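(* Let $1\leq p,q,r<\infty$ and let $\pmb{w}=\{w_j\}_{j\in\mathbb{Z}}$ be a vector weight (with $w_j\ge0$) such that, for some $\varepsilon>0$, $$w_j\lesssim \begin{cases} 2^{-\varepsilon j} & \text{if } j\geq 0,\\ 2^{-\left(\frac{d}{p'}-\frac{d}{q}-\varepsilon\right)j} & \text{if } j<0,\end{cases}$$ with an implicit constant independent of $j$. Define the vector weight $\pmb{\sigma}=\{\sigma_j\}_{j\in\mathbb{Z}}$ by $$\sigma_j=\begin{cases}2^{-jd\,|1-\frac2p|}\,w_j & \text{if } j\ge 0,\\ w_j & \text{if } j<0.\end{cases}$$ Then for every $t\in\mathbb{R}$ the Schrödinger operator $S(t)=e^{-it\Delta}$ is bounded from $\mathfrak{M}^{p,q,r}_{\pmb{w}}(\mathbb{R}^d)$ to $\mathfrak{M}^{p,q,r}_{\pmb{\sigma}}(\mathbb{R}^d)$, and there is a constant $C>0$, independent of $t$ and $f$, such that $$\|S(t)f\|_{\mathfrak{M}^{p,q,r}_{\pmb{\sigma}}}\le C\,\langle t\rangle^{d\,|\frac12-\frac1p|}\,\|f\|_{\mathfrak{M}^{p,q,r}_{\pmb{w}}}$$ for all $t\in\mathbb{R}$ and all $f\in\mathfrak{M}^{p,q,r}_{\pmb{w}}(\mathbb{R}^d)$.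
   Context: $\langle t\rangle=(1+|t|^2)^{1/2}$; $p'$ is the conjugate exponent, $\frac1p+\frac1{p'}=1$. The Fourier transform is $\widehat f(\xi)=\int_{\mathbb{R}^d} f(x)e^{-2\pi i x\cdot\xi}\,dx$. $S(t)=e^{-it\Delta}$ is the Fourier multiplier operator with multiplier $e^{4\pi^2 i t|\xi|^2}$, i.e. $\widehat{S(t)f}(\xi)=e^{4\pi^2it|\xi|^2}\widehat f(\xi)$. Fix $\psi\in\mathcal{S}(\mathbb{R}^d)$ (Schwartz class) with $\operatorname{supp}\psi\subset[-1,1]^d$ and $\sum_{k\in\mathbb{Z}^d}\psi(\xi-k)\equiv 1$. For $j\in\mathbb{Z}$ and $k\in\mathbb{Z}^d$ let $$\psi_{j,k}(D)f(x)=\int_{\mathbb{R}^d}\psi(2^{-j}\xi-k)\widehat f(\xi)e^{2\pi i x\cdot\xi}\,d\xi ,\qquad \|f\|_{M^{p,q}_{[j]}}=\Big(\sum_{k\in\mathbb{Z}^d}\|\psi_{j,k}(D)f\|_{L^p(\mathbb{R}^d)}^q\Big)^{1/q}.$$ For a vector weight $\pmb{w}=\{w_j\}_{j\in\mathbb{Z}}$, $w_j\ge 0$, and $1\le p,q,r<\infty$, $\mathfrak{M}^{p,q,r}_{\pmb{w}}(\mathbb{R}^d)$ is the collection of all tempered distributions $f\in\mathcal{S}'(\mathbb{R}^d)$ such that $$\|f\|_{\mathfrak{M}^{p,q,r}_{\pmb{w}}}:=\Big(\sum_{j\in\mathbb{Z}}w_j^r\|f\|_{M^{p,q}_{[j]}}^r\Big)^{1/r}<\infty.$$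 *)

theory Defs
  imports "HOL-Analysis.Analysis"
begin

section \<open>Schwartz functions and tempered distributions\<close>

definition partial_deriv :: "'n::finite \<Rightarrow> (real^'n \<Rightarrow> complex) \<Rightarrow> real^'n \<Rightarrow> complex" where
  "partial_deriv i f = (\<lambda>x. frechet_derivative f (at x) (axis i 1))"

text \<open>Iterated partial derivatives are indexed by lists of coordinates instead of multi-indices;
  for smooth functions the order of the list is irrelevant.\<close>

definition partial_derivs :: "'n::finite list \<Rightarrow> (real^'n \<Rightarrow> complex) \<Rightarrow> real^'n \<Rightarrow> complex" where
  "partial_derivs \<alpha> f = foldr partial_deriv \<alpha> f"

definition smooth :: "(real^'n::finite \<Rightarrow> complex) \<Rightarrow> bool" where
  "smooth f \<longleftrightarrow> (\<forall>\<alpha>. partial_derivs \<alpha> f differentiable_on UNIV)"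

definition schwartz :: "(real^'n::finite \<Rightarrow> complex) \<Rightarrow> bool" where
  "schwartz f \<longleftrightarrow> smooth f \<and>
     (\<forall>N \<alpha>. bdd_above (range (\<lambda>x. (1 + norm x) ^ N * norm (partial_derivs \<alpha> f x))))"

definition schwartz_seminorm :: "nat \<Rightarrow> 'n::finite list \<Rightarrow> (real^'n \<Rightarrow> complex) \<Rightarrow> real" where
  "schwartz_seminorm N \<alpha> f = (SUP x. (1 + norm x) ^ N * norm (partial_derivs \<alpha> f x))"

type_synonym 'n dist = "(real^'n \<Rightarrow> complex) \<Rightarrow> complex"

text \<open>A tempered distribution is a linear functional on the Schwartz functions that is continuous
  for the topology of the seminorms above. The values of the HOL function on arguments that are
  not Schwartz functions carry no information and are never used.\<close>

definition tempered :: "'n::finite dist \<Rightarrow> bool" where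
  "tempered u \<longleftrightarrow>
     (\<forall>\<phi> \<theta>. schwartz \<phi> \<longrightarrow> schwartz \<theta> \<longrightarrow> u (\<lambda>x. \<phi> x + \<theta> x) = u \<phi> + u \<theta>) \<and>
     (\<forall>c \<phi>. schwartz \<phi> \<longrightarrow> u (\<lambda>x. c * \<phi> x) = c * u \<phi>) \<and>
     (\<exists>C N. \<forall>\<phi>. schwartz \<phi> \<longrightarrow>
        norm (u \<phi>) \<le> C * (\<Sum>\<alpha> | length \<alpha> \<le> N. schwartz_seminorm N \<alpha> \<phi>))"

section \<open>Fourier transform and Fourier multipliers\<close>

definition fourier :: "(real^'n::finite \<Rightarrow> complex) \<Rightarrow> real^'n \<Rightarrow> complex" where
  "fourier f \<xi> = (\<integral>x. f x * cis (- 2 * pi * (x \<bullet> \<xi>)) \<partial>lborel)"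

definition inv_fourier :: "(real^'n::finite \<Rightarrow> complex) \<Rightarrow> real^'n \<Rightarrow> complex" where
  "inv_fourier f x = (\<integral>\<xi>. f \<xi> * cis (2 * pi * (x \<bullet> \<xi>)) \<partial>lborel)"

text \<open>The corresponding operations on tempered distributions are defined by transposition.\<close>

definition dist_fourier :: "'n::finite dist \<Rightarrow> 'n dist" where
  "dist_fourier u = (\<lambda>\<phi>. u (fourier \<phi>))"

definition dist_inv_fourier :: "'n::finite dist \<Rightarrow> 'n dist" where
  "dist_inv_fourier u = (\<lambda>\<phi>. u (inv_fourier \<phi>))"

definition dist_mult :: "(real^'n::finite \<Rightarrow> complex) \<Rightarrow> 'n dist \<Rightarrow> 'n dist" where
  "dist_mult m u = (\<lambda>\<phi>. u (\<lambda>x. m x * \<phi> x))"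

definition fourier_multiplier :: "(real^'n::finite \<Rightarrow> complex) \<Rightarrow> 'n dist \<Rightarrow> 'n dist" where
  "fourier_multiplier m u = dist_inv_fourier (dist_mult m (dist_fourier u))"

definition schrodinger :: "real \<Rightarrow> 'n::finite dist \<Rightarrow> 'n dist" where
  "schrodinger t = fourier_multiplier (\<lambda>\<xi>. cis (4 * pi\<^sup>2 * t * (norm \<xi>)\<^sup>2))"

section \<open>The function spaces\<close>

definition of_int_vec :: "int^'n \<Rightarrow> real^'n" where
  "of_int_vec k = (\<chi> i. of_int (k $ i))"

definition supp :: "(real^'n::finite \<Rightarrow> complex) \<Rightarrow> (real^'n) set" where
  "supp f = closure {x. f x \<noteq> 0}"

definition decomposition_function :: "(real^'n::finite \<Rightarrow> complex) \<Rightarrow> bool" where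
  "decomposition_function \<psi> \<longleftrightarrow>
     schwartz \<psi> \<and> supp \<psi> \<subseteq> {x. \<forall>i. - 1 \<le> x $ i \<and> x $ i \<le> 1} \<and>
     (\<forall>\<xi>. ((\<lambda>k. \<psi> (\<xi> - of_int_vec k)) has_sum 1) UNIV)"

text \<open>For a tempered distribution \<open>u\<close>, the Fourier integral of \<open>\<psi> (2^(-j) \<xi> - k)\<close> times the
  Fourier transform of \<open>u\<close> is read as the pairing of that transform with the Schwartz function
  \<open>\<xi> \<mapsto> \<psi> (2^(-j) \<xi> - k) exp (2 \<pi> i x \<bullet> \<xi>)\<close>; it is a smooth function of \<open>x\<close>.\<close>

definition freq_proj ::
    "(real^'n::finite \<Rightarrow> complex) \<Rightarrow> int \<Rightarrow> int^'n \<Rightarrow> 'n dist \<Rightarrow> real^'n \<Rightarrow> complex" where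
  "freq_proj \<psi> j k u x =
     dist_fourier u (\<lambda>\<xi>. \<psi> ((2 powi (- j)) *\<^sub>R \<xi> - of_int_vec k) * cis (2 * pi * (x \<bullet> \<xi>)))"

text \<open>Powers with a positive real exponent on \<open>[0,\<infinity>]\<close>.\<close>

definition epowr :: "ennreal \<Rightarrow> real \<Rightarrow> ennreal" where
  "epowr x a = (if x = \<infinity> then \<infinity> else ennreal (enn2real x powr a))"

definition Lp_norm :: "real \<Rightarrow> (real^'n::finite \<Rightarrow> complex) \<Rightarrow> ennreal" where
  "Lp_norm p g = epowr (\<integral>\<^sup>+x. ennreal (norm (g x) powr p) \<partial>lborel) (1 / p)"

definition modulation_norm ::
    "(real^'n::finite \<Rightarrow> complex) \<Rightarrow> real \<Rightarrow> real \<Rightarrow> int \<Rightarrow> 'n dist \<Rightarrow> ennreal" where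
  "modulation_norm \<psi> p q j u =
     epowr (\<Sum>\<^sub>\<infinity>k. epowr (Lp_norm p (freq_proj \<psi> j k u)) q) (1 / q)"

text \<open>As usual, \<open>0 \<cdot> \<infinity> = 0\<close>: indices with \<open>w j = 0\<close> impose no condition.\<close>

definition frakM_norm ::
    "(real^'n::finite \<Rightarrow> complex) \<Rightarrow> real \<Rightarrow> real \<Rightarrow> real \<Rightarrow> (int \<Rightarrow> real) \<Rightarrow> 'n dist \<Rightarrow> ennreal" where
  "frakM_norm \<psi> p q r w u =
     epowr (\<Sum>\<^sub>\<infinity>j. ennreal (w j powr r) * epowr (modulation_norm \<psi> p q j u) r) (1 / r)"

definition frakM ::
    "(real^'n::finite \<Rightarrow> complex) \<Rightarrow> real \<Rightarrow> real \<Rightarrow> real \<Rightarrow> (int \<Rightarrow> real) \<Rightarrow> 'n dist set" where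
  "frakM \<psi> p q r w = {u. tempered u \<and> frakM_norm \<psi> p q r w u < \<infinity>}"

text \<open>\<open>1 / p'\<close> for the conjugate exponent \<open>p'\<close> of \<open>p\<close>; it is \<open>0\<close> when \<open>p = 1\<close>, \<open>p' = \<infinity>\<close>.\<close>

definition inverse_conj :: "real \<Rightarrow> real" where
  "inverse_conj p = 1 - 1 / p"

definition japanese :: "real \<Rightarrow> real" where
  "japanese t = sqrt (1 + \<bar>t\<bar>\<^sup>2)"

definition schrodinger_weight :: "real \<Rightarrow> real \<Rightarrow> (int \<Rightarrow> real) \<Rightarrow> int \<Rightarrow> real" where
  "schrodinger_weight d p w j =
     (if j \<ge> 0 then 2 powr (- of_int j * d * \<bar>1 - 2 / p\<bar>) * w j else w j)"

end

theory Submission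
  imports Defs
begin

text \<open>The bound holds for each scale \<open>j\<close> and each cube \<open>k\<close> separately. Rescaling and translating
  the cube \<open>k\<close> of side \<open>2^j\<close> to the unit cube turns the propagator into the multiplier
  \<open>exp (i s \<bar>\<eta>\<bar>\<^sup>2)\<close> with \<open>s = 4 \<pi>\<^sup>2 t 4^j\<close>; the linear part of the phase is a translation in space.

  Cut off smoothly and expanded in a Fourier series on a larger cube, the multiplier acts as a discrete
  convolution on the samples \<open>v (\<psi> e_(x + n / L))\<close> of the localized distribution, for every offset \<open>x\<close>.
  The coefficients have $\ell^1$ norm \<open>O((1 + \<bar>s\<bar>)^(d/2))\<close>, which bounds the convolution on $\ell^1$ and
  $\ell^\infty$, and Bessel's inequality bounds it on $\ell^2$ uniformly in \<open>s\<close>. Marcinkiewicz interpolation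
  gives the factor \<open>(1 + \<bar>s\<bar>)^(d \<bar>1/2 - 1/p\<bar>)\<close> on $\ell^p$, and integration over the offsets the same factor on
  $L^p$. For \<open>j \<ge> 0\<close> the resulting growth \<open>2^(j d \<bar>1 - 2/p\<bar>)\<close> is what the weight \<open>\<sigma>\<close> absorbs.\<close>

subsection \<open>Iterated partial derivatives\<close>

text \<open>The given object is only a tempered distribution, so its localized pieces are known
  solely through pairings, and no convolution with an integrable kernel is available at the outset.
  Passing to the Fourier series of the multiplier leaves only pairings with modulations, and the
  analytic core becomes a set of inequalities for sequences. The test functions at hand have compact
  support in frequency, so Fourier inversion is needed only for such functions and follows from the
  same Fourier series.

  The exponent survives interpolation because the splitting heights are scaled by the l^1 bound
  \<open>A\<close>: this yields exactly \<open>A powr |p - 2|\<close>, with a constant depending on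
  \<open>p\<close> and the l^2 bound alone. With \<open>A\<close> of size (1 + |s|)^(d/2), the p-th
  root has exponent d |1/2 - 1/p|. The range p > 2 is treated directly between l^2 and l^infinity,
  without duality.

  The spatial translation is a multiple of the cube index and thus unbounded in \<open>k\<close>,
  but L^p norms do not see it; the bound is uniform over all cubes of one scale.\<close>

lemma partial_derivs_Nil [simp]: "partial_derivs [] f = f"
  by (simp add: partial_derivs_def)

lemma partial_derivs_Cons: "partial_derivs (i # \<alpha>) f = partial_deriv i (partial_derivs \<alpha> f)"
  by (simp add: partial_derivs_def)

text \<open>Inductions on derivative lists peel off the innermost derivative with this identity: it
  hits \<open>f\<close> itself, where the product and chain rules are known, and leaves a shorter
  list acting on another function of the same class.\<close>

lemma partial_derivs_snoc: "partial_derivs (\<alpha> @ [i]) f = partial_derivs \<alpha> (partial_deriv i f)"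
  by (simp add: partial_derivs_def)

lemma partial_deriv_unique:
  assumes "(f has_derivative f') (at x)"
  shows "partial_deriv i f x = f' (axis i 1)"
  using frechet_derivative_at[OF assms] by (simp add: partial_deriv_def)

lemma differentiable_UNIV_D:
  assumes "f differentiable_on UNIV"
  shows "(f has_derivative frechet_derivative f (at x)) (at x)"
  using assms by (auto simp: differentiable_on_def frechet_derivative_works)

lemma partial_deriv_add:
  assumes "f differentiable_on UNIV" "g differentiable_on UNIV"
  shows "partial_deriv i (\<lambda>x. f x + g x) = (\<lambda>x. partial_deriv i f x + partial_deriv i g x)"
proof
  fix x
  show "partial_deriv i (\<lambda>x. f x + g x) x = partial_deriv i f x + partial_deriv i g x"
    using partial_deriv_unique[OF has_derivative_add[OF
        differentiable_UNIV_D[OF assms(1)] differentiable_UNIV_D[OF assms(2)]], of i x]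
    by (simp add: partial_deriv_def)
qed

lemma partial_deriv_mult:
  assumes "f differentiable_on UNIV" "g differentiable_on UNIV"
  shows "partial_deriv i (\<lambda>x. f x * g x) = (\<lambda>x. partial_deriv i f x * g x + f x * partial_deriv i g x)"
proof
  fix x
  show "partial_deriv i (\<lambda>x. f x * g x) x = partial_deriv i f x * g x + f x * partial_deriv i g x"
    using partial_deriv_unique[OF has_derivative_mult[OF
        differentiable_UNIV_D[OF assms(1)] differentiable_UNIV_D[OF assms(2)]], of i x]
    by (simp add: partial_deriv_def)
qed

lemma partial_deriv_const [simp]: "partial_deriv i (\<lambda>x. c) = (\<lambda>x. 0)"
proof
  show "partial_deriv i (\<lambda>x. c) x = 0" for x
    using partial_deriv_unique[OF has_derivative_const[of c "at x"], of i] by simp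
qed

lemma partial_deriv_cmult:
  assumes "f differentiable_on UNIV"
  shows "partial_deriv i (\<lambda>x. c * f x) = (\<lambda>x. c * partial_deriv i f x)"
  using partial_deriv_mult[of "\<lambda>x. c" f] assms by simp

subsection \<open>Smoothness\<close>

text \<open>\<open>smooth\<close> speaks of all derivative lists at once and gives no induction.
  Counting the order does: by the product rule, order \<open>Suc n\<close> of a product rests on
  order \<open>n\<close> of products of the factors and their first derivatives.\<close>

fun smooth_upto :: "nat \<Rightarrow> (real^'n::finite \<Rightarrow> complex) \<Rightarrow> bool" where
  "smooth_upto 0 f \<longleftrightarrow> f differentiable_on UNIV"
| "smooth_upto (Suc n) f \<longleftrightarrow> f differentiable_on UNIV \<and> (\<forall>i. smooth_upto n (partial_deriv i f))"

lemma smooth_upto_differentiable: "smooth_upto n f \<Longrightarrow> f differentiable_on UNIV"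
  by (cases n) auto

lemma smooth_upto_Suc_D: "smooth_upto (Suc n) f \<Longrightarrow> smooth_upto n f"
  by (induction n arbitrary: f) auto

lemma smooth_upto_iff: "smooth_upto n f \<longleftrightarrow> (\<forall>\<alpha>. length \<alpha> \<le> n \<longrightarrow> partial_derivs \<alpha> f differentiable_on UNIV)"
proof (induction n arbitrary: f)
  case 0
  then show ?case by simp
next
  case (Suc n)
  show ?case
  proof
    assume L: "smooth_upto (Suc n) f"
    show "\<forall>\<alpha>. length \<alpha> \<le> Suc n \<longrightarrow> partial_derivs \<alpha> f differentiable_on UNIV"
    proof (intro allI impI)
      fix \<alpha> :: "'a list" assume "length \<alpha> \<le> Suc n"
      then show "partial_derivs \<alpha> f differentiable_on UNIV"
        using L Suc.IH by (cases \<alpha> rule: rev_cases) (auto simp: partial_derivs_snoc)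
    qed
  next
    assume R: "\<forall>\<alpha>. length \<alpha> \<le> Suc n \<longrightarrow> partial_derivs \<alpha> f differentiable_on UNIV"
    have "f differentiable_on UNIV" using R[rule_format, of "[]"] by simp
    moreover have "smooth_upto n (partial_deriv i f)" for i
      unfolding Suc.IH partial_derivs_snoc[symmetric] using R by simp
    ultimately show "smooth_upto (Suc n) f" by simp
  qed
qed

lemma smooth_iff_upto: "smooth f \<longleftrightarrow> (\<forall>n. smooth_upto n f)"
  unfolding smooth_def smooth_upto_iff by blast

lemma smooth_differentiable: "smooth f \<Longrightarrow> f differentiable_on UNIV"
  using smooth_iff_upto smooth_upto_differentiable by blast

lemma smooth_partial_deriv: "smooth f \<Longrightarrow> smooth (partial_deriv i f)"
  by (metis partial_derivs_snoc smooth_def)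

lemma smooth_partial_derivs: "smooth f \<Longrightarrow> smooth (partial_derivs \<alpha> f)"
  by (induction \<alpha>) (auto simp: partial_derivs_Cons smooth_partial_deriv)

lemma smooth_has_derivative:
  "smooth f \<Longrightarrow> (f has_derivative frechet_derivative f (at x)) (at x)"
  by (intro differentiable_UNIV_D smooth_differentiable)

lemma smooth_upto_add:
  "smooth_upto n f \<Longrightarrow> smooth_upto n g \<Longrightarrow> smooth_upto n (\<lambda>x. f x + g x)"
proof (induction n arbitrary: f g)
  case (Suc n)
  then show ?case
    using partial_deriv_add[of f g] by (auto intro!: differentiable_on_add)
qed (auto intro!: differentiable_on_add)

lemma smooth_upto_mult:
  "smooth_upto n f \<Longrightarrow> smooth_upto n g \<Longrightarrow> smooth_upto n (\<lambda>x. f x * g x)"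
proof (induction n arbitrary: f g)
  case (Suc n)
  have "smooth_upto n f" "smooth_upto n g" using Suc.prems smooth_upto_Suc_D by blast+
  with Suc show ?case
    using partial_deriv_mult[of f g]
    by (auto intro!: smooth_upto_add differentiable_on_mult)
qed (auto intro!: differentiable_on_mult)

lemma smooth_add: "smooth f \<Longrightarrow> smooth g \<Longrightarrow> smooth (\<lambda>x. f x + g x)"
  by (simp add: smooth_iff_upto smooth_upto_add)

lemma smooth_mult: "smooth f \<Longrightarrow> smooth g \<Longrightarrow> smooth (\<lambda>x. f x * g x)"
  by (simp add: smooth_iff_upto smooth_upto_mult)

lemma smooth_upto_const: "smooth_upto n (\<lambda>x. c)"
  by (induction n arbitrary: c) auto

lemma smooth_const: "smooth (\<lambda>x. c)"
  by (simp add: smooth_iff_upto smooth_upto_const)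

lemma smooth_cmult: "smooth f \<Longrightarrow> smooth (\<lambda>x. c * f x)"
  by (intro smooth_mult smooth_const)

lemma smooth_sum: "(\<And>k. k \<in> A \<Longrightarrow> smooth (f k)) \<Longrightarrow> smooth (\<lambda>x. \<Sum>k\<in>A. f k x)"
  by (induction A rule: infinite_finite_induct) (auto intro: smooth_const smooth_add)

lemma partial_derivs_add:
  "smooth f \<Longrightarrow> smooth g \<Longrightarrow>
    partial_derivs \<alpha> (\<lambda>x. f x + g x) = (\<lambda>x. partial_derivs \<alpha> f x + partial_derivs \<alpha> g x)"
proof (induction \<alpha> arbitrary: f g rule: rev_induct)
  case (snoc i \<alpha>)
  then show ?case
    by (simp add: partial_derivs_snoc partial_deriv_add smooth_differentiable smooth_partial_deriv)
qed simp

lemma partial_derivs_cmult: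
  "smooth f \<Longrightarrow> partial_derivs \<alpha> (\<lambda>x. c * f x) = (\<lambda>x. c * partial_derivs \<alpha> f x)"
proof (induction \<alpha> arbitrary: f rule: rev_induct)
  case (snoc i \<alpha>)
  then show ?case
    by (simp add: partial_derivs_snoc partial_deriv_cmult smooth_differentiable smooth_partial_deriv)
qed simp

section \<open>Coordinate factors and quadratic phases\<close>

definition coord_mult :: "'n \<Rightarrow> (real^'n::finite \<Rightarrow> complex) \<Rightarrow> real^'n \<Rightarrow> complex" where
  "coord_mult i f = (\<lambda>x. of_real (x $ i) * f x)"

lemma has_derivative_coord: "((\<lambda>x::real^'n::finite. complex_of_real (x $ i)) has_derivative (\<lambda>h. of_real (h $ i))) (at x)"
  by (rule bounded_linear_imp_has_derivative)
     (rule bounded_linear_compose[OF bounded_linear_of_real bounded_linear_vec_nth])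

lemma partial_deriv_coord:
  "partial_deriv j (\<lambda>x::real^'n::finite. complex_of_real (x $ i)) = (\<lambda>x. if i = j then 1 else 0)"
proof
  show "partial_deriv j (\<lambda>x::real^'n::finite. complex_of_real (x $ i)) x = (if i = j then 1 else 0)" for x
    using partial_deriv_unique[OF has_derivative_coord, of j i x] by (auto simp: axis_def)
qed

lemma differentiable_coord: "(\<lambda>x::real^'n::finite. complex_of_real (x $ i)) differentiable_on UNIV"
  using has_derivative_coord by (auto simp: differentiable_on_def differentiable_def)

lemma smooth_coord: "smooth (\<lambda>x::real^'n::finite. complex_of_real (x $ i))"
proof -
  have "smooth_upto n (\<lambda>x::real^'n::finite. complex_of_real (x $ i))" for n
    by (cases n) (auto simp: partial_deriv_coord differentiable_coord smooth_upto_const)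
  then show ?thesis by (simp add: smooth_iff_upto)
qed

lemma smooth_coord_mult: "smooth f \<Longrightarrow> smooth (coord_mult i f)"
  unfolding coord_mult_def by (intro smooth_mult smooth_coord)

lemma partial_deriv_coord_mult:
  "smooth f \<Longrightarrow> partial_deriv j (coord_mult i f) =
     (\<lambda>x. (if i = j then 1 else 0) * f x + coord_mult i (partial_deriv j f) x)"
  by (simp add: coord_mult_def partial_deriv_mult partial_deriv_coord differentiable_coord smooth_differentiable)

text \<open>The family contains the characters (\<open>s = 0\<close>) and the symbol of the
  propagator (\<open>y = 0\<close>); it is closed under products and, up to a constant phase, under
  affine substitution. The quadratic part carries no factor 2 pi, which is why divisions by
  \<open>pi\<close> occur later.\<close>

definition phase :: "real^'n::finite \<Rightarrow> real \<Rightarrow> real^'n \<Rightarrow> complex" where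
  "phase y s x = cis (2 * pi * (y \<bullet> x) + s * (norm x)\<^sup>2)"

lemma norm_phase [simp]: "norm (phase y s x) = 1"
  by (simp add: phase_def)

lemma has_derivative_phase:
  "(phase y s has_derivative (\<lambda>h. phase y s x * (\<i> * of_real (2 * pi * (y \<bullet> h) + 2 * s * (x \<bullet> h))))) (at x)"
proof -
  have "((\<lambda>x. \<i> * of_real (2 * pi * (y \<bullet> x) + s * (x \<bullet> x))) has_derivative
      (\<lambda>h. \<i> * of_real (2 * pi * (y \<bullet> h) + 2 * s * (x \<bullet> h)))) (at x)"
    by (auto intro!: derivative_eq_intros simp: inner_commute algebra_simps)
  from has_derivative_compose[OF this, of exp "\<lambda>h. exp (\<i> * of_real (2 * pi * (y \<bullet> x) + s * (x \<bullet> x))) * h"]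
  show ?thesis
    by (simp add: phase_def[abs_def] cis_conv_exp power2_norm_eq_inner has_field_derivative_imp_has_derivative DERIV_exp)
qed

lemma differentiable_phase: "phase y s differentiable_on UNIV"
  using has_derivative_phase by (auto simp: differentiable_on_def differentiable_def)

lemma partial_deriv_phase:
  "partial_deriv i (phase y s) = (\<lambda>x. (\<i> * of_real (2 * pi * y $ i) + \<i> * of_real (2 * s) * of_real (x $ i)) * phase y s x)"
proof
  show "partial_deriv i (phase y s) x = (\<i> * of_real (2 * pi * y $ i) + \<i> * of_real (2 * s) * of_real (x $ i)) * phase y s x" for x
    using partial_deriv_unique[OF has_derivative_phase, of i y s x]
    by (simp add: inner_axis algebra_simps)
qed

text \<open>The derivative of a phase is an affine function times the same phase, so smoothness to
  order \<open>n\<close> feeds back into the proof of order \<open>Suc n\<close>.\<close>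

lemma smooth_phase: "smooth (phase y s)"
proof -
  have "smooth_upto n (phase y s)" for n
  proof (induction n)
    case (Suc n)
    have "smooth_upto n (\<lambda>x. (\<i> * of_real (2 * pi * y $ i) + \<i> * of_real (2 * s) * of_real (x $ i)) * phase y s x)" for i
      using smooth_coord[of i] Suc smooth_iff_upto
      by (intro smooth_upto_mult smooth_upto_add smooth_upto_const) auto
    then show ?case by (simp add: partial_deriv_phase differentiable_phase)
  qed (simp add: differentiable_phase)
  then show ?thesis by (simp add: smooth_iff_upto)
qed

text \<open>Arranged so that each term is a constant times the same phase times a function obtained
  from \<open>f\<close> alone, namely \<open>partial_deriv i f\<close>, \<open>f\<close> or
  \<open>coord_mult i f\<close>; the induction in \<open>phase_mult_bound\<close> needs this
  shape.\<close>

lemma partial_deriv_phase_mult: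
  assumes "smooth f"
  shows "partial_deriv i (\<lambda>x. phase y s x * f x) = (\<lambda>x. phase y s x * partial_deriv i f x +
    (\<i> * of_real (2 * pi * y $ i) * (phase y s x * f x) + \<i> * of_real (2 * s) * (phase y s x * coord_mult i f x)))"
  by (simp add: partial_deriv_mult partial_deriv_phase differentiable_phase smooth_differentiable assms
      coord_mult_def algebra_simps)

section \<open>Affine substitutions\<close>

lemma has_derivative_affine:
  assumes "smooth f"
  shows "((\<lambda>x. f (a *\<^sub>R x - b)) has_derivative (\<lambda>h. frechet_derivative f (at (a *\<^sub>R x - b)) (a *\<^sub>R h))) (at x)"
  by (rule has_derivative_compose[OF _ smooth_has_derivative[OF assms]])
     (auto intro!: derivative_eq_intros)

lemma partial_deriv_affine:
  assumes "smooth f"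
  shows "partial_deriv i (\<lambda>x. f (a *\<^sub>R x - b)) = (\<lambda>x. of_real a * partial_deriv i f (a *\<^sub>R x - b))"
proof
  fix x
  have "linear (frechet_derivative f (at (a *\<^sub>R x - b)))"
    using smooth_has_derivative[OF assms] has_derivative_linear by blast
  then show "partial_deriv i (\<lambda>x. f (a *\<^sub>R x - b)) x = of_real a * partial_deriv i f (a *\<^sub>R x - b)"
    using partial_deriv_unique[OF has_derivative_affine[OF assms], of i a b x]
    by (simp add: partial_deriv_def linear_scale scaleR_conv_of_real[where 'a=complex])
qed

lemma differentiable_affine: "smooth f \<Longrightarrow> (\<lambda>x. f (a *\<^sub>R x - b)) differentiable_on UNIV"
  unfolding differentiable_on_def differentiable_def using has_derivative_affine by fast

lemma smooth_affine:
  fixes f :: "real^'n::finite \<Rightarrow> complex"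
  assumes "smooth f" shows "smooth (\<lambda>x. f (a *\<^sub>R x - b))"
proof -
  have "smooth_upto n (\<lambda>x. f (a *\<^sub>R x - b))" if "smooth f" for n and f :: "real^'n \<Rightarrow> complex"
    using that
  proof (induction n arbitrary: f)
    case 0
    then show ?case by (simp add: differentiable_affine)
  next
    case (Suc n)
    then show ?case
      by (auto simp: differentiable_affine partial_deriv_affine intro!: smooth_upto_mult smooth_upto_const smooth_partial_deriv)
  qed
  then show ?thesis using assms by (simp add: smooth_iff_upto)
qed

lemma partial_derivs_affine:
  "smooth f \<Longrightarrow> partial_derivs \<alpha> (\<lambda>x. f (a *\<^sub>R x - b)) = (\<lambda>x. of_real a ^ length \<alpha> * partial_derivs \<alpha> f (a *\<^sub>R x - b))"
proof (induction \<alpha> arbitrary: f rule: rev_induct)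
  case (snoc i \<alpha>)
  then show ?case
    by (simp add: partial_derivs_snoc partial_deriv_affine partial_derivs_cmult smooth_partial_deriv smooth_affine mult.assoc)
qed simp

subsection \<open>Schwartz functions\<close>

text \<open>The sum of seminorms that occurs in \<open>tempered\<close>. One index bounds both the
  weight and the order of the derivatives, so these quantities increase with \<open>N\<close> and
  finitely many estimates can be merged into one.\<close>

definition schwartz_sum :: "nat \<Rightarrow> (real^'n::finite \<Rightarrow> complex) \<Rightarrow> real" where
  "schwartz_sum N \<phi> = (\<Sum>\<alpha> | length \<alpha> \<le> N. schwartz_seminorm N \<alpha> \<phi>)"

lemma finite_lists_length_le_UNIV [simp]: "finite {\<alpha> :: 'n::finite list. length \<alpha> \<le> N}"
  using finite_lists_length_le[OF finite_class.finite_UNIV[where 'a='n], of N] by simp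

lemma schwartz_smooth: "schwartz f \<Longrightarrow> smooth f"
  by (simp add: schwartz_def)

lemma schwartz_bdd: "schwartz f \<Longrightarrow> bdd_above (range (\<lambda>x. (1 + norm x) ^ N * norm (partial_derivs \<alpha> f x)))"
  by (simp add: schwartz_def)

lemma schwartz_seminorm_upper:
  "schwartz f \<Longrightarrow> (1 + norm x) ^ N * norm (partial_derivs \<alpha> f x) \<le> schwartz_seminorm N \<alpha> f"
  unfolding schwartz_seminorm_def by (rule cSUP_upper) (auto intro: schwartz_bdd)

lemma schwartz_seminorm_nonneg: "schwartz f \<Longrightarrow> 0 \<le> schwartz_seminorm N \<alpha> f"
  by (rule order_trans[OF _ schwartz_seminorm_upper[of f 0]]) auto

lemma schwartz_sum_nonneg: "schwartz f \<Longrightarrow> 0 \<le> schwartz_sum N f"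
  unfolding schwartz_sum_def by (intro sum_nonneg schwartz_seminorm_nonneg)

lemma schwartz_sum_upper:
  assumes "schwartz f" "length \<alpha> \<le> K" "N \<le> K"
  shows "(1 + norm x) ^ N * norm (partial_derivs \<alpha> f x) \<le> schwartz_sum K f"
proof -
  have "(1 + norm x) ^ N * norm (partial_derivs \<alpha> f x) \<le> (1 + norm x) ^ K * norm (partial_derivs \<alpha> f x)"
    using assms by (intro mult_right_mono power_increasing) auto
  also have "\<dots> \<le> schwartz_seminorm K \<alpha> f" by (rule schwartz_seminorm_upper) fact
  also have "\<dots> \<le> schwartz_sum K f"
    unfolding schwartz_sum_def
    using assms by (intro member_le_sum schwartz_seminorm_nonneg) auto
  finally show ?thesis .
qed

lemma schwartz_sum_le:
  fixes f :: "real^'n::finite \<Rightarrow> complex"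
  assumes "\<And>\<alpha> x. length \<alpha> \<le> K \<Longrightarrow> (1 + norm x) ^ K * norm (partial_derivs \<alpha> f x) \<le> B"
  shows "schwartz_sum K f \<le> real (card {\<alpha> :: 'n::finite list. length \<alpha> \<le> K}) * B"
  unfolding schwartz_sum_def schwartz_seminorm_def
  by (rule sum_bounded_above) (auto intro!: cSUP_least assms)

lemma schwartz_sum_mono:
  assumes "schwartz f" "K \<le> L"
  shows "schwartz_sum K f \<le> schwartz_sum L f"
proof -
  have "schwartz_sum K f \<le> (\<Sum>\<alpha> | length \<alpha> \<le> K. schwartz_seminorm L \<alpha> f)"
    unfolding schwartz_sum_def
  proof (rule sum_mono)
    fix \<alpha>
    show "schwartz_seminorm K \<alpha> f \<le> schwartz_seminorm L \<alpha> f"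
      unfolding schwartz_seminorm_def[of K]
    proof (rule cSUP_least)
      fix x
      have "(1 + norm x) ^ K * norm (partial_derivs \<alpha> f x) \<le> (1 + norm x) ^ L * norm (partial_derivs \<alpha> f x)"
        using assms by (intro mult_right_mono power_increasing) auto
      also have "\<dots> \<le> schwartz_seminorm L \<alpha> f" by (rule schwartz_seminorm_upper) fact
      finally show "(1 + norm x) ^ K * norm (partial_derivs \<alpha> f x) \<le> schwartz_seminorm L \<alpha> f" .
    qed simp
  qed
  also have "\<dots> \<le> schwartz_sum L f" unfolding schwartz_sum_def
    by (rule sum_mono2) (use assms in \<open>auto intro: schwartz_seminorm_nonneg\<close>)
  finally show ?thesis .
qed

lemma schwartzI:
  assumes "smooth f" "\<And>N \<alpha>. \<exists>B. \<forall>x. (1 + norm x) ^ N * norm (partial_derivs \<alpha> f x) \<le> B"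
  shows "schwartz f"
  unfolding schwartz_def using assms by (auto simp: bdd_above_def)

text \<open>These are the continuous linear maps between Schwartz spaces. They are closed under
  composition and their transposes preserve temperedness, so each operation on distributions reduces
  to checking its building blocks.\<close>

definition schwartz_op :: "((real^'n::finite \<Rightarrow> complex) \<Rightarrow> real^'m::finite \<Rightarrow> complex) \<Rightarrow> bool" where
  "schwartz_op T \<longleftrightarrow>
     (\<forall>\<phi>. schwartz \<phi> \<longrightarrow> schwartz (T \<phi>)) \<and>
     (\<forall>\<phi> \<theta>. schwartz \<phi> \<longrightarrow> schwartz \<theta> \<longrightarrow> T (\<lambda>x. \<phi> x + \<theta> x) = (\<lambda>x. T \<phi> x + T \<theta> x)) \<and>
     (\<forall>c \<phi>. schwartz \<phi> \<longrightarrow> T (\<lambda>x. c * \<phi> x) = (\<lambda>x. c * T \<phi> x)) \<and>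
     (\<forall>K. \<exists>C L. \<forall>\<phi>. schwartz \<phi> \<longrightarrow> schwartz_sum K (T \<phi>) \<le> C * schwartz_sum L \<phi>)"

lemma schwartz_op_schwartz: "schwartz_op T \<Longrightarrow> schwartz \<phi> \<Longrightarrow> schwartz (T \<phi>)"
  by (simp add: schwartz_op_def)

lemma schwartz_op_bound:
  assumes "schwartz_op T"
  obtains C L where "C \<ge> 0" "\<And>\<phi>. schwartz \<phi> \<Longrightarrow> schwartz_sum K (T \<phi>) \<le> C * schwartz_sum L \<phi>"
proof -
  obtain C L where *: "\<And>\<phi>. schwartz \<phi> \<Longrightarrow> schwartz_sum K (T \<phi>) \<le> C * schwartz_sum L \<phi>"
    using assms unfolding schwartz_op_def by metis
  have "schwartz_sum K (T \<phi>) \<le> \<bar>C\<bar> * schwartz_sum L \<phi>" if "schwartz \<phi>" for \<phi>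
    by (rule order_trans[OF *[OF that]]) (intro mult_right_mono schwartz_sum_nonneg that, simp)
  then show ?thesis by (intro that[of "\<bar>C\<bar>" L]) auto
qed

lemma schwartz_op_compose:
  assumes "schwartz_op S" "schwartz_op T"
  shows "schwartz_op (\<lambda>\<phi>. S (T \<phi>))"
proof -
  have "\<exists>C L. \<forall>\<phi>. schwartz \<phi> \<longrightarrow> schwartz_sum K (S (T \<phi>)) \<le> C * schwartz_sum L \<phi>" for K
  proof -
    obtain C L where C: "C \<ge> 0" "\<And>\<phi>. schwartz \<phi> \<Longrightarrow> schwartz_sum K (S \<phi>) \<le> C * schwartz_sum L \<phi>"
      using schwartz_op_bound[OF assms(1)] by blast
    obtain C' L' where C': "C' \<ge> 0" "\<And>\<phi>. schwartz \<phi> \<Longrightarrow> schwartz_sum L (T \<phi>) \<le> C' * schwartz_sum L' \<phi>"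
      using schwartz_op_bound[OF assms(2)] by blast
    have "schwartz_sum K (S (T \<phi>)) \<le> (C * C') * schwartz_sum L' \<phi>" if "schwartz \<phi>" for \<phi>
    proof -
      have "schwartz_sum K (S (T \<phi>)) \<le> C * schwartz_sum L (T \<phi>)"
        using C(2) schwartz_op_schwartz[OF assms(2) that] by blast
      also have "\<dots> \<le> C * (C' * schwartz_sum L' \<phi>)"
        using C'(2)[OF that] C(1) by (rule mult_left_mono)
      finally show ?thesis by (simp add: mult.assoc)
    qed
    then show ?thesis by blast
  qed
  then show ?thesis using assms unfolding schwartz_op_def by simp
qed

text \<open>Only finitely many lists \<open>\<alpha>\<close> enter \<open>schwartz_sum K\<close>, so
  constants and orders that depend on \<open>\<alpha>\<close> can be replaced by their sums
  \<open>C'\<close> and \<open>L'\<close>. Pointwise bounds for one pair \<open>N\<close>,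
  \<open>\<alpha>\<close> at a time are therefore enough.\<close>

lemma schwartz_opI:
  fixes T :: "(real^'n::finite \<Rightarrow> complex) \<Rightarrow> real^'m::finite \<Rightarrow> complex"
  assumes add: "\<And>\<phi> \<theta>. schwartz \<phi> \<Longrightarrow> schwartz \<theta> \<Longrightarrow> T (\<lambda>x. \<phi> x + \<theta> x) = (\<lambda>x. T \<phi> x + T \<theta> x)"
    and scale: "\<And>c \<phi>. schwartz \<phi> \<Longrightarrow> T (\<lambda>x. c * \<phi> x) = (\<lambda>x. c * T \<phi> x)"
    and smooth: "\<And>\<phi>. schwartz \<phi> \<Longrightarrow> smooth (T \<phi>)"
    and bound: "\<And>N \<alpha>. \<exists>C K. \<forall>\<phi>. schwartz \<phi> \<longrightarrow>
      (\<forall>x. (1 + norm x) ^ N * norm (partial_derivs \<alpha> (T \<phi>) x) \<le> C * schwartz_sum K \<phi>)"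
  shows "schwartz_op T"
proof -
  have "\<exists>C L. \<forall>\<phi>. schwartz \<phi> \<longrightarrow> schwartz_sum K (T \<phi>) \<le> C * schwartz_sum L \<phi>" for K
  proof -
    obtain C L where C: "\<And>\<alpha> \<phi> x. schwartz \<phi> \<Longrightarrow>
        (1 + norm x) ^ K * norm (partial_derivs \<alpha> (T \<phi>) x) \<le> C \<alpha> * schwartz_sum (L \<alpha>) \<phi>"
      using bound[of K] by metis
    let ?A = "{\<alpha> :: 'm list. length \<alpha> \<le> K}"
    define C' where "C' = (\<Sum>\<alpha>\<in>?A. \<bar>C \<alpha>\<bar>)"
    define L' where "L' = (\<Sum>\<alpha>\<in>?A. L \<alpha>)"
    have "schwartz_sum K (T \<phi>) \<le> (real (card ?A) * C') * schwartz_sum L' \<phi>" if \<phi>: "schwartz \<phi>" for \<phi>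
      unfolding mult.assoc
    proof (rule schwartz_sum_le)
      fix \<alpha> :: "'m list" and x :: "real^'m" assume \<alpha>: "length \<alpha> \<le> K"
      have "(1 + norm x) ^ K * norm (partial_derivs \<alpha> (T \<phi>) x) \<le> C \<alpha> * schwartz_sum (L \<alpha>) \<phi>"
        by (rule C) fact
      also have "\<dots> \<le> \<bar>C \<alpha>\<bar> * schwartz_sum (L \<alpha>) \<phi>"
        by (intro mult_right_mono schwartz_sum_nonneg \<phi>) simp
      also have "\<dots> \<le> C' * schwartz_sum L' \<phi>"
      proof (rule mult_mono)
        show "\<bar>C \<alpha>\<bar> \<le> C'" unfolding C'_def using \<alpha> by (intro member_le_sum) auto
        have "L \<alpha> \<le> L'" unfolding L'_def using \<alpha> by (intro member_le_sum) auto
        then show "schwartz_sum (L \<alpha>) \<phi> \<le> schwartz_sum L' \<phi>" by (rule schwartz_sum_mono[OF \<phi>])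
        show "0 \<le> C'" unfolding C'_def by (rule sum_nonneg) simp
        show "0 \<le> schwartz_sum (L \<alpha>) \<phi>" by (rule schwartz_sum_nonneg[OF \<phi>])
      qed
      finally show "(1 + norm x) ^ K * norm (partial_derivs \<alpha> (T \<phi>) x) \<le> C' * schwartz_sum L' \<phi>" .
    qed
    then show ?thesis by blast
  qed
  moreover have "schwartz (T \<phi>)" if "schwartz \<phi>" for \<phi>
    by (rule schwartzI) (use that smooth bound in blast)+
  ultimately show ?thesis unfolding schwartz_op_def using add scale by blast
qed

lemma schwartz_add: "schwartz (\<lambda>x. \<phi> x + \<theta> x)" if "schwartz \<phi>" "schwartz \<theta>"
proof (rule schwartzI)
  show "smooth (\<lambda>x. \<phi> x + \<theta> x)" by (intro smooth_add schwartz_smooth that)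
  fix N \<alpha>
  have "(1 + norm x) ^ N * norm (partial_derivs \<alpha> (\<lambda>x. \<phi> x + \<theta> x) x)
     \<le> schwartz_seminorm N \<alpha> \<phi> + schwartz_seminorm N \<alpha> \<theta>" for x
  proof -
    have "(1 + norm x) ^ N * norm (partial_derivs \<alpha> (\<lambda>x. \<phi> x + \<theta> x) x) \<le>
      (1 + norm x) ^ N * norm (partial_derivs \<alpha> \<phi> x) + (1 + norm x) ^ N * norm (partial_derivs \<alpha> \<theta> x)"
      by (simp add: partial_derivs_add schwartz_smooth that distrib_left[symmetric] norm_triangle_ineq mult_left_mono)
    also have "\<dots> \<le> schwartz_seminorm N \<alpha> \<phi> + schwartz_seminorm N \<alpha> \<theta>"
      by (intro add_mono schwartz_seminorm_upper that)
    finally show ?thesis .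
  qed
  then show "\<exists>B. \<forall>x. (1 + norm x) ^ N * norm (partial_derivs \<alpha> (\<lambda>x. \<phi> x + \<theta> x) x) \<le> B" by blast
qed

lemma schwartz_cmult: "schwartz (\<lambda>x. c * \<phi> x)" if "schwartz \<phi>"
proof (rule schwartzI)
  show "smooth (\<lambda>x. c * \<phi> x)" by (intro smooth_cmult schwartz_smooth that)
  fix N \<alpha>
  have "(1 + norm x) ^ N * norm (partial_derivs \<alpha> (\<lambda>x. c * \<phi> x) x) \<le> norm c * schwartz_seminorm N \<alpha> \<phi>" for x
    using mult_left_mono[OF schwartz_seminorm_upper[OF that, of x N \<alpha>], of "norm c"]
    by (simp add: partial_derivs_cmult schwartz_smooth that norm_mult algebra_simps)
  then show "\<exists>B. \<forall>x. (1 + norm x) ^ N * norm (partial_derivs \<alpha> (\<lambda>x. c * \<phi> x) x) \<le> B" by blast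
qed

lemma schwartz_zero: "schwartz (\<lambda>x. 0)"
proof (rule schwartzI)
  have "partial_derivs \<alpha> (\<lambda>x. 0) = (\<lambda>x. 0)" for \<alpha> :: "'a list"
    by (induction \<alpha>) (auto simp: partial_derivs_Cons)
  then show "\<exists>B. \<forall>x. (1 + norm x) ^ N * norm (partial_derivs \<alpha> (\<lambda>x::real^'a. 0) x) \<le> B" for N \<alpha>
    by auto
qed (rule smooth_const)

lemma schwartz_sum_fun: "(\<And>k. k \<in> A \<Longrightarrow> schwartz (f k)) \<Longrightarrow> schwartz (\<lambda>x. \<Sum>k\<in>A. f k x)"
  by (induction A rule: infinite_finite_induct) (auto intro: schwartz_zero schwartz_add)

lemma schwartz_op_id: "schwartz_op (\<lambda>\<phi>. \<phi>)"
  unfolding schwartz_op_def by (metis mult_1 order_refl)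

lemma schwartz_op_partial_deriv: "schwartz_op (partial_deriv i)"
proof (rule schwartz_opI)
  fix N :: nat and \<alpha> :: "'a list"
  have "(1 + norm x) ^ N * norm (partial_derivs \<alpha> (partial_deriv i \<phi>) x) \<le> 1 * schwartz_sum (N + Suc (length \<alpha>)) \<phi>"
    if "schwartz \<phi>" for \<phi> x
    using schwartz_sum_upper[OF that, of "\<alpha> @ [i]" "N + Suc (length \<alpha>)" N x] by (simp add: partial_derivs_snoc)
  then show "\<exists>C K. \<forall>\<phi>. schwartz \<phi> \<longrightarrow> (\<forall>x. (1 + norm x) ^ N * norm (partial_derivs \<alpha> (partial_deriv i \<phi>) x) \<le> C * schwartz_sum K \<phi>)"
    by blast
qed (simp_all add: partial_deriv_add partial_deriv_cmult smooth_differentiable schwartz_smooth smooth_partial_deriv)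

text \<open>\<open>Q\<close> stands for any pointwise quantity already bounded by a Schwartz norm.
  Inductions use this to apply their hypothesis to \<open>partial_deriv j \<phi>\<close> or
  \<open>coord_mult j \<phi>\<close> and to return to a norm of \<open>\<phi>\<close>; with
  \<open>T\<close> the identity it serves to make the constant nonnegative.\<close>

lemma schwartz_op_bound_compose:
  assumes T: "schwartz_op T"
    and P: "\<exists>C K. \<forall>\<phi>. schwartz \<phi> \<longrightarrow> (\<forall>x. Q \<phi> x \<le> C * schwartz_sum K \<phi>)"
  shows "\<exists>C K. C \<ge> 0 \<and> (\<forall>\<phi>. schwartz \<phi> \<longrightarrow> (\<forall>x. Q (T \<phi>) x \<le> C * schwartz_sum K \<phi>))"
proof -
  obtain C K where C: "\<And>\<phi> x. schwartz \<phi> \<Longrightarrow> Q \<phi> x \<le> C * schwartz_sum K \<phi>" using P by blast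
  obtain D L where D: "D \<ge> 0" "\<And>\<phi>. schwartz \<phi> \<Longrightarrow> schwartz_sum K (T \<phi>) \<le> D * schwartz_sum L \<phi>"
    using schwartz_op_bound[OF T] by blast
  have "Q (T \<phi>) x \<le> (\<bar>C\<bar> * D) * schwartz_sum L \<phi>" if \<phi>: "schwartz \<phi>" for \<phi> x
  proof -
    have T': "schwartz (T \<phi>)" using schwartz_op_schwartz[OF T \<phi>] .
    have "Q (T \<phi>) x \<le> C * schwartz_sum K (T \<phi>)" using C T' by blast
    also have "\<dots> \<le> \<bar>C\<bar> * schwartz_sum K (T \<phi>)" by (intro mult_right_mono schwartz_sum_nonneg T') simp
    also have "\<dots> \<le> \<bar>C\<bar> * (D * schwartz_sum L \<phi>)" by (intro mult_left_mono D \<phi>) simp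
    finally show ?thesis by (simp add: mult.assoc)
  qed
  then show ?thesis using D(1) by (intro exI[of _ "\<bar>C\<bar> * D"] exI[of _ L]) simp
qed

lemma partial_derivs_snoc_coord_mult:
  assumes "smooth \<phi>"
  shows "partial_derivs (\<alpha> @ [j]) (coord_mult i \<phi>) =
    (\<lambda>x. (if i = j then 1 else 0) * partial_derivs \<alpha> \<phi> x + partial_derivs \<alpha> (coord_mult i (partial_deriv j \<phi>)) x)"
  using assms
  by (simp add: partial_derivs_snoc partial_deriv_coord_mult partial_derivs_add partial_derivs_cmult
      smooth_cmult smooth_coord_mult smooth_partial_deriv)

text \<open>A derivative either removes the coordinate factor or falls on \<open>\<phi>\<close>. In
  the second case the hypothesis is used for \<open>partial_deriv j \<phi>\<close>, which is why
  \<open>\<phi>\<close> is quantified after the constants.\<close>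

lemma coord_mult_bound:
  "\<exists>C K. \<forall>\<phi>. schwartz \<phi> \<longrightarrow>
      (\<forall>x. (1 + norm x) ^ N * norm (partial_derivs \<alpha> (coord_mult i \<phi>) x) \<le> C * schwartz_sum K \<phi>)"
proof (induction \<alpha> rule: rev_induct)
  case Nil
  have "(1 + norm x) ^ N * norm (coord_mult i \<phi> x) \<le> 1 * schwartz_sum (Suc N) \<phi>" if "schwartz \<phi>" for \<phi> x
  proof -
    have "norm (coord_mult i \<phi> x) \<le> (1 + norm x) * norm (\<phi> x)"
      using component_le_norm_cart[of x i] unfolding coord_mult_def norm_mult norm_of_real
      by (intro mult_right_mono) auto
    then have "(1 + norm x) ^ N * norm (coord_mult i \<phi> x) \<le> (1 + norm x) ^ N * ((1 + norm x) * norm (\<phi> x))"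
      by (rule mult_left_mono) simp
    also have "\<dots> \<le> 1 * schwartz_sum (Suc N) \<phi>"
      using schwartz_sum_upper[OF that, of "[]" "Suc N" "Suc N" x] by (simp add: algebra_simps)
    finally show ?thesis .
  qed
  then show ?case unfolding partial_derivs_Nil by blast
next
  case (snoc j \<alpha>)
  obtain C K where C: "C \<ge> 0" "\<And>\<phi> x. schwartz \<phi> \<Longrightarrow>
      (1 + norm x) ^ N * norm (partial_derivs \<alpha> (coord_mult i (partial_deriv j \<phi>)) x) \<le> C * schwartz_sum K \<phi>"
    using schwartz_op_bound_compose[OF schwartz_op_partial_deriv snoc] by blast
  define L where "L = K + N + length \<alpha>"
  have "(1 + norm x) ^ N * norm (partial_derivs (\<alpha> @ [j]) (coord_mult i \<phi>) x) \<le> (1 + C) * schwartz_sum L \<phi>"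
    if \<phi>: "schwartz \<phi>" for \<phi> x
  proof -
    have "norm (partial_derivs (\<alpha> @ [j]) (coord_mult i \<phi>) x) \<le>
        norm (partial_derivs \<alpha> \<phi> x) + norm (partial_derivs \<alpha> (coord_mult i (partial_deriv j \<phi>)) x)"
      unfolding partial_derivs_snoc_coord_mult[OF schwartz_smooth[OF \<phi>]]
      by (rule order_trans[OF norm_triangle_ineq]) auto
    then have "(1 + norm x) ^ N * norm (partial_derivs (\<alpha> @ [j]) (coord_mult i \<phi>) x) \<le>
        (1 + norm x) ^ N * norm (partial_derivs \<alpha> \<phi> x) +
        (1 + norm x) ^ N * norm (partial_derivs \<alpha> (coord_mult i (partial_deriv j \<phi>)) x)"
      unfolding distrib_left[symmetric] by (rule mult_left_mono) simp
    also have "\<dots> \<le> schwartz_sum L \<phi> + C * schwartz_sum L \<phi>"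
    proof (rule add_mono)
      show "(1 + norm x) ^ N * norm (partial_derivs \<alpha> \<phi> x) \<le> schwartz_sum L \<phi>"
        by (rule schwartz_sum_upper) (use \<phi> in \<open>auto simp: L_def\<close>)
      show "(1 + norm x) ^ N * norm (partial_derivs \<alpha> (coord_mult i (partial_deriv j \<phi>)) x) \<le> C * schwartz_sum L \<phi>"
        by (rule order_trans[OF C(2)[OF \<phi>]]) (use \<phi> C in \<open>auto simp: L_def intro!: mult_left_mono schwartz_sum_mono\<close>)
    qed
    finally show ?thesis by (simp add: algebra_simps)
  qed
  then show ?case by blast
qed

lemma schwartz_op_coord_mult: "schwartz_op (coord_mult i)"
  by (rule schwartz_opI[OF _ _ _ coord_mult_bound])
     (simp_all add: coord_mult_def distrib_left mult.left_commute smooth_coord_mult[unfolded coord_mult_def] schwartz_smooth)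

lemma partial_derivs_snoc_phase_mult:
  assumes "smooth f"
  shows "partial_derivs (\<alpha> @ [i]) (\<lambda>x. phase y s x * f x) =
    (\<lambda>x. partial_derivs \<alpha> (\<lambda>x. phase y s x * partial_deriv i f x) x +
      (\<i> * of_real (2 * pi * y $ i) * partial_derivs \<alpha> (\<lambda>x. phase y s x * f x) x +
       \<i> * of_real (2 * s) * partial_derivs \<alpha> (\<lambda>x. phase y s x * coord_mult i f x) x))"
  using assms
  by (simp add: partial_derivs_snoc partial_deriv_phase_mult partial_derivs_add partial_derivs_cmult smooth_add
      smooth_cmult smooth_coord_mult smooth_partial_deriv smooth_mult smooth_phase)

text \<open>Every derivative that falls on the phase costs one power of the frequency and of \<open>s\<close>.\<close>

lemma phase_mult_bound:
  "\<exists>C K. \<forall>\<phi>. schwartz \<phi> \<longrightarrow> (\<forall>p. (\<lambda>(x, y, s). (1 + norm x) ^ N * norm (partial_derivs \<alpha> (\<lambda>x. phase y s x * \<phi> x) x)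
      / (1 + norm y + \<bar>s\<bar>) ^ length \<alpha>) p \<le> C * schwartz_sum K \<phi>)"
proof (induction \<alpha> rule: rev_induct)
  case Nil
  have "(1 + norm x) ^ N * norm (\<phi> x) \<le> 1 * schwartz_sum N \<phi>" if "schwartz \<phi>" for \<phi> and x :: "real^'a"
    using schwartz_sum_upper[OF that, of "[]" N N x] by simp
  then show ?case
    by (intro exI[of _ 1] exI[of _ N]) (simp add: norm_mult split_paired_All)
next
  case (snoc j \<alpha>)
  \<comment> \<open>The point, the frequency and \<open>s\<close> form one argument and the expected
    growth is divided out, so that \<open>schwartz_op_bound_compose\<close> applies with constants
    uniform in all three.\<close>
  let ?Q = "\<lambda>f. \<lambda>(x, y, s). (1 + norm x) ^ N * norm (partial_derivs \<alpha> (\<lambda>x. phase y s x * f x) x)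
      / (1 + norm y + \<bar>s\<bar>) ^ length \<alpha>"
  obtain C1 K1 where C1: "C1 \<ge> 0" "\<And>\<phi> p. schwartz \<phi> \<Longrightarrow> ?Q (partial_deriv j \<phi>) p \<le> C1 * schwartz_sum K1 \<phi>"
    using schwartz_op_bound_compose[where Q = ?Q, OF schwartz_op_partial_deriv snoc] by blast
  obtain C2 K2 where C2: "C2 \<ge> 0" "\<And>\<phi> p. schwartz \<phi> \<Longrightarrow> ?Q (coord_mult j \<phi>) p \<le> C2 * schwartz_sum K2 \<phi>"
    using schwartz_op_bound_compose[where Q = ?Q, OF schwartz_op_coord_mult snoc] by blast
  obtain C3 K3 where C3: "C3 \<ge> 0" "\<And>\<phi> p. schwartz \<phi> \<Longrightarrow> ?Q \<phi> p \<le> C3 * schwartz_sum K3 \<phi>"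
    using schwartz_op_bound_compose[where Q = ?Q, OF schwartz_op_id snoc] by blast
  define L where "L = K1 + K2 + K3"
  have "(1 + norm x) ^ N * norm (partial_derivs (\<alpha> @ [j]) (\<lambda>x. phase y s x * \<phi> x) x)
      / (1 + norm y + \<bar>s\<bar>) ^ length (\<alpha> @ [j]) \<le> (C1 + (2 * pi * C3 + 2 * C2)) * schwartz_sum L \<phi>"
    if \<phi>: "schwartz \<phi>" for \<phi> x y s
  proof -
    define D where "D f = norm (partial_derivs \<alpha> (\<lambda>x. phase y s x * f x) x)" for f
    define l where "l = 1 + norm y + \<bar>s\<bar>"
    have l: "l \<ge> 1" "norm y \<le> l" "\<bar>s\<bar> \<le> l" unfolding l_def by auto
    have "norm (partial_derivs (\<alpha> @ [j]) (\<lambda>x. phase y s x * \<phi> x) x) \<le>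
      D (partial_deriv j \<phi>) + (2 * pi * \<bar>y $ j\<bar> * D \<phi> + 2 * \<bar>s\<bar> * D (coord_mult j \<phi>))"
      unfolding partial_derivs_snoc_phase_mult[OF schwartz_smooth[OF \<phi>]] D_def
      by (rule order_trans[OF norm_triangle_ineq] add_mono order_refl)+ (simp_all add: norm_mult)
    also have "\<dots> \<le> l * D (partial_deriv j \<phi>) + (2 * pi * l * D \<phi> + 2 * l * D (coord_mult j \<phi>))"
    proof -
      have "\<bar>y $ j\<bar> \<le> l" using component_le_norm_cart[of y j] l by linarith
      moreover have "1 * D (partial_deriv j \<phi>) \<le> l * D (partial_deriv j \<phi>)"
        using l by (intro mult_right_mono) (auto simp: D_def)
      ultimately show ?thesis using l by (intro add_mono mult_right_mono mult_left_mono) (auto simp: D_def)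
    qed
    also have "\<dots> = l * (D (partial_deriv j \<phi>) + (2 * pi * D \<phi> + 2 * D (coord_mult j \<phi>)))"
      by (simp add: algebra_simps)
    finally have "(1 + norm x) ^ N * norm (partial_derivs (\<alpha> @ [j]) (\<lambda>x. phase y s x * \<phi> x) x) / l ^ length (\<alpha> @ [j]) \<le>
       (1 + norm x) ^ N * (l * (D (partial_deriv j \<phi>) + (2 * pi * D \<phi> + 2 * D (coord_mult j \<phi>)))) / l ^ length (\<alpha> @ [j])"
      using l by (intro divide_right_mono mult_left_mono) auto
    also have "\<dots> = ?Q (partial_deriv j \<phi>) (x, y, s) + (2 * pi * ?Q \<phi> (x, y, s) + 2 * ?Q (coord_mult j \<phi>) (x, y, s))"
      unfolding prod.case l_def[symmetric] D_def[symmetric] using l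
      by (simp add: field_simps)
    also have "\<dots> \<le> C1 * schwartz_sum L \<phi> + (2 * pi * (C3 * schwartz_sum L \<phi>) + 2 * (C2 * schwartz_sum L \<phi>))"
    proof (intro add_mono mult_left_mono)
      show "?Q (partial_deriv j \<phi>) (x, y, s) \<le> C1 * schwartz_sum L \<phi>"
        by (rule order_trans[OF C1(2)[OF \<phi>]]) (use \<phi> C1 in \<open>auto simp: L_def intro!: mult_left_mono schwartz_sum_mono\<close>)
      show "?Q (coord_mult j \<phi>) (x, y, s) \<le> C2 * schwartz_sum L \<phi>"
        by (rule order_trans[OF C2(2)[OF \<phi>]]) (use \<phi> C2 in \<open>auto simp: L_def intro!: mult_left_mono schwartz_sum_mono\<close>)
      show "?Q \<phi> (x, y, s) \<le> C3 * schwartz_sum L \<phi>"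
        by (rule order_trans[OF C3(2)[OF \<phi>]]) (use \<phi> C3 in \<open>auto simp: L_def intro!: mult_left_mono schwartz_sum_mono\<close>)
    qed auto
    finally show ?thesis unfolding l_def by (simp add: algebra_simps)
  qed
  then show ?case
    by (intro exI[of _ "C1 + (2 * pi * C3 + 2 * C2)"] exI[of _ L]) (simp add: split_paired_All)
qed

text \<open>Uniformity in \<open>y\<close> makes modulated series converge in Schwartz space;
  uniformity in \<open>s\<close> measures the cost of differentiating the chirp.\<close>

lemma phase_mult_bound':
  "\<exists>C K. C \<ge> 0 \<and> (\<forall>\<phi> x y s. schwartz \<phi> \<longrightarrow>
    (1 + norm x) ^ N * norm (partial_derivs \<alpha> (\<lambda>x. phase y s x * \<phi> x) x)
      \<le> C * (1 + norm y + \<bar>s\<bar>) ^ length \<alpha> * schwartz_sum K \<phi>)"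
proof -
  obtain C K where C: "\<And>\<phi> x y s. schwartz \<phi> \<Longrightarrow> (1 + norm x) ^ N * norm (partial_derivs \<alpha> (\<lambda>x. phase y s x * \<phi> x) x)
      / (1 + norm y + \<bar>s\<bar>) ^ length \<alpha> \<le> C * schwartz_sum K \<phi>"
    using phase_mult_bound[of N \<alpha>] unfolding split_paired_All prod.case by blast
  have "(1 + norm x) ^ N * norm (partial_derivs \<alpha> (\<lambda>x. phase y s x * \<phi> x) x)
      \<le> \<bar>C\<bar> * (1 + norm y + \<bar>s\<bar>) ^ length \<alpha> * schwartz_sum K \<phi>" if "schwartz \<phi>" for \<phi> x y s
  proof -
    have l: "(1 + norm y + \<bar>s\<bar>) ^ length \<alpha> > 0" by (intro zero_less_power) (smt (verit) norm_ge_zero)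
    have "(1 + norm x) ^ N * norm (partial_derivs \<alpha> (\<lambda>x. phase y s x * \<phi> x) x)
        \<le> (C * schwartz_sum K \<phi>) * (1 + norm y + \<bar>s\<bar>) ^ length \<alpha>"
      using C[OF that, of x y s] unfolding pos_divide_le_eq[OF l] .
    also have "\<dots> \<le> (\<bar>C\<bar> * schwartz_sum K \<phi>) * (1 + norm y + \<bar>s\<bar>) ^ length \<alpha>"
      using l by (intro mult_right_mono schwartz_sum_nonneg that) auto
    finally show ?thesis by (simp add: mult_ac)
  qed
  then show ?thesis using abs_ge_zero by blast
qed

lemma schwartz_op_phase_mult: "schwartz_op (\<lambda>\<phi> x. phase y s x * \<phi> x)"
proof (rule schwartz_opI)
  fix N :: nat and \<alpha> :: "'a list"
  obtain C K where C: "\<And>\<phi> x y s. schwartz \<phi> \<Longrightarrow>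
    (1 + norm x) ^ N * norm (partial_derivs \<alpha> (\<lambda>x. phase y s x * \<phi> x) x)
      \<le> C * (1 + norm y + \<bar>s\<bar>) ^ length \<alpha> * schwartz_sum K \<phi>"
    using phase_mult_bound'[of N \<alpha>] by blast
  show "\<exists>C K. \<forall>\<phi>. schwartz \<phi> \<longrightarrow> (\<forall>x. (1 + norm x) ^ N * norm (partial_derivs \<alpha> (\<lambda>x. phase y s x * \<phi> x) x) \<le> C * schwartz_sum K \<phi>)"
    by (intro exI[of _ "C * (1 + norm y + \<bar>s\<bar>) ^ length \<alpha>"] exI[of _ K]) (use C in blast)
qed (simp_all add: smooth_mult smooth_phase schwartz_smooth distrib_left mult.left_commute)

lemma schwartz_phase_mult: "schwartz \<phi> \<Longrightarrow> schwartz (\<lambda>x. phase y s x * \<phi> x)"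
  using schwartz_op_schwartz[OF schwartz_op_phase_mult] .

lemma schwartz_op_affine:
  assumes "a \<noteq> 0"
  shows "schwartz_op (\<lambda>\<phi> x. \<phi> (a *\<^sub>R x - b))"
proof (rule schwartz_opI)
  fix N :: nat and \<alpha> :: "'a list"
  \<comment> \<open>From |a| |x| <= |a x - b| + |b|: the weight at \<open>x\<close> exceeds the
    weight at its image by at most this factor.\<close>
  define M where "M = 1 + (1 + norm b) / \<bar>a\<bar>"
  have M: "1 + norm x \<le> M * (1 + norm (a *\<^sub>R x - b))" for x
  proof -
    have "\<bar>a\<bar> * norm x \<le> norm (a *\<^sub>R x - b) + norm b"
      using norm_triangle_ineq[of "a *\<^sub>R x - b" b] by simp
    then have "norm x \<le> (norm (a *\<^sub>R x - b) + norm b) / \<bar>a\<bar>" using assms by (simp add: field_simps)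
    also have "\<dots> \<le> ((1 + norm b) * (1 + norm (a *\<^sub>R x - b))) / \<bar>a\<bar>"
      by (intro divide_right_mono) (auto simp: algebra_simps)
    also have "1 + \<dots> \<le> M * (1 + norm (a *\<^sub>R x - b))" unfolding M_def by (simp add: algebra_simps add_divide_distrib)
    finally show ?thesis by simp
  qed
  have "(1 + norm x) ^ N * norm (partial_derivs \<alpha> (\<lambda>x. \<phi> (a *\<^sub>R x - b)) x) \<le> (M ^ N * \<bar>a\<bar> ^ length \<alpha>) * schwartz_sum (N + length \<alpha>) \<phi>"
    if \<phi>: "schwartz \<phi>" for \<phi> x
  proof -
    have M0: "0 \<le> M" unfolding M_def by (simp add: add_nonneg_nonneg)
    have "(1 + norm x) ^ N \<le> M ^ N * (1 + norm (a *\<^sub>R x - b)) ^ N"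
      unfolding power_mult_distrib[symmetric] using M by (intro power_mono) auto
    then have "(1 + norm x) ^ N * norm (partial_derivs \<alpha> (\<lambda>x. \<phi> (a *\<^sub>R x - b)) x) \<le>
      (M ^ N * (1 + norm (a *\<^sub>R x - b)) ^ N) * (\<bar>a\<bar> ^ length \<alpha> * norm (partial_derivs \<alpha> \<phi> (a *\<^sub>R x - b)))"
      by (simp add: partial_derivs_affine schwartz_smooth \<phi> norm_mult norm_power mult_right_mono)
    also have "\<dots> = (M ^ N * \<bar>a\<bar> ^ length \<alpha>) * ((1 + norm (a *\<^sub>R x - b)) ^ N * norm (partial_derivs \<alpha> \<phi> (a *\<^sub>R x - b)))"
      by (simp add: mult_ac)
    also have "\<dots> \<le> (M ^ N * \<bar>a\<bar> ^ length \<alpha>) * schwartz_sum (N + length \<alpha>) \<phi>"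
      using M0 by (intro mult_left_mono schwartz_sum_upper \<phi>) auto
    finally show ?thesis .
  qed
  then show "\<exists>C K. \<forall>\<phi>. schwartz \<phi> \<longrightarrow> (\<forall>x. (1 + norm x) ^ N * norm (partial_derivs \<alpha> (\<lambda>x. \<phi> (a *\<^sub>R x - b)) x) \<le> C * schwartz_sum K \<phi>)"
    by blast
qed (simp_all add: smooth_affine schwartz_smooth)

subsection \<open>Tempered distributions\<close>

lemma tempered_add: "tempered u \<Longrightarrow> schwartz \<phi> \<Longrightarrow> schwartz \<theta> \<Longrightarrow> u (\<lambda>x. \<phi> x + \<theta> x) = u \<phi> + u \<theta>"
  by (auto simp: tempered_def)

lemma tempered_cmult: "tempered u \<Longrightarrow> schwartz \<phi> \<Longrightarrow> u (\<lambda>x. c * \<phi> x) = c * u \<phi>"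
  by (auto simp: tempered_def)

lemma tempered_bound:
  assumes "tempered u"
  obtains C N where "C \<ge> 0" "\<And>\<phi>. schwartz \<phi> \<Longrightarrow> norm (u \<phi>) \<le> C * schwartz_sum N \<phi>"
proof -
  obtain C N where *: "\<And>\<phi>. schwartz \<phi> \<Longrightarrow> norm (u \<phi>) \<le> C * schwartz_sum N \<phi>"
    using assms unfolding tempered_def schwartz_sum_def by blast
  have "norm (u \<phi>) \<le> \<bar>C\<bar> * schwartz_sum N \<phi>" if "schwartz \<phi>" for \<phi>
    by (rule order_trans[OF *[OF that]]) (intro mult_right_mono schwartz_sum_nonneg that, simp)
  then show ?thesis by (intro that[of "\<bar>C\<bar>" N]) auto
qed

lemma tempered_compose:
  assumes u: "tempered u" and T: "schwartz_op T"
  shows "tempered (\<lambda>\<phi>. u (T \<phi>))"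
proof -
  obtain C N where C: "C \<ge> 0" "\<And>\<phi>. schwartz \<phi> \<Longrightarrow> norm (u \<phi>) \<le> C * schwartz_sum N \<phi>"
    using tempered_bound[OF u] by blast
  obtain D L where D: "D \<ge> 0" "\<And>\<phi>. schwartz \<phi> \<Longrightarrow> schwartz_sum N (T \<phi>) \<le> D * schwartz_sum L \<phi>"
    using schwartz_op_bound[OF T] by blast
  have "norm (u (T \<phi>)) \<le> (C * D) * schwartz_sum L \<phi>" if "schwartz \<phi>" for \<phi>
  proof -
    have "norm (u (T \<phi>)) \<le> C * schwartz_sum N (T \<phi>)" using C(2) schwartz_op_schwartz[OF T that] by blast
    also have "\<dots> \<le> C * (D * schwartz_sum L \<phi>)" by (intro mult_left_mono C D that)
    finally show ?thesis by (simp add: mult.assoc)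
  qed
  then have "\<exists>C N. \<forall>\<phi>. schwartz \<phi> \<longrightarrow> norm (u (T \<phi>)) \<le> C * (\<Sum>\<alpha> | length \<alpha> \<le> N. schwartz_seminorm N \<alpha> \<phi>)"
    unfolding schwartz_sum_def by blast
  then show ?thesis using u T unfolding tempered_def schwartz_op_def by simp
qed

subsection \<open>Integrability\<close>

lemma emeasure_lborel_ball_le:
  assumes "R \<ge> 0"
  shows "emeasure lborel (ball (0::real^'n::finite) R) \<le> ennreal ((2 * R) ^ CARD('n))"
proof -
  let ?u = "R *\<^sub>R One :: real^'n"
  have "ball 0 R \<subseteq> cbox (- ?u) ?u"
  proof
    fix x :: "real^'n" assume "x \<in> ball 0 R"
    then have "\<bar>x \<bullet> b\<bar> \<le> R" if "b \<in> Basis" for b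
      using Basis_le_norm[OF that, of x] by simp
    then show "x \<in> cbox (- ?u) ?u" by (fastforce simp: mem_box abs_le_iff)
  qed
  then have "emeasure lborel (ball (0::real^'n) R) \<le> emeasure lborel (cbox (- ?u) ?u)"
    by (rule emeasure_mono) simp
  also have "\<dots> = ennreal (\<Prod>b\<in>(Basis::(real^'n) set). (?u - (- ?u)) \<bullet> b)"
    by (rule emeasure_lborel_cbox) (use assms in auto)
  also have "(\<Prod>b\<in>(Basis::(real^'n) set). (?u - (- ?u)) \<bullet> b) = (\<Prod>b\<in>(Basis::(real^'n) set). 2 * R)"
    by (rule prod.cong) (simp_all only: diff_minus_eq_add inner_add_left inner_scaleR_left inner_sum_left_Basis if_P, simp)
  finally show ?thesis by simp
qed

lemma ennreal_le_suminf: "f n \<le> (\<Sum>n. f n :: ennreal)"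
  using sum_le_suminf[OF summableI, of "{n}" f] by simp

text \<open>Split by the integer part of the norm: a ball of radius \<open>1 + n\<close> has volume
  O((1 + n)^d), so the exponent d + 2 leaves the convergent series of inverse squares. The same
  exponent serves for lattice sums later.\<close>

lemma nn_integral_decay_finite:
  "(\<integral>\<^sup>+x. ennreal (1 / (1 + norm (x::real^'n::finite)) ^ (CARD('n) + 2)) \<partial>lborel) < \<infinity>"
proof -
  let ?d = "CARD('n)"
  let ?g = "\<lambda>n (x::real^'n). ennreal (1 / (1 + real n) ^ (?d + 2)) * indicator (ball 0 (1 + real n)) x"
  have "ennreal (1 / (1 + norm x) ^ (?d + 2)) \<le> (\<Sum>n. ?g n x)" for x :: "real^'n"
  proof -
    define n where "n = nat \<lfloor>norm x\<rfloor>"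
    have n: "real n \<le> norm x" "norm x < 1 + real n" proof -
      have "real n = of_int \<lfloor>norm x\<rfloor>" by (simp add: n_def)
      then show "real n \<le> norm x" "norm x < 1 + real n" by linarith+
    qed
    have "ennreal (1 / (1 + norm x) ^ (?d + 2)) \<le> ?g n x"
    proof -
      have "1 / (1 + norm x) ^ (?d + 2) \<le> 1 / (1 + real n) ^ (?d + 2)"
        using n by (intro divide_left_mono power_mono mult_pos_pos zero_less_power) (auto simp: add_pos_nonneg)
      moreover have "indicator (ball 0 (1 + real n)) x = (1::ennreal)" using n by simp
      ultimately show ?thesis by (simp only: mult_1_right ennreal_leI)
    qed
    also have "\<dots> \<le> (\<Sum>n. ?g n x)"
      by (rule ennreal_le_suminf)
    finally show ?thesis .
  qed
  then have "(\<integral>\<^sup>+x. ennreal (1 / (1 + norm (x::real^'n)) ^ (?d + 2)) \<partial>lborel) \<le> (\<integral>\<^sup>+x. (\<Sum>n. ?g n x) \<partial>lborel)"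
    by (intro nn_integral_mono)
  also have "\<dots> = (\<Sum>n. \<integral>\<^sup>+x. ?g n x \<partial>lborel)"
    by (rule nn_integral_suminf) (auto intro!: borel_measurable_times_ennreal borel_measurable_indicator)
  also have "\<dots> = (\<Sum>n. ennreal (1 / (1 + real n) ^ (?d + 2)) * emeasure lborel (ball (0::real^'n) (1 + real n)))"
    by (intro suminf_cong nn_integral_cmult_indicator) auto
  also have "\<dots> \<le> (\<Sum>n. ennreal (2 ^ ?d * (1 / real (Suc n) ^ 2)))"
  proof (intro suminf_le summableI)
    fix n
    have "ennreal (1 / (1 + real n) ^ (?d + 2)) * emeasure lborel (ball (0::real^'n) (1 + real n)) \<le>
      ennreal (1 / (1 + real n) ^ (?d + 2)) * ennreal ((2 * (1 + real n)) ^ ?d)"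
      by (intro mult_left_mono emeasure_lborel_ball_le) auto
    also have "\<dots> = ennreal (1 / (1 + real n) ^ (?d + 2) * (2 * (1 + real n)) ^ ?d)"
      by (rule ennreal_mult'[symmetric]) simp
    also have "1 / (1 + real n) ^ (?d + 2) * (2 * (1 + real n)) ^ ?d = 2 ^ ?d * (1 / real (Suc n) ^ 2)"
      unfolding of_nat_Suc power_add power_mult_distrib by (simp add: divide_simps add_nonneg_eq_0_iff)
    finally show "ennreal (1 / (1 + real n) ^ (?d + 2)) * emeasure lborel (ball (0::real^'n) (1 + real n))
      \<le> ennreal (2 ^ ?d * (1 / real (Suc n) ^ 2))" .
  qed
  also have "\<dots> < \<infinity>"
  proof -
    have "summable (\<lambda>n. 1 / real (Suc n) ^ 2)"
      using sums_summable[OF inverse_squares_sums] by (simp add: add.commute)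
    then have "summable (\<lambda>n. 2 ^ ?d * (1 / real (Suc n) ^ 2))" by (rule summable_mult)
    then have "(\<Sum>n. ennreal (2 ^ ?d * (1 / real (Suc n) ^ 2))) = ennreal (\<Sum>n. 2 ^ ?d * (1 / real (Suc n) ^ 2))"
      by (intro suminf_ennreal2) auto
    then show ?thesis by simp
  qed
  finally show ?thesis .
qed

lemma integrable_decay:
  "integrable lborel (\<lambda>x::real^'n::finite. 1 / (1 + norm x) ^ (CARD('n) + 2))"
  by (rule integrableI_nonneg) (use nn_integral_decay_finite in \<open>auto simp: add_nonneg_nonneg\<close>)

lemma schwartz_continuous: "schwartz \<phi> \<Longrightarrow> continuous_on UNIV \<phi>"
  using smooth_differentiable schwartz_smooth differentiable_imp_continuous_on by blast

lemma schwartz_measurable [measurable_dest]: "schwartz \<phi> \<Longrightarrow> \<phi> \<in> borel_measurable borel"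
  using schwartz_continuous borel_measurable_continuous_onI by blast

lemma schwartz_decay:
  assumes "schwartz (\<phi> :: real^'n::finite \<Rightarrow> complex)"
  shows "norm (\<phi> x) \<le> schwartz_sum N \<phi> / (1 + norm x) ^ N"
proof -
  have "(1 + norm x) ^ N > 0" by (intro zero_less_power) (simp add: add_pos_nonneg)
  then show ?thesis
    using schwartz_sum_upper[OF assms, of "[]" N N x] by (simp add: field_simps)
qed

lemma schwartz_integrable_power:
  fixes \<phi> :: "real^'n::finite \<Rightarrow> complex"
  assumes "schwartz \<phi>"
  shows "integrable lborel (\<lambda>x. (1 + norm x) ^ k * norm (\<phi> x))"
proof (rule Bochner_Integration.integrable_bound)
  let ?N = "CARD('n) + 2"
  show "integrable lborel (\<lambda>x::real^'n. schwartz_sum (?N + k) \<phi> * (1 / (1 + norm x) ^ ?N))"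
    by (intro integrable_mult_right integrable_decay)
  show "(\<lambda>x. (1 + norm x) ^ k * norm (\<phi> x)) \<in> borel_measurable lborel"
    using schwartz_measurable[OF assms] by measurable
  show "AE x in lborel. norm ((1 + norm x) ^ k * norm (\<phi> x)) \<le> norm (schwartz_sum (?N + k) \<phi> * (1 / (1 + norm x) ^ ?N))"
  proof (rule AE_I2)
    fix x :: "real^'n"
    have p: "(1 + norm x) ^ k > 0" by (intro zero_less_power) (simp add: add_pos_nonneg)
    have "(1 + norm x) ^ k * norm (\<phi> x) \<le> (1 + norm x) ^ k * (schwartz_sum (?N + k) \<phi> / (1 + norm x) ^ (?N + k))"
      using p by (intro mult_left_mono schwartz_decay assms) auto
    also have "\<dots> = schwartz_sum (?N + k) \<phi> * (1 / (1 + norm x) ^ ?N)"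
      using p by (simp add: power_add)
    finally have "(1 + norm x) ^ k * norm (\<phi> x) \<le> schwartz_sum (?N + k) \<phi> * (1 / (1 + norm x) ^ ?N)" .
    then show "norm ((1 + norm x) ^ k * norm (\<phi> x)) \<le> norm (schwartz_sum (?N + k) \<phi> * (1 / (1 + norm x) ^ ?N))"
      using p schwartz_sum_nonneg[OF assms] by (simp add: abs_mult)
  qed
qed

lemma schwartz_integrable_norm:
  assumes "schwartz \<phi>" shows "integrable lborel (\<lambda>x. norm (\<phi> x))"
  using schwartz_integrable_power[OF assms, of 0] by simp

lemma schwartz_integrable:
  assumes "schwartz \<phi>" shows "integrable lborel \<phi>"
  using schwartz_integrable_norm[OF assms] schwartz_measurable[OF assms]
  by (subst (asm) integrable_norm_iff) auto

subsection \<open>The Fourier transform on Schwartz functions\<close>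

lemma fourier_phase: "fourier \<phi> \<xi> = (\<integral>x. phase (- \<xi>) 0 x * \<phi> x \<partial>lborel)"
  unfolding fourier_def phase_def
  by (intro Bochner_Integration.integral_cong) (auto simp: inner_commute mult_ac)

lemma fourier_add:
  assumes "schwartz \<phi>" "schwartz \<theta>"
  shows "fourier (\<lambda>x. \<phi> x + \<theta> x) = (\<lambda>\<xi>. fourier \<phi> \<xi> + fourier \<theta> \<xi>)"
  unfolding fourier_phase distrib_left
  by (intro ext Bochner_Integration.integral_add schwartz_integrable schwartz_phase_mult assms)

lemma fourier_cmult: "fourier (\<lambda>x. c * \<phi> x) = (\<lambda>\<xi>. c * fourier \<phi> \<xi>)"
  unfolding fourier_phase by (simp add: mult.left_commute)

lemma norm_fourier_le:
  assumes "schwartz \<phi>"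
  shows "norm (fourier \<phi> \<xi>) \<le> (\<integral>x. norm (\<phi> x) \<partial>lborel)"
  unfolding fourier_phase by (rule order_trans[OF integral_norm_bound]) (simp add: norm_mult)

lemma fourier_bound:
  "\<exists>C K. \<forall>\<phi>::real^'n::finite \<Rightarrow> complex. schwartz \<phi> \<longrightarrow> (\<forall>\<xi>. norm (fourier \<phi> \<xi>) \<le> C * schwartz_sum K \<phi>)"
proof -
  let ?N = "CARD('n) + 2"
  let ?I = "\<integral>x. 1 / (1 + norm (x::real^'n)) ^ ?N \<partial>lborel"
  have "norm (fourier \<phi> \<xi>) \<le> ?I * schwartz_sum ?N \<phi>" if \<phi>: "schwartz \<phi>" for \<phi> :: "real^'n \<Rightarrow> complex" and \<xi>
  proof -
    have "norm (fourier \<phi> \<xi>) \<le> (\<integral>x. norm (\<phi> x) \<partial>lborel)" by (rule norm_fourier_le) fact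
    also have "\<dots> \<le> (\<integral>x. schwartz_sum ?N \<phi> * (1 / (1 + norm (x::real^'n)) ^ ?N) \<partial>lborel)"
    proof (rule Bochner_Integration.integral_mono)
      show "norm (\<phi> x) \<le> schwartz_sum ?N \<phi> * (1 / (1 + norm x) ^ ?N)" for x
        using schwartz_decay[OF \<phi>, of x ?N] by simp
    qed (intro schwartz_integrable_norm \<phi> integrable_mult_right integrable_decay)+
    finally show ?thesis unfolding integral_mult_right_zero by (simp only: mult.commute)
  qed
  then show ?thesis by blast
qed

lemma norm_cis_minus_Taylor: "norm (cis a - 1 - \<i> * of_real a) \<le> a\<^sup>2"
proof -
  \<comment> \<open>On the imaginary axis, a convex set, \<open>exp\<close> has modulus one, which
    bounds the derivatives in Taylor's theorem by 1.\<close>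
  have "norm (exp (\<i> * of_real a) - (\<Sum>i\<le>1. exp 0 * (\<i> * of_real a - 0) ^ i / fact i)) \<le> 1 * norm (\<i> * of_real a - 0) ^ Suc 1 / fact 1"
    by (rule complex_Taylor[where S = "{z. Re z = 0}" and f = "\<lambda>i. exp"])
       (auto intro!: derivative_eq_intros simp: convex_def norm_exp_eq_Re)
  then show ?thesis
    by (simp add: cis_conv_exp norm_mult power2_eq_square algebra_simps)
qed

text \<open>Differentiation under the integral by an explicit remainder: the second-order bound for
  \<open>cis\<close> is integrated, and the error is at most \<open>B\<close> times the squared
  increment, where \<open>B\<close> comes from the weighted second moment of
  \<open>\<phi>\<close>.\<close>

lemma has_derivative_fourier:
  assumes \<phi>: "schwartz (\<phi> :: real^'n::finite \<Rightarrow> complex)"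
  shows "(fourier \<phi> has_derivative (\<lambda>h. \<Sum>i\<in>UNIV. of_real (h $ i) * fourier (\<lambda>x. - (2 * pi * \<i>) * coord_mult i \<phi> x) \<xi>)) (at \<xi>)"
    (is "(_ has_derivative ?D) _")
proof -
  define B where "B = (2 * pi)\<^sup>2 * (\<integral>x. (1 + norm x) ^ 2 * norm (\<phi> x) \<partial>lborel)"
  have B0: "B \<ge> 0" unfolding B_def by (auto intro!: mult_nonneg_nonneg integral_nonneg_AE)
  have X: "schwartz (\<lambda>x. - (2 * pi * \<i>) * coord_mult i \<phi> x)" for i
    by (intro schwartz_cmult schwartz_op_schwartz[OF schwartz_op_coord_mult] \<phi>)
  have D: "?D h = (\<integral>x. phase (- \<xi>) 0 x * (\<i> * of_real (- 2 * pi * (x \<bullet> h))) * \<phi> x \<partial>lborel)" for h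
  proof -
    have "?D h = (\<Sum>i\<in>UNIV. \<integral>x. of_real (h $ i) * (phase (- \<xi>) 0 x * (- (2 * pi * \<i>) * coord_mult i \<phi> x)) \<partial>lborel)"
      unfolding fourier_phase by simp
    also have "\<dots> = (\<integral>x. (\<Sum>i\<in>UNIV. of_real (h $ i) * (phase (- \<xi>) 0 x * (- (2 * pi * \<i>) * coord_mult i \<phi> x))) \<partial>lborel)"
      by (rule Bochner_Integration.integral_sum[symmetric])
         (intro integrable_mult_right schwartz_integrable schwartz_phase_mult X)
    also have "\<dots> = (\<integral>x. phase (- \<xi>) 0 x * (\<i> * of_real (- 2 * pi * (x \<bullet> h))) * \<phi> x \<partial>lborel)"
      by (intro Bochner_Integration.integral_cong)
         (auto simp: coord_mult_def inner_vec_def sum_distrib_left sum_distrib_right mult_ac)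
    finally show ?thesis .
  qed
  have Dint: "integrable lborel (\<lambda>x. phase (- \<xi>) 0 x * (\<i> * of_real (- 2 * pi * (x \<bullet> h))) * \<phi> x)" for h
  proof -
    have "integrable lborel (\<lambda>x. (\<Sum>i\<in>UNIV. of_real (h $ i) * (phase (- \<xi>) 0 x * (- (2 * pi * \<i>) * coord_mult i \<phi> x))))"
      by (intro Bochner_Integration.integrable_sum integrable_mult_right schwartz_integrable schwartz_phase_mult X)
    then show ?thesis
      by (rule Bochner_Integration.integrable_cong[THEN iffD1, rotated -1])
         (auto simp: coord_mult_def inner_vec_def sum_distrib_left sum_distrib_right mult_ac)
  qed
  have est: "norm (fourier \<phi> (\<xi> + h) - fourier \<phi> \<xi> - ?D h) \<le> B * (norm h)\<^sup>2" for h
  proof -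
    let ?f = "\<lambda>x. phase (- (\<xi> + h)) 0 x * \<phi> x - phase (- \<xi>) 0 x * \<phi> x - phase (- \<xi>) 0 x * (\<i> * of_real (- 2 * pi * (x \<bullet> h))) * \<phi> x"
    have i: "integrable lborel (\<lambda>x. phase (- (\<xi> + h)) 0 x * \<phi> x)" "integrable lborel (\<lambda>x. phase (- \<xi>) 0 x * \<phi> x)"
      by (intro schwartz_integrable schwartz_phase_mult \<phi>)+
    have "fourier \<phi> (\<xi> + h) - fourier \<phi> \<xi> - ?D h = (\<integral>x. phase (- (\<xi> + h)) 0 x * \<phi> x \<partial>lborel) -
       (\<integral>x. phase (- \<xi>) 0 x * \<phi> x \<partial>lborel) - (\<integral>x. phase (- \<xi>) 0 x * (\<i> * of_real (- 2 * pi * (x \<bullet> h))) * \<phi> x \<partial>lborel)"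
      unfolding D unfolding fourier_phase by (rule refl)
    also have "\<dots> = (\<integral>x. ?f x \<partial>lborel)"
      unfolding Bochner_Integration.integral_diff[OF Bochner_Integration.integrable_diff[OF i] Dint]
        Bochner_Integration.integral_diff[OF i] by (rule refl)
    finally have "norm (fourier \<phi> (\<xi> + h) - fourier \<phi> \<xi> - ?D h) \<le> (\<integral>x. norm (?f x) \<partial>lborel)"
      by (simp only: integral_norm_bound)
    also have "\<dots> \<le> (\<integral>x. ((2 * pi)\<^sup>2 * (norm h)\<^sup>2) * ((1 + norm x) ^ 2 * norm (\<phi> x)) \<partial>lborel)"
    proof (rule Bochner_Integration.integral_mono)
      show "integrable lborel (\<lambda>x. norm (?f x))"
        by (intro integrable_norm Bochner_Integration.integrable_diff schwartz_integrable schwartz_phase_mult \<phi> Dint)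
      show "integrable lborel (\<lambda>x. ((2 * pi)\<^sup>2 * (norm h)\<^sup>2) * ((1 + norm x) ^ 2 * norm (\<phi> x)))"
        by (intro integrable_mult_right schwartz_integrable_power \<phi>)
      fix x
      define a where "a = - 2 * pi * (x \<bullet> h)"
      have "phase (- (\<xi> + h)) 0 x = phase (- \<xi>) 0 x * cis a"
        by (simp add: phase_def a_def cis_mult inner_simps inner_commute algebra_simps)
      then have "?f x = phase (- \<xi>) 0 x * (cis a - 1 - \<i> * of_real a) * \<phi> x"
        unfolding a_def[symmetric] by (simp add: algebra_simps)
      then have "norm (?f x) \<le> a\<^sup>2 * norm (\<phi> x)"
        using norm_cis_minus_Taylor[of a] by (simp add: norm_mult mult_right_mono)
      also have "\<dots> \<le> (2 * pi * (norm h * (1 + norm x)))\<^sup>2 * norm (\<phi> x)"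
      proof (rule mult_right_mono, rule power2_le_iff_abs_le[THEN iffD2])
        have "\<bar>x \<bullet> h\<bar> \<le> norm x * norm h" by (rule Cauchy_Schwarz_ineq2)
        also have "\<dots> \<le> norm h * (1 + norm x)" by (simp add: algebra_simps)
        finally show "\<bar>a\<bar> \<le> 2 * pi * (norm h * (1 + norm x))" by (simp add: a_def abs_mult)
      qed simp_all
      finally show "norm (?f x) \<le> ((2 * pi)\<^sup>2 * (norm h)\<^sup>2) * ((1 + norm x) ^ 2 * norm (\<phi> x))"
        by (simp only: power_mult_distrib mult.assoc)
    qed
    also have "\<dots> = B * (norm h)\<^sup>2" by (simp add: B_def)
    finally show ?thesis .
  qed
  show ?thesis
    unfolding has_derivative_at
  proof
    show "bounded_linear ?D"
      by (intro bounded_linear_sum bounded_linear_mult_const bounded_linear_compose[OF bounded_linear_of_real bounded_linear_vec_nth])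
    have "((\<lambda>h::real^'n. B * norm h) \<longlongrightarrow> B * norm (0::real^'n)) (at 0)"
      by (intro tendsto_mult tendsto_norm[OF tendsto_ident_at] tendsto_const)
    then have lim: "((\<lambda>h::real^'n. B * norm h) \<longlongrightarrow> 0) (at 0)" by simp
    have le: "norm (norm (fourier \<phi> (\<xi> + h) - fourier \<phi> \<xi> - ?D h) / norm h) \<le> B * norm h" for h
    proof -
      have "norm (a / n) \<le> B * n" if "a \<le> B * n\<^sup>2" "0 \<le> a" "0 \<le> n" for a n :: real
        using that B0 by (cases "n = 0") (simp_all add: divide_le_eq power2_eq_square mult.assoc)
      from this[OF est[of h]] show ?thesis by simp
    qed
    show "((\<lambda>h. norm (fourier \<phi> (\<xi> + h) - fourier \<phi> \<xi> - ?D h) / norm h) \<longlongrightarrow> 0) (at 0)"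
      by (rule Lim_null_comparison[OF always_eventually lim]) (rule allI, rule le)
  qed
qed

lemma differentiable_fourier: "schwartz \<phi> \<Longrightarrow> fourier \<phi> differentiable_on UNIV"
  using has_derivative_fourier by (fastforce simp: differentiable_on_def differentiable_def)

lemma partial_deriv_fourier:
  assumes "schwartz \<phi>"
  shows "partial_deriv i (fourier \<phi>) = fourier (\<lambda>x. - (2 * pi * \<i>) * coord_mult i \<phi> x)"
proof
  fix \<xi>
  have "(\<Sum>k\<in>UNIV. complex_of_real (axis i 1 $ k) * fourier (\<lambda>x. - (2 * pi * \<i>) * coord_mult k \<phi> x) \<xi>) =
    (\<Sum>k\<in>UNIV. if k = i then fourier (\<lambda>x. - (2 * pi * \<i>) * coord_mult k \<phi> x) \<xi> else 0)"
    by (rule sum.cong) (auto simp: axis_def)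
  then show "partial_deriv i (fourier \<phi>) \<xi> = fourier (\<lambda>x. - (2 * pi * \<i>) * coord_mult i \<phi> x) \<xi>"
    using partial_deriv_unique[OF has_derivative_fourier[OF assms], of i \<xi>] by simp
qed

section \<open>Translation invariance and integration by parts\<close>

lemma integral_lborel_translation:
  fixes f :: "'a::euclidean_space \<Rightarrow> 'b::{banach, second_countable_topology}"
  assumes [measurable]: "f \<in> borel_measurable borel"
  shows "(\<integral>x. f (x + c) \<partial>lborel) = (\<integral>x. f x \<partial>lborel)"
proof -
  have "(\<integral>x. f x \<partial>lborel) = (\<integral>x. f x \<partial>(distr lborel borel ((+) c)))" by (simp add: lborel_distr_plus)
  also have "\<dots> = (\<integral>x. f (c + x) \<partial>lborel)" by (rule integral_distr) auto
  finally show ?thesis by (simp add: add.commute)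
qed

lemma integrable_lborel_translation:
  fixes f :: "'a::euclidean_space \<Rightarrow> 'b::{banach, second_countable_topology}"
  assumes "integrable lborel f"
  shows "integrable lborel (\<lambda>x. f (x + c))"
proof -
  have [measurable]: "f \<in> borel_measurable borel" using assms by simp
  have "integrable (distr lborel borel ((+) c)) f" using assms by (simp add: lborel_distr_plus)
  then show ?thesis by (subst (asm) integrable_distr_eq) (auto simp: add.commute)
qed

text \<open>Difference quotients of \<open>h\<close> have integral zero by translation invariance,
  and the decay of the derivative dominates them, so the limit passes under the integral. No
  boundary terms have to be estimated.\<close>

lemma integral_partial_deriv_zero:
  assumes h: "schwartz (h :: real^'n::finite \<Rightarrow> complex)"
  shows "(\<integral>x. partial_deriv i h x \<partial>lborel) = 0"
proof -
  let ?e = "axis i 1 :: real^'n" and ?N = "CARD('n) + 2"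
  define q where "q n x = (h (x + (1 / real (Suc n)) *\<^sub>R ?e) - h x) * of_nat (Suc n)" for n x
  have Dh: "schwartz (partial_deriv i h)" using schwartz_op_schwartz[OF schwartz_op_partial_deriv h] .
  define S where "S = schwartz_sum ?N (partial_deriv i h)"
  have S0: "S \<ge> 0" unfolding S_def by (rule schwartz_sum_nonneg[OF Dh])
  have hm [measurable]: "h \<in> borel_measurable borel" "partial_deriv i h \<in> borel_measurable borel"
    using h Dh schwartz_measurable by auto
  have line: "((\<lambda>\<tau>. h (x + \<tau> *\<^sub>R ?e)) has_derivative (\<lambda>d. d *\<^sub>R partial_deriv i h (x + \<tau> *\<^sub>R ?e))) (at \<tau> within A)" for x \<tau> A
  proof -
    have "((\<lambda>\<tau>. x + \<tau> *\<^sub>R ?e) has_derivative (\<lambda>d. d *\<^sub>R ?e)) (at \<tau> within A)"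
      by (auto intro!: derivative_eq_intros)
    from has_derivative_compose[OF this smooth_has_derivative[OF schwartz_smooth[OF h]]]
    have "((\<lambda>\<tau>. h (x + \<tau> *\<^sub>R ?e)) has_derivative (\<lambda>d. frechet_derivative h (at (x + \<tau> *\<^sub>R ?e)) (d *\<^sub>R ?e))) (at \<tau> within A)" .
    moreover have "linear (frechet_derivative h (at (x + \<tau> *\<^sub>R ?e)))"
      using smooth_has_derivative[OF schwartz_smooth[OF h]] has_derivative_linear by blast
    ultimately show ?thesis by (simp add: linear_scale partial_deriv_def)
  qed
  have "(\<lambda>n. \<integral>x. q n x \<partial>lborel) \<longlonglongrightarrow> (\<integral>x. partial_deriv i h x \<partial>lborel)"
  proof (rule integral_dominated_convergence)
    show "integrable lborel (\<lambda>x::real^'n. (S * 2 ^ ?N) * (1 / (1 + norm x) ^ ?N))"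
      by (intro integrable_mult_right integrable_decay)
    show "AE x in lborel. (\<lambda>n. q n x) \<longlonglongrightarrow> partial_deriv i h x"
    proof (rule AE_I2)
      fix x
      let ?t = "\<lambda>n. 1 / real (Suc n)"
      have "((\<lambda>d. norm (h (x + (0 + d) *\<^sub>R ?e) - h (x + 0 *\<^sub>R ?e) - d *\<^sub>R partial_deriv i h (x + 0 *\<^sub>R ?e)) / norm d) \<longlongrightarrow> 0) (at 0)"
        using line[of x 0 UNIV] unfolding has_derivative_at by blast
      moreover have "filterlim ?t (at 0) sequentially"
        unfolding filterlim_at using LIMSEQ_Suc[OF lim_1_over_n[where 'a=real]] by auto
      ultimately have "(\<lambda>n. norm (h (x + (0 + ?t n) *\<^sub>R ?e) - h (x + 0 *\<^sub>R ?e) - ?t n *\<^sub>R partial_deriv i h (x + 0 *\<^sub>R ?e)) / norm (?t n)) \<longlonglongrightarrow> 0"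
        by (rule filterlim_compose)
      moreover have "norm (h (x + (0 + ?t n) *\<^sub>R ?e) - h (x + 0 *\<^sub>R ?e) - ?t n *\<^sub>R partial_deriv i h (x + 0 *\<^sub>R ?e)) / norm (?t n)
          = norm (q n x - partial_deriv i h x)" for n
      proof -
        have "q n x - partial_deriv i h x = (h (x + ?t n *\<^sub>R ?e) - h x - ?t n *\<^sub>R partial_deriv i h x) * of_nat (Suc n)"
          unfolding q_def scaleR_conv_of_real by (simp add: field_simps del: of_nat_Suc)
        then show ?thesis by (simp add: norm_mult del: of_nat_Suc)
      qed
      ultimately have "(\<lambda>n. norm (q n x - partial_deriv i h x)) \<longlonglongrightarrow> 0" by simp
      then show "(\<lambda>n. q n x) \<longlonglongrightarrow> partial_deriv i h x" by (simp add: tendsto_norm_zero_iff LIM_zero_iff)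
    qed
    show "AE x in lborel. norm (q n x) \<le> (S * 2 ^ ?N) * (1 / (1 + norm x) ^ ?N)" for n
    proof (rule AE_I2)
      fix x :: "real^'n"
      let ?t = "1 / real (Suc n)"
      have "norm (h (x + ?t *\<^sub>R ?e) - h (x + 0 *\<^sub>R ?e)) \<le> ((S * 2 ^ ?N) * (1 / (1 + norm x) ^ ?N)) * norm (?t - 0)"
      proof (rule differentiable_bound[where S = "{0..1}"])
        fix \<tau> :: real assume \<tau>: "\<tau> \<in> {0..1}"
        show "((\<lambda>\<tau>. h (x + \<tau> *\<^sub>R ?e)) has_derivative (\<lambda>d. d *\<^sub>R partial_deriv i h (x + \<tau> *\<^sub>R ?e))) (at \<tau> within {0..1})"
          by (rule line)
        \<comment> \<open>The segment from \<open>x\<close> has length at most one, hence the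
          weights along it are comparable up to the factor 2, and decay at any of its points
          transfers to \<open>x\<close>.\<close>
        have "norm x \<le> norm (x + \<tau> *\<^sub>R ?e) + norm (\<tau> *\<^sub>R ?e)"
          using norm_triangle_ineq4[of "x + \<tau> *\<^sub>R ?e" "\<tau> *\<^sub>R ?e"] by simp
        moreover have "norm (\<tau> *\<^sub>R ?e) \<le> 1" using \<tau> by simp
        ultimately have "1 + norm x \<le> 2 * (1 + norm (x + \<tau> *\<^sub>R ?e))"
        proof -
          have "1 + a \<le> 2 * (1 + b)" if "a \<le> b + c" "c \<le> 1" "0 \<le> b" for a b c :: real
            using that by simp
          then show "norm x \<le> norm (x + \<tau> *\<^sub>R ?e) + norm (\<tau> *\<^sub>R ?e) \<Longrightarrow> norm (\<tau> *\<^sub>R ?e) \<le> 1 \<Longrightarrow> ?thesis"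
            using norm_ge_zero by blast
        qed
        then have le: "(1 + norm x) ^ ?N \<le> 2 ^ ?N * (1 + norm (x + \<tau> *\<^sub>R ?e)) ^ ?N"
          unfolding power_mult_distrib[symmetric] by (intro power_mono) auto
        have p: "(1 + norm x) ^ ?N > 0" "(1 + norm (x + \<tau> *\<^sub>R ?e)) ^ ?N > 0"
          by (intro zero_less_power; simp add: add_pos_nonneg)+
        have "norm (partial_deriv i h (x + \<tau> *\<^sub>R ?e)) \<le> S / (1 + norm (x + \<tau> *\<^sub>R ?e)) ^ ?N"
          unfolding S_def by (rule schwartz_decay[OF Dh])
        also have "\<dots> \<le> (S * 2 ^ ?N) * (1 / (1 + norm x) ^ ?N)"
          using mult_left_mono[OF le S0] p by (simp add: field_simps)
        finally show "onorm (\<lambda>d. d *\<^sub>R partial_deriv i h (x + \<tau> *\<^sub>R ?e)) \<le> (S * 2 ^ ?N) * (1 / (1 + norm x) ^ ?N)"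
          by (simp add: onorm_scaleR_left onorm_id)
      qed auto
      then have "norm (h (x + ?t *\<^sub>R ?e) - h x) * real (Suc n) \<le> (((S * 2 ^ ?N) * (1 / (1 + norm x) ^ ?N)) * ?t) * real (Suc n)"
        by (intro mult_right_mono) auto
      then show "norm (q n x) \<le> (S * 2 ^ ?N) * (1 / (1 + norm x) ^ ?N)"
        by (simp add: q_def norm_mult del: of_nat_Suc)
    qed
    show "partial_deriv i h \<in> borel_measurable lborel" "q n \<in> borel_measurable lborel" for n
      unfolding q_def[abs_def] using hm by measurable
  qed
  moreover have "(\<integral>x. q n x \<partial>lborel) = 0" for n
  proof -
    have "(\<integral>x. h (x + (1 / real (Suc n)) *\<^sub>R ?e) - h x \<partial>lborel) = 0"
      using schwartz_integrable[OF h] integrable_lborel_translation[OF schwartz_integrable[OF h]]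
      by (subst Bochner_Integration.integral_diff) (auto simp: integral_lborel_translation simp del: of_nat_Suc)
    then show ?thesis unfolding q_def by simp
  qed
  ultimately show ?thesis using LIMSEQ_unique[OF _ tendsto_const] by auto
qed

text \<open>The vanishing integral is applied to the product of \<open>\<phi>\<close> with the
  character; the derivative of the character produces the factor \<open>\<xi> $ i\<close>.\<close>

lemma fourier_partial_deriv:
  assumes "schwartz \<phi>"
  shows "fourier (partial_deriv i \<phi>) \<xi> = 2 * pi * \<i> * of_real (\<xi> $ i) * fourier \<phi> \<xi>"
proof -
  have 1: "schwartz (\<lambda>x. phase (- \<xi>) 0 x * \<phi> x)" "schwartz (\<lambda>x. phase (- \<xi>) 0 x * partial_deriv i \<phi> x)"
    by (intro schwartz_phase_mult schwartz_op_schwartz[OF schwartz_op_partial_deriv] assms)+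
  have "0 = (\<integral>x. partial_deriv i (\<lambda>x. phase (- \<xi>) 0 x * \<phi> x) x \<partial>lborel)"
    by (rule integral_partial_deriv_zero[symmetric]) (rule 1)
  also have "\<dots> = (\<integral>x. phase (- \<xi>) 0 x * partial_deriv i \<phi> x + \<i> * of_real (2 * pi * - \<xi> $ i) * (phase (- \<xi>) 0 x * \<phi> x) \<partial>lborel)"
    by (simp add: partial_deriv_phase_mult schwartz_smooth assms)
  also have "\<dots> = fourier (partial_deriv i \<phi>) \<xi> + \<i> * of_real (2 * pi * - \<xi> $ i) * fourier \<phi> \<xi>"
    unfolding fourier_phase
    by (subst Bochner_Integration.integral_add[OF schwartz_integrable[OF 1(2)] integrable_mult_right[OF schwartz_integrable[OF 1(1)]]]) simp
  finally show ?thesis by (simp add: algebra_simps)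
qed

lemma schwartz_op_cmult:
  assumes "schwartz_op T" shows "schwartz_op (\<lambda>\<phi> x. c * T \<phi> x)"
proof (rule schwartz_opI)
  fix N :: nat and \<alpha> :: "'b list"
  have "(1 + norm x) ^ N * norm (partial_derivs \<alpha> (\<lambda>x. c * \<phi> x) x) \<le> norm c * schwartz_sum (N + length \<alpha>) \<phi>"
    if "schwartz \<phi>" for \<phi> :: "real^'b \<Rightarrow> complex" and x
    using mult_left_mono[OF schwartz_sum_upper[OF that, of \<alpha> "N + length \<alpha>" N x], of "norm c"]
    by (simp add: partial_derivs_cmult schwartz_smooth that norm_mult algebra_simps)
  then show "\<exists>C K. \<forall>\<phi>. schwartz \<phi> \<longrightarrow> (\<forall>x. (1 + norm x) ^ N * norm (partial_derivs \<alpha> (\<lambda>x. c * T \<phi> x) x) \<le> C * schwartz_sum K \<phi>)"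
    using schwartz_op_bound_compose[where Q = "\<lambda>\<phi> x. (1 + norm x) ^ N * norm (partial_derivs \<alpha> (\<lambda>x. c * \<phi> x) x)", OF assms]
    by blast
qed (use assms in \<open>simp_all add: schwartz_op_def distrib_left mult.left_commute schwartz_cmult schwartz_smooth\<close>)

text \<open>Each derivative becomes a coordinate factor inside the integral. Recording only that
  some continuous operator \<open>T\<close> does this lets \<open>fourier_decay\<close>, stated for
  the transform itself, cover all of its derivatives.\<close>

lemma partial_derivs_fourier:
  "\<exists>T. schwartz_op T \<and> (\<forall>\<phi>::real^'n::finite \<Rightarrow> complex. schwartz \<phi> \<longrightarrow> partial_derivs \<alpha> (fourier \<phi>) = fourier (T \<phi>))"
proof (induction \<alpha>)
  case Nil
  then show ?case using schwartz_op_id by auto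
next
  case (Cons i \<alpha>)
  then obtain T where T: "schwartz_op T" "\<And>\<phi>::real^'n \<Rightarrow> complex. schwartz \<phi> \<Longrightarrow> partial_derivs \<alpha> (fourier \<phi>) = fourier (T \<phi>)"
    by blast
  from schwartz_op_compose[OF schwartz_op_cmult[OF schwartz_op_coord_mult] T(1)]
  have "schwartz_op (\<lambda>\<phi> x. - (2 * pi * \<i>) * coord_mult i (T \<phi>) x)" .
  moreover have "partial_derivs (i # \<alpha>) (fourier \<phi>) = fourier (\<lambda>x. - (2 * pi * \<i>) * coord_mult i (T \<phi>) x)"
    if "schwartz \<phi>" for \<phi> :: "real^'n \<Rightarrow> complex"
    by (simp add: partial_derivs_Cons T(2) that partial_deriv_fourier schwartz_op_schwartz[OF T(1)])
  ultimately show ?case by blast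
qed

lemma smooth_fourier: "schwartz \<phi> \<Longrightarrow> smooth (fourier \<phi>)"
  unfolding smooth_def using partial_derivs_fourier differentiable_fourier schwartz_op_schwartz by metis

text \<open>One more power of the weight costs one derivative: the norm of \<open>\<xi>\<close> is
  at most the sum of its absolute coordinates, and \<open>\<xi> $ i\<close> times the transform is,
  up to a factor of modulus 2 pi, the transform of \<open>partial_deriv i \<phi>\<close>.\<close>

lemma fourier_decay:
  "\<exists>C K. \<forall>\<phi>::real^'n::finite \<Rightarrow> complex. schwartz \<phi> \<longrightarrow>
     (\<forall>\<xi>. (1 + norm \<xi>) ^ N * norm (fourier \<phi> \<xi>) \<le> C * schwartz_sum K \<phi>)"
proof (induction N)
  case 0
  then show ?case using fourier_bound by simp
next
  case (Suc N)
  let ?Q = "\<lambda>\<phi>::real^'n\<Rightarrow>complex. \<lambda>\<xi>. (1 + norm \<xi>) ^ N * norm (fourier \<phi> \<xi>)"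
  obtain C0 K0 where C0: "C0 \<ge> 0" "\<And>\<phi> \<xi>. schwartz \<phi> \<Longrightarrow> ?Q \<phi> \<xi> \<le> C0 * schwartz_sum K0 \<phi>"
    using schwartz_op_bound_compose[where Q = ?Q, OF schwartz_op_id Suc] by blast
  have "\<exists>C K. C \<ge> 0 \<and> (\<forall>\<phi>. schwartz \<phi> \<longrightarrow> (\<forall>\<xi>. ?Q (partial_deriv i \<phi>) \<xi> \<le> C * schwartz_sum K \<phi>))" for i
    using schwartz_op_bound_compose[where Q = ?Q, OF schwartz_op_partial_deriv Suc] .
  then obtain C K where C: "\<And>i. C i \<ge> 0"
    "\<And>i \<phi> \<xi>. schwartz \<phi> \<Longrightarrow> ?Q (partial_deriv i \<phi>) \<xi> \<le> C i * schwartz_sum (K i) \<phi>"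
    by metis
  define L where "L = K0 + (\<Sum>i\<in>UNIV. K i)"
  have "(1 + norm \<xi>) ^ Suc N * norm (fourier \<phi> \<xi>) \<le> (C0 + (\<Sum>i\<in>UNIV. C i)) * schwartz_sum L \<phi>"
    if \<phi>: "schwartz \<phi>" for \<phi> :: "real^'n \<Rightarrow> complex" and \<xi>
  proof -
    have "norm \<xi> \<le> (\<Sum>i\<in>UNIV. \<bar>\<xi> $ i\<bar>)" by (rule norm_le_l1_cart)
    then have "(1 + norm \<xi>) * ?Q \<phi> \<xi> \<le> (1 + (\<Sum>i\<in>UNIV. \<bar>\<xi> $ i\<bar>)) * ?Q \<phi> \<xi>"
      by (intro mult_right_mono) auto
    also have "\<dots> = ?Q \<phi> \<xi> + (\<Sum>i\<in>UNIV. \<bar>\<xi> $ i\<bar> * ?Q \<phi> \<xi>)" by (simp add: distrib_right sum_distrib_right)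
    also have "\<dots> \<le> C0 * schwartz_sum L \<phi> + (\<Sum>i\<in>UNIV. C i * schwartz_sum L \<phi>)"
    proof (intro add_mono sum_mono)
      show "?Q \<phi> \<xi> \<le> C0 * schwartz_sum L \<phi>"
        by (rule order_trans[OF C0(2)[OF \<phi>]]) (use \<phi> C0 in \<open>auto simp: L_def intro!: mult_left_mono schwartz_sum_mono\<close>)
      fix i
      have "1 * (\<bar>\<xi> $ i\<bar> * ?Q \<phi> \<xi>) \<le> (2 * pi) * (\<bar>\<xi> $ i\<bar> * ?Q \<phi> \<xi>)"
        using pi_ge_two by (intro mult_right_mono) auto
      also have "\<dots> = ?Q (partial_deriv i \<phi>) \<xi>"
        by (simp add: fourier_partial_deriv \<phi> norm_mult)
      also have "\<dots> \<le> C i * schwartz_sum L \<phi>"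
        by (rule order_trans[OF C(2)[OF \<phi>]])
           (use \<phi> C in \<open>auto simp: L_def intro!: mult_left_mono schwartz_sum_mono trans_le_add2 member_le_sum\<close>)
      finally show "\<bar>\<xi> $ i\<bar> * ?Q \<phi> \<xi> \<le> C i * schwartz_sum L \<phi>" by simp
    qed
    finally show ?thesis by (simp add: algebra_simps sum_distrib_left sum_distrib_right)
  qed
  then show ?case by blast
qed

lemma schwartz_op_fourier: "schwartz_op (fourier :: (real^'n::finite \<Rightarrow> complex) \<Rightarrow> _)"
proof (rule schwartz_opI)
  fix N :: nat and \<alpha> :: "'n list"
  obtain T where T: "schwartz_op T" "\<And>\<phi>::real^'n \<Rightarrow> complex. schwartz \<phi> \<Longrightarrow> partial_derivs \<alpha> (fourier \<phi>) = fourier (T \<phi>)"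
    using partial_derivs_fourier by blast
  show "\<exists>C K. \<forall>\<phi>::real^'n \<Rightarrow> complex. schwartz \<phi> \<longrightarrow> (\<forall>x. (1 + norm x) ^ N * norm (partial_derivs \<alpha> (fourier \<phi>) x) \<le> C * schwartz_sum K \<phi>)"
    using schwartz_op_bound_compose[where Q = "\<lambda>\<phi> \<xi>. (1 + norm \<xi>) ^ N * norm (fourier \<phi> \<xi>)", OF T(1) fourier_decay] T(2)
    by metis
qed (simp_all add: fourier_add fourier_cmult smooth_fourier)

lemma schwartz_fourier: "schwartz \<phi> \<Longrightarrow> schwartz (fourier \<phi>)"
  using schwartz_op_schwartz[OF schwartz_op_fourier] .

text \<open>The reflection is written in the affine form covered by
  \<open>schwartz_op_affine\<close>, so continuity of the inverse transform comes from
  composition.\<close>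

lemma inv_fourier_eq: "inv_fourier \<phi> x = fourier \<phi> ((- 1) *\<^sub>R x - 0)"
  by (simp add: inv_fourier_def fourier_def inner_commute)

lemma schwartz_op_inv_fourier: "schwartz_op inv_fourier"
  using schwartz_op_compose[OF schwartz_op_affine[of "- 1" 0] schwartz_op_fourier]
  by (simp add: inv_fourier_eq[abs_def])

lemma schrodinger_eq:
  "schrodinger t u = (\<lambda>\<phi>. u (fourier (\<lambda>x. phase 0 (4 * pi\<^sup>2 * t) x * inv_fourier \<phi> x)))"
  by (simp add: schrodinger_def fourier_multiplier_def dist_inv_fourier_def dist_mult_def dist_fourier_def phase_def)

lemma tempered_schrodinger:
  assumes "tempered u" shows "tempered (schrodinger t u)"
  unfolding schrodinger_eq
  by (rule tempered_compose[OF assms])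
     (rule schwartz_op_compose[OF schwartz_op_fourier schwartz_op_compose[OF schwartz_op_phase_mult schwartz_op_inv_fourier]])

subsection \<open>Lattice points and the tiling of space by cells\<close>

lemma of_int_vec_nth [simp]: "of_int_vec k $ i = of_int (k $ i)"
  by (simp add: of_int_vec_def)

lemma of_int_vec_simps [simp]:
  "of_int_vec 0 = 0" "of_int_vec (k + l) = of_int_vec k + of_int_vec l"
  "of_int_vec (k - l) = of_int_vec k - of_int_vec l" "of_int_vec (- k) = - of_int_vec k"
  by (simp_all add: vec_eq_iff)

text \<open>Half open, so that every point lies in exactly one lattice translate and no null sets
  have to be discarded. The closed centred \<open>cube\<close> serves where compactness is needed
  instead.\<close>

definition cell :: "real \<Rightarrow> (real^'n::finite) set" where
  "cell c = {x. \<forall>i. 0 \<le> x $ i \<and> x $ i < c}"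

lemma borel_cell [measurable]: "cell c \<in> sets borel"
proof -
  have "cell c = (\<Inter>i. {x. 0 \<le> x $ i} \<inter> {x. x $ i < c})" by (auto simp: cell_def)
  also have "\<dots> \<in> sets borel" by measurable
  finally show ?thesis .
qed

lemma emeasure_cell:
  assumes "c > 0"
  shows "emeasure lborel (cell c :: (real^'n::finite) set) = ennreal (c ^ CARD('n))"
proof -
  let ?u = "(\<chi> i. c) :: real^'n"
  have u: "?u \<bullet> b = c" if "b \<in> Basis" for b
    using that by (auto simp: Basis_vec_def inner_axis)
  have "emeasure lborel (box 0 ?u) = ennreal (c ^ CARD('n))" "emeasure lborel (cbox 0 ?u) = ennreal (c ^ CARD('n))"
    using assms u by (subst emeasure_lborel_box emeasure_lborel_cbox; force)+
  moreover have "emeasure lborel (box 0 ?u) \<le> emeasure lborel (cell c :: (real^'n) set)"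
    "emeasure lborel (cell c :: (real^'n) set) \<le> emeasure lborel (cbox 0 ?u)"
    by (auto intro!: emeasure_mono simp: cell_def mem_box_cart less_imp_le)
  ultimately show ?thesis by simp
qed

lemma cell_unique:
  assumes "c > 0"
  shows "x - c *\<^sub>R of_int_vec m \<in> cell c \<longleftrightarrow> m = (\<chi> i. \<lfloor>x $ i / c\<rfloor>)"
proof -
  have "0 \<le> x $ i - c * of_int (m $ i) \<and> x $ i - c * of_int (m $ i) < c \<longleftrightarrow> m $ i = \<lfloor>x $ i / c\<rfloor>" for i
    unfolding eq_commute[of "m $ i"] floor_eq_iff using assms by (auto simp: field_simps)
  then show ?thesis by (simp add: cell_def vec_eq_iff)
qed

section \<open>Integrals over space as integrals of lattice sums over a cell\<close>

lemma nn_integral_lborel_translation: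
  fixes f :: "'a::euclidean_space \<Rightarrow> ennreal"
  assumes [measurable]: "f \<in> borel_measurable borel"
  shows "(\<integral>\<^sup>+x. f (x + c) \<partial>lborel) = (\<integral>\<^sup>+x. f x \<partial>lborel)"
proof -
  have "(\<integral>\<^sup>+x. f x \<partial>lborel) = (\<integral>\<^sup>+x. f x \<partial>(distr lborel borel ((+) c)))" by (simp add: lborel_distr_plus)
  also have "\<dots> = (\<integral>\<^sup>+x. f (c + x) \<partial>lborel)" by (rule nn_integral_distr) auto
  finally show ?thesis by (simp add: add.commute)
qed

lemma nn_integral_lborel_scaleR:
  fixes f :: "'a::euclidean_space \<Rightarrow> ennreal"
  assumes [measurable]: "f \<in> borel_measurable borel" and c: "c > 0"
  shows "(\<integral>\<^sup>+x. f x \<partial>lborel) = ennreal (c ^ DIM('a)) * (\<integral>\<^sup>+x. f (c *\<^sub>R x) \<partial>lborel)"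
proof -
  have "(\<integral>\<^sup>+x. f x \<partial>lborel) = (\<integral>\<^sup>+x. f x \<partial>(density (distr lborel borel (\<lambda>x. 0 + c *\<^sub>R x)) (\<lambda>_. \<bar>c\<bar> ^ DIM('a))))"
    using lborel_affine[of c "0::'a"] c by simp
  also have "\<dots> = (\<integral>\<^sup>+x. ennreal (c ^ DIM('a)) * f x \<partial>(distr lborel borel (\<lambda>x. 0 + c *\<^sub>R x)))"
    using c by (subst nn_integral_density) auto
  also have "\<dots> = (\<integral>\<^sup>+x. ennreal (c ^ DIM('a)) * f (0 + c *\<^sub>R x) \<partial>lborel)"
    by (rule nn_integral_distr) auto
  also have "\<dots> = ennreal (c ^ DIM('a)) * (\<integral>\<^sup>+x. f (c *\<^sub>R x) \<partial>lborel)"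
    by (subst nn_integral_cmult) auto
  finally show ?thesis .
qed

lemma nn_integral_count_space_Fubini:
  fixes f :: "'k::countable \<Rightarrow> 'a::euclidean_space \<Rightarrow> ennreal"
  assumes [measurable]: "\<And>k. f k \<in> borel_measurable borel"
  shows "(\<integral>\<^sup>+x. (\<integral>\<^sup>+k. f k x \<partial>count_space UNIV) \<partial>lborel) = (\<integral>\<^sup>+k. (\<integral>\<^sup>+x. f k x \<partial>lborel) \<partial>count_space UNIV)"
proof -
  interpret sigma_finite_measure "count_space (UNIV :: 'k set)" by (rule sigma_finite_measure_count_space)
  interpret pair_sigma_finite "count_space (UNIV :: 'k set)" "lborel :: 'a measure" ..
  show ?thesis
    by (rule Fubini') (rule measurable_pair_measure_countable1, auto)
qed

text \<open>The indicators of the translated cells add up to one at each point; Tonelli's theorem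
  and a translation of each summand do the rest.\<close>

lemma nn_integral_tiling:
  fixes f :: "real^'n::finite \<Rightarrow> ennreal"
  assumes [measurable]: "f \<in> borel_measurable borel" and c: "c > 0"
  shows "(\<integral>\<^sup>+x. f x \<partial>lborel) =
    (\<integral>\<^sup>+m. (\<integral>\<^sup>+x. f (x + c *\<^sub>R of_int_vec m) * indicator (cell c) x \<partial>lborel) \<partial>count_space UNIV)"
proof -
  have "f x = (\<integral>\<^sup>+m. f x * indicator (cell c) (x - c *\<^sub>R of_int_vec m) \<partial>count_space UNIV)" for x
  proof -
    let ?m = "\<chi> i. \<lfloor>x $ i / c\<rfloor>"
    have "(\<integral>\<^sup>+m. f x * indicator (cell c) (x - c *\<^sub>R of_int_vec m) \<partial>count_space UNIV) =
        (\<integral>\<^sup>+m. f x * indicator {?m} m \<partial>count_space UNIV)"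
      by (intro nn_integral_cong arg_cong2[where f="(*)"] refl) (simp add: indicator_def cell_unique[OF c])
    also have "\<dots> = f x" by (simp add: nn_integral_cmult_indicator)
    finally show ?thesis ..
  qed
  then have "(\<integral>\<^sup>+x. f x \<partial>lborel) = (\<integral>\<^sup>+x. (\<integral>\<^sup>+m. f x * indicator (cell c) (x - c *\<^sub>R of_int_vec m) \<partial>count_space UNIV) \<partial>lborel)"
    by (intro nn_integral_cong)
  also have "\<dots> = (\<integral>\<^sup>+m. (\<integral>\<^sup>+x. f x * indicator (cell c) (x - c *\<^sub>R of_int_vec m) \<partial>lborel) \<partial>count_space UNIV)"
    by (rule nn_integral_count_space_Fubini) measurable
  also have "\<dots> = (\<integral>\<^sup>+m. (\<integral>\<^sup>+x. f (x + c *\<^sub>R of_int_vec m) * indicator (cell c) x \<partial>lborel) \<partial>count_space UNIV)"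
  proof (rule nn_integral_cong)
    fix m :: "int^'n"
    have "(\<integral>\<^sup>+x. f x * indicator (cell c) (x - c *\<^sub>R of_int_vec m) \<partial>lborel) =
      (\<integral>\<^sup>+x. f (x + c *\<^sub>R of_int_vec m) * indicator (cell c) (x + c *\<^sub>R of_int_vec m - c *\<^sub>R of_int_vec m) \<partial>lborel)"
      by (rule nn_integral_lborel_translation[symmetric]) measurable
    then show "(\<integral>\<^sup>+x. f x * indicator (cell c) (x - c *\<^sub>R of_int_vec m) \<partial>lborel) =
      (\<integral>\<^sup>+x. f (x + c *\<^sub>R of_int_vec m) * indicator (cell c) x \<partial>lborel)" by simp
  qed
  finally show ?thesis .
qed

lemma nn_integral_tiling':
  fixes f :: "real^'n::finite \<Rightarrow> ennreal"
  assumes [measurable]: "f \<in> borel_measurable borel" and c: "c > 0"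
  shows "(\<integral>\<^sup>+x. f x \<partial>lborel) =
    (\<integral>\<^sup>+x. (\<integral>\<^sup>+m. f (x + c *\<^sub>R of_int_vec m) \<partial>count_space UNIV) * indicator (cell c) x \<partial>lborel)"
proof -
  have "(\<integral>\<^sup>+x. f x \<partial>lborel) = (\<integral>\<^sup>+m. (\<integral>\<^sup>+x. f (x + c *\<^sub>R of_int_vec m) * indicator (cell c) x \<partial>lborel) \<partial>count_space UNIV)"
    by (rule nn_integral_tiling) fact+
  also have "\<dots> = (\<integral>\<^sup>+x. (\<integral>\<^sup>+m. f (x + c *\<^sub>R of_int_vec m) * indicator (cell c) x \<partial>count_space UNIV) \<partial>lborel)"
    by (rule nn_integral_count_space_Fubini[symmetric]) measurable
  also have "\<dots> = (\<integral>\<^sup>+x. (\<integral>\<^sup>+m. f (x + c *\<^sub>R of_int_vec m) \<partial>count_space UNIV) * indicator (cell c) x \<partial>lborel)"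
    by (intro nn_integral_cong nn_integral_multc) auto
  finally show ?thesis .
qed

text \<open>The complex-valued counterpart, with the periodization given as \<open>S\<close>.
  \<open>G\<close> cuts \<open>f\<close> to a translated cell and sums to \<open>f\<close>;
  \<open>F\<close> is its translate to the basic cell and sums to \<open>S\<close> there. For each
  \<open>m\<close> the two have the same integral, and both are integrable on the product, so
  Fubini's theorem applies to each.\<close>

lemma integral_tiling:
  fixes f :: "real^'n::finite \<Rightarrow> complex"
  assumes f: "integrable lborel f" and c: "c > 0"
    and sums: "\<And>x. ((\<lambda>m. f (x + c *\<^sub>R of_int_vec m)) has_sum S x) UNIV"
  shows "(\<integral>x. f x \<partial>lborel) = (\<integral>x. indicator (cell c) x *\<^sub>R S x \<partial>lborel)"
proof -
  interpret sigma_finite_measure "count_space (UNIV :: (int^'n) set)" by (rule sigma_finite_measure_count_space)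
  interpret pair_sigma_finite "count_space (UNIV :: (int^'n) set)" "lborel :: (real^'n) measure" ..
  have [measurable]: "f \<in> borel_measurable borel" using f by simp
  define F where "F m x = indicator (cell c) x *\<^sub>R f (x + c *\<^sub>R of_int_vec m)" for m x
  have Fm: "case_prod F \<in> borel_measurable (count_space UNIV \<Otimes>\<^sub>M lborel)"
    unfolding F_def by (rule measurable_pair_measure_countable1) auto
  have "(\<integral>\<^sup>+p. norm (case_prod F p) \<partial>(count_space UNIV \<Otimes>\<^sub>M lborel)) =
      (\<integral>\<^sup>+m. (\<integral>\<^sup>+x. norm (F m x) \<partial>lborel) \<partial>count_space UNIV)"
    using Fm by (subst lborel.nn_integral_fst[symmetric]) auto
  also have "\<dots> = (\<integral>\<^sup>+m. (\<integral>\<^sup>+x. ennreal (norm (f (x + c *\<^sub>R of_int_vec m))) * indicator (cell c) x \<partial>lborel) \<partial>count_space UNIV)"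
    by (intro nn_integral_cong) (simp add: F_def indicator_def)
  also have "\<dots> = (\<integral>\<^sup>+x. norm (f x) \<partial>lborel)"
    by (rule nn_integral_tiling[symmetric]) (use c in auto)
  also have "\<dots> < \<infinity>" using f by (simp add: integrable_iff_bounded)
  finally have Fi: "integrable (count_space UNIV \<Otimes>\<^sub>M lborel) (case_prod F)"
    using Fm by (simp add: integrable_iff_bounded)
  define G where "G m x = indicator (cell c) (x - c *\<^sub>R of_int_vec m) *\<^sub>R f x" for m x
  have Gm: "case_prod G \<in> borel_measurable (count_space UNIV \<Otimes>\<^sub>M lborel)"
    unfolding G_def by (rule measurable_pair_measure_countable1) auto
  have sh: "(\<integral>\<^sup>+x. norm (G m x) \<partial>lborel) = (\<integral>\<^sup>+x. norm (F m x) \<partial>lborel)"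
       "(\<integral>x. G m x \<partial>lborel) = (\<integral>x. F m x \<partial>lborel)" for m
    using nn_integral_lborel_translation[of "\<lambda>x. norm (G m x)" "c *\<^sub>R of_int_vec m"]
      integral_lborel_translation[of "\<lambda>x. G m x" "c *\<^sub>R of_int_vec m"]
    by (simp_all add: G_def F_def)
  have "(\<integral>\<^sup>+p. norm (case_prod G p) \<partial>(count_space UNIV \<Otimes>\<^sub>M lborel)) =
      (\<integral>\<^sup>+m. (\<integral>\<^sup>+x. norm (G m x) \<partial>lborel) \<partial>count_space UNIV)"
    using Gm by (subst lborel.nn_integral_fst[symmetric]) auto
  also have "\<dots> = (\<integral>\<^sup>+p. norm (case_prod F p) \<partial>(count_space UNIV \<Otimes>\<^sub>M lborel))"
    using Fm by (subst lborel.nn_integral_fst[symmetric]) (auto simp: sh)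
  also have "\<dots> < \<infinity>" using Fi by (simp add: integrable_iff_bounded)
  finally have Gi: "integrable (count_space UNIV \<Otimes>\<^sub>M lborel) (case_prod G)"
    using Gm by (simp add: integrable_iff_bounded)
  have point: "(\<integral>m. G m x \<partial>count_space UNIV) = f x" for x
  proof -
    let ?m = "\<chi> i. \<lfloor>x $ i / c\<rfloor>"
    have "(\<integral>m. G m x \<partial>count_space UNIV) = (\<integral>m. indicator {?m} m *\<^sub>R f x \<partial>count_space UNIV)"
      unfolding G_def by (intro Bochner_Integration.integral_cong refl) (simp add: indicator_def cell_unique[OF c])
    also have "\<dots> = f x" by simp
    finally show ?thesis .
  qed
  have inner: "(\<integral>m. F m x \<partial>count_space UNIV) = indicator (cell c) x *\<^sub>R S x" for x
  proof (cases "x \<in> cell c")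
    case True
    have "(\<lambda>m. f (x + c *\<^sub>R of_int_vec m)) summable_on UNIV"
      using sums[of x] by (auto simp: summable_on_def)
    \<comment> \<open>Unconditional summability of complex families is absolute, which identifies
      the \<open>has_sum\<close> value with the integral over counting measure.\<close>
    then have "Infinite_Set_Sum.abs_summable_on (\<lambda>m. f (x + c *\<^sub>R of_int_vec m)) UNIV"
      by (simp add: abs_summable_equivalent summable_on_iff_abs_summable_on_complex)
    then have "infsetsum (\<lambda>m. f (x + c *\<^sub>R of_int_vec m)) UNIV = S x"
      using sums[of x] infsetsum_infsum by (metis infsumI)
    then show ?thesis using True by (simp add: F_def infsetsum_def)
  qed (simp add: F_def)
  have "(\<integral>x. f x \<partial>lborel) = (\<integral>x. (\<integral>m. G m x \<partial>count_space UNIV) \<partial>lborel)"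
    by (simp only: point)
  also have "\<dots> = (\<integral>m. (\<integral>x. G m x \<partial>lborel) \<partial>count_space UNIV)"
    by (rule Fubini_integral[OF Gi])
  also have "\<dots> = (\<integral>m. (\<integral>x. F m x \<partial>lborel) \<partial>count_space UNIV)" by (simp only: sh)
  also have "\<dots> = (\<integral>x. (\<integral>m. F m x \<partial>count_space UNIV) \<partial>lborel)"
    by (rule Fubini_integral[OF Fi, symmetric])
  finally show ?thesis by (simp only: inner)
qed

text \<open>Each lattice value is compared with the integrand on its unit cell; the factor
  \<open>?D\<close> appears because points of a cell have norm at most d. The dilation by
  \<open>S\<close> in the resulting integral produces \<open>S ^ CARD('n)\<close>.\<close>

lemma lattice_sum_bound:
  "\<exists>C\<ge>0. \<forall>S\<ge>1. (\<integral>\<^sup>+m. ennreal (1 / (1 + norm (of_int_vec (m::int^'n::finite)) / S) ^ (CARD('n) + 2)) \<partial>count_space UNIV)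
      \<le> ennreal (C * S ^ CARD('n))"
proof -
  let ?N = "CARD('n) + 2" and ?D = "1 + real CARD('n)"
  define I where "I = enn2real (\<integral>\<^sup>+x. ennreal (1 / (1 + norm (x::real^'n)) ^ ?N) \<partial>lborel)"
  have I: "ennreal I = (\<integral>\<^sup>+x. ennreal (1 / (1 + norm (x::real^'n)) ^ ?N) \<partial>lborel)" "I \<ge> 0"
    unfolding I_def using nn_integral_decay_finite[where 'n='n] by (auto simp: ennreal_enn2real_if)
  have "(\<integral>\<^sup>+m. ennreal (1 / (1 + norm (of_int_vec (m::int^'n)) / S) ^ ?N) \<partial>count_space UNIV)
      \<le> ennreal ((?D ^ ?N * I) * S ^ CARD('n))" if S: "S \<ge> 1" for S
  proof -
    let ?f = "\<lambda>x::real^'n. ennreal (1 / (1 + norm x / S) ^ ?N)"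
    have "(\<integral>\<^sup>+m. ?f (of_int_vec m) \<partial>count_space UNIV) \<le>
        (\<integral>\<^sup>+m. (\<integral>\<^sup>+x. (ennreal (?D ^ ?N) * ?f (x + 1 *\<^sub>R of_int_vec m)) * indicator (cell 1) x \<partial>lborel) \<partial>count_space UNIV)"
    proof (rule nn_integral_mono)
      fix m :: "int^'n"
      have "?f (of_int_vec m) = (\<integral>\<^sup>+x. ?f (of_int_vec m) * indicator (cell 1 :: (real^'n) set) x \<partial>lborel)"
        by (simp add: nn_integral_cmult_indicator emeasure_cell)
      also have "\<dots> \<le> (\<integral>\<^sup>+x. (ennreal (?D ^ ?N) * ?f (x + 1 *\<^sub>R of_int_vec m)) * indicator (cell 1) x \<partial>lborel)"
      proof (rule nn_integral_mono)
        fix x :: "real^'n"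
        show "?f (of_int_vec m) * indicator (cell 1) x \<le> (ennreal (?D ^ ?N) * ?f (x + 1 *\<^sub>R of_int_vec m)) * indicator (cell 1) x"
        proof (cases "x \<in> cell 1")
          case True
          have "norm x \<le> (\<Sum>i\<in>UNIV. \<bar>x $ i\<bar>)" by (rule norm_le_l1_cart)
          also have "\<dots> \<le> (\<Sum>i\<in>(UNIV::'n set). 1)" using True by (intro sum_mono) (auto simp: cell_def less_imp_le)
          finally have nx: "norm x \<le> real CARD('n)" by simp
          have "norm (x + of_int_vec m) \<le> real CARD('n) + norm (of_int_vec m)"
            using norm_triangle_ineq[of x "of_int_vec m"] nx by linarith
          then have "norm (x + of_int_vec m) / S \<le> real CARD('n) / S + norm (of_int_vec m) / S"
            using S by (simp add: add_divide_distrib[symmetric] divide_right_mono)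
          also have "real CARD('n) / S \<le> real CARD('n)" using S by (simp add: divide_le_eq mult_le_cancel_left1)
          finally have "1 + norm (x + of_int_vec m) / S \<le> ?D + norm (of_int_vec m) / S" by simp
          also have "\<dots> \<le> ?D * (1 + norm (of_int_vec m) / S)"
            using S by (simp add: algebra_simps divide_right_mono)
          finally have le: "(1 + norm (x + of_int_vec m) / S) ^ ?N \<le> ?D ^ ?N * (1 + norm (of_int_vec m) / S) ^ ?N"
            unfolding power_mult_distrib[symmetric] using S by (intro power_mono) (auto intro: add_nonneg_nonneg)
          have p: "(1 + norm (x + of_int_vec m) / S) ^ ?N > 0" "(1 + norm (of_int_vec m :: real^'n) / S) ^ ?N > 0"
            using S by (intro zero_less_power; simp add: add_pos_nonneg)+
          have "1 / (1 + norm (of_int_vec m :: real^'n) / S) ^ ?N \<le> ?D ^ ?N * (1 / (1 + norm (x + of_int_vec m) / S) ^ ?N)"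
          proof -
            have "1 / b \<le> D * (1 / a)" if "a \<le> D * b" "a > 0" "b > 0" for a b D :: real
              using that by (simp add: field_simps)
            then show ?thesis using le p by blast
          qed
          then have "?f (of_int_vec m) \<le> ennreal (?D ^ ?N * (1 / (1 + norm (x + of_int_vec m) / S) ^ ?N))"
            by (rule ennreal_leI)
          then show ?thesis using True by (simp only: ennreal_mult' zero_le_power scaleR_one indicator_simps mult_1_right)
        qed simp
      qed
      finally show "?f (of_int_vec m) \<le> (\<integral>\<^sup>+x. (ennreal (?D ^ ?N) * ?f (x + 1 *\<^sub>R of_int_vec m)) * indicator (cell 1) x \<partial>lborel)" .
    qed
    also have "\<dots> = (\<integral>\<^sup>+x. ennreal (?D ^ ?N) * ?f x \<partial>lborel)"
      by (rule nn_integral_tiling[symmetric]) auto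
    also have "\<dots> = ennreal (?D ^ ?N) * (\<integral>\<^sup>+x. ?f x \<partial>lborel)"
      by (rule nn_integral_cmult) auto
    also have "(\<integral>\<^sup>+x. ?f x \<partial>lborel) = ennreal (S ^ CARD('n)) * (\<integral>\<^sup>+x. ?f (S *\<^sub>R x) \<partial>lborel)"
      using S by (subst nn_integral_lborel_scaleR[where c = S]) auto
    also have "(\<integral>\<^sup>+x. ?f (S *\<^sub>R x) \<partial>lborel) = ennreal I"
      unfolding I(1) using S by (intro nn_integral_cong) simp
    also have "ennreal (?D ^ ?N) * (ennreal (S ^ CARD('n)) * ennreal I) = ennreal ((?D ^ ?N * I) * S ^ CARD('n))"
    proof -
      have "ennreal a * (ennreal b * ennreal c) = ennreal ((a * c) * b)" if "a \<ge> 0" "b \<ge> 0" "c \<ge> 0" for a b c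
        using that by (simp add: ennreal_mult'[symmetric] mult_ac)
      then show ?thesis using S I by (meson zero_le_power add_nonneg_nonneg of_nat_0_le_iff zero_le_one order_trans)
    qed
    finally show ?thesis .
  qed
  moreover have "?D ^ ?N * I \<ge> 0" using I by simp
  ultimately show ?thesis by blast
qed

lemma abs_summable_on_lattice:
  fixes f :: "int^'n::finite \<Rightarrow> complex"
  assumes "\<And>m. norm (f m) \<le> B / (1 + norm (of_int_vec m :: real^'n)) ^ (CARD('n) + 2)"
  shows "(\<lambda>m. norm (f m)) summable_on UNIV"
proof -
  let ?N = "CARD('n) + 2"
  have B: "B \<ge> 0"
    using order_trans[OF norm_ge_zero assms[of 0]] by simp
  obtain C where C: "(\<integral>\<^sup>+m. ennreal (1 / (1 + norm (of_int_vec (m::int^'n)) / 1) ^ ?N) \<partial>count_space UNIV) \<le> ennreal (C * 1 ^ CARD('n))"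
    using lattice_sum_bound[where 'n='n] by (meson order_refl)
  have "(\<integral>\<^sup>+m. ennreal (norm (f m)) \<partial>count_space UNIV) \<le> (\<integral>\<^sup>+m. ennreal B * ennreal (1 / (1 + norm (of_int_vec m :: real^'n) / 1) ^ ?N) \<partial>count_space UNIV)"
    using assms B by (intro nn_integral_mono) (simp only: ennreal_mult'[symmetric], auto intro!: ennreal_leI)
  also have "\<dots> = ennreal B * (\<integral>\<^sup>+m. ennreal (1 / (1 + norm (of_int_vec m :: real^'n) / 1) ^ ?N) \<partial>count_space UNIV)"
    by (rule nn_integral_cmult) simp
  also have "\<dots> < \<infinity>" using C by (auto simp: ennreal_mult_less_top intro: le_less_trans)
  finally have "integrable (count_space UNIV) f" by (simp add: integrable_iff_bounded)
  then show ?thesis by (simp add: Infinite_Set_Sum.abs_summable_on_def[symmetric] abs_summable_equivalent)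
qed

subsection \<open>Fourier series on a cube\<close>

lemma phase_mult_phase: "phase y s x * phase z t x = phase (y + z) (s + t) x"
  by (simp add: phase_def cis_mult inner_add_left algebra_simps)

lemma phase_zero [simp]: "phase 0 0 x = 1"
  by (simp add: phase_def)

lemma cnj_phase: "cnj (phase y s x) = phase (- y) (- s) x"
  by (simp add: phase_def cis_cnj)

lemma continuous_phase [continuous_intros]: "continuous_on A (phase y s)"
  using differentiable_phase differentiable_imp_continuous_on continuous_on_subset by blast

lemma measurable_phase [measurable]: "phase y s \<in> borel_measurable borel"
  by (intro borel_measurable_continuous_onI continuous_phase)

text \<open>The frequencies whose characters have period \<open>L\<close> in each coordinate. They
  index Fourier series on a cube of side \<open>L\<close> and are also the spacing at which the
  localized distribution is sampled.\<close>

definition lat :: "real \<Rightarrow> int^'n \<Rightarrow> real^'n::finite" where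
  "lat L n = (1 / L) *\<^sub>R of_int_vec n"

lemma lat_simps [simp]: "lat L 0 = 0" "lat L (- n) = - lat L n" "lat L (m + n) = lat L m + lat L n"
    "lat L (m - n) = lat L m - lat L n"
  by (simp_all add: lat_def algebra_simps)

section \<open>Orthogonality of the characters on a cube\<close>

definition cube :: "real \<Rightarrow> (real^'n::finite) set" where
  "cube L = cbox (\<chi> i. - L / 2) (\<chi> i. L / 2)"

lemma abs_le_half: "\<bar>a\<bar> \<le> L / 2 \<longleftrightarrow> - L / 2 \<le> a \<and> a \<le> L / 2" for a L :: real
  by linarith

lemma mem_cube: "x \<in> cube L \<longleftrightarrow> (\<forall>i. \<bar>x $ i\<bar> \<le> L / 2)"
  unfolding cube_def mem_box_cart vec_lambda_beta abs_le_half ..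

lemma compact_cube: "compact (cube L)" by (simp add: cube_def)

lemma borel_cube [measurable]: "cube L \<in> sets borel" by (simp add: cube_def)

lemma interior_cube: "x \<in> interior (cube L) \<longleftrightarrow> (\<forall>i. \<bar>x $ i\<bar> < L / 2)"
proof -
  have "\<bar>a\<bar> < L / 2 \<longleftrightarrow> - L / 2 < a \<and> a < L / 2" for a :: real by linarith
  then show ?thesis unfolding cube_def interior_cbox mem_box_cart vec_lambda_beta by simp
qed

text \<open>Lebesgue measure is a product measure indexed by basis vectors, whereas the factors are
  indexed by coordinates; \<open>k\<close> translates between the two index sets.\<close>

lemma integral_lborel_prod:
  fixes f :: "'n::finite \<Rightarrow> real \<Rightarrow> complex"
  assumes "\<And>i. integrable lborel (f i)"
  shows "(\<integral>x. (\<Prod>i\<in>UNIV. f i ((x::real^'n) $ i)) \<partial>lborel) = (\<Prod>i\<in>UNIV. \<integral>x. f i x \<partial>lborel)"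
proof -
  let ?B = "Basis :: (real^'n) set"
  interpret product_sigma_finite "\<lambda>_::real^'n. lborel :: real measure" ..
  define k :: "real^'n \<Rightarrow> 'n" where "k = inv (\<lambda>i. axis i 1)"
  have inj: "inj (\<lambda>i. axis i (1::real) :: real^'n)" by (auto simp: inj_def axis_eq_axis)
  have k: "k (axis i 1) = i" for i unfolding k_def by (rule inv_f_f[OF inj])
  have B: "?B = range (\<lambda>i. axis i 1)" by (auto simp: Basis_vec_def)
  have [measurable]: "f i \<in> borel_measurable borel" for i using assms[of i] by simp
  have re: "(\<Prod>i\<in>UNIV. g i) = (\<Prod>b\<in>?B. g (k b))" for g :: "'n \<Rightarrow> complex"
    unfolding B by (subst prod.reindex) (auto simp: k intro: inj_on_subset[OF inj])
  have nth: "(\<Sum>b\<in>?B. y b *\<^sub>R b) $ i = y (axis i 1)" for y i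
  proof -
    have "(\<Sum>b\<in>?B. y b *\<^sub>R b) $ i = (\<Sum>b\<in>?B. y b *\<^sub>R b) \<bullet> axis i 1" by (simp add: inner_axis)
    also have "\<dots> = y (axis i 1)" by (subst inner_sum_left_Basis) (auto simp: B)
    finally show ?thesis .
  qed
  have "(\<integral>x. (\<Prod>i\<in>UNIV. f i ((x::real^'n) $ i)) \<partial>lborel) =
      (\<integral>x. (\<Prod>i\<in>UNIV. f i (x $ i)) \<partial>(distr (\<Pi>\<^sub>M b\<in>?B. lborel) borel (\<lambda>y. \<Sum>b\<in>?B. y b *\<^sub>R b)))"
    by (simp add: lborel_eq[symmetric])
  also have "\<dots> = (\<integral>y. (\<Prod>i\<in>UNIV. f i ((\<Sum>b\<in>?B. y b *\<^sub>R b) $ i)) \<partial>(\<Pi>\<^sub>M b\<in>?B. lborel))"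
    by (rule integral_distr) auto
  also have "\<dots> = (\<integral>y. (\<Prod>b\<in>?B. f (k b) (y b)) \<partial>(\<Pi>\<^sub>M b\<in>?B. lborel))"
  proof (rule Bochner_Integration.integral_cong[OF refl])
    fix y :: "real^'n \<Rightarrow> real"
    have "(\<Prod>i\<in>UNIV. f i ((\<Sum>b\<in>?B. y b *\<^sub>R b) $ i)) = (\<Prod>b\<in>?B. f (k b) (y (axis (k b) 1)))"
      unfolding nth by (rule re)
    also have "\<dots> = (\<Prod>b\<in>?B. f (k b) (y b))" by (rule prod.cong) (auto simp: B k)
    finally show "(\<Prod>i\<in>UNIV. f i ((\<Sum>b\<in>?B. y b *\<^sub>R b) $ i)) = (\<Prod>b\<in>?B. f (k b) (y b))" .
  qed
  also have "\<dots> = (\<Prod>b\<in>?B. \<integral>x. f (k b) x \<partial>lborel)"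
    by (rule product_integral_prod) (use assms in auto)
  also have "\<dots> = (\<Prod>i\<in>UNIV. \<integral>x. f i x \<partial>lborel)" by (rule re[symmetric])
  finally show ?thesis .
qed

lemma integral_cis_interval:
  assumes "L > 0"
  shows "(\<integral>x. indicator {- L / 2..L / 2} x *\<^sub>R cis (2 * pi * (of_int n / L) * x) \<partial>lborel) = (if n = 0 then of_real L else 0)"
proof (cases "n = 0")
  case True
  then show ?thesis using assms by (simp add: scaleR_conv_of_real)
next
  case False
  define w where "w = 2 * pi * (of_int n / L)"
  have w: "w \<noteq> 0" using False assms by (simp add: w_def)
  have "(\<integral>x. indicator {- L / 2..L / 2} x *\<^sub>R cis (w * x) \<partial>lborel) =
     cis (w * (L / 2)) / (\<i> * of_real w) - cis (w * (- L / 2)) / (\<i> * of_real w)"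
  proof (rule integral_FTC_atLeastAtMost)
    fix x
    have "((\<lambda>x. cis (w * x) / (\<i> * of_real w)) has_vector_derivative
        (\<i> * of_real w * exp (\<i> * of_real (w * x))) / (\<i> * of_real w)) (at x within {- L / 2..L / 2})"
    proof -
      have "((\<lambda>z. exp (\<i> * of_real w * z) / (\<i> * of_real w)) has_field_derivative
          (\<i> * of_real w * exp (\<i> * of_real w * of_real x)) / (\<i> * of_real w)) (at (of_real x))"
        by (auto intro!: derivative_eq_intros)
      from has_vector_derivative_real_field[OF this] show ?thesis
        by (auto simp: cis_conv_exp mult.assoc intro: has_vector_derivative_at_within)
    qed
    then show "((\<lambda>x. cis (w * x) / (\<i> * of_real w)) has_vector_derivative cis (w * x)) (at x within {- L / 2..L / 2})"
      using w by (simp add: cis_conv_exp)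
  qed (use assms in \<open>auto intro!: continuous_intros\<close>)
  \<comment> \<open>The arguments at the endpoints are pi n and - pi n, so the boundary terms
    cancel.\<close>
  also have "cis (w * (L / 2)) = cis (w * (- L / 2))"
  proof -
    have "w * (L / 2) = pi * of_int n" "w * (- L / 2) = - (pi * of_int n)"
      using assms by (simp_all add: w_def)
    moreover have "sin (pi * of_int n) = 0" by (simp add: sin_zero_iff_int2 mult.commute)
    ultimately show ?thesis by (simp add: complex_eq_iff)
  qed
  finally show ?thesis using False by (simp add: w_def)
qed

lemma integral_cube_phase:
  assumes L: "L > 0"
  shows "(\<integral>x. indicator (cube L) (x::real^'n::finite) *\<^sub>R phase (lat L n) 0 x \<partial>lborel) = (if n = 0 then of_real (L ^ CARD('n)) else 0)"
proof -
  let ?f = "\<lambda>i x. indicator {- L / 2..L / 2} x *\<^sub>R cis (2 * pi * (of_int (n $ i) / L) * x)"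
  have "indicator (cube L) x *\<^sub>R phase (lat L n) 0 x = (\<Prod>i\<in>UNIV. ?f i (x $ i))" for x :: "real^'n"
  proof -
    have "phase (lat L n) 0 x = cis (\<Sum>i\<in>UNIV. 2 * pi * (of_int (n $ i) / L) * x $ i)"
      by (simp add: phase_def lat_def inner_vec_def sum_distrib_left mult_ac)
    also have "\<dots> = (\<Prod>i\<in>UNIV. cis (2 * pi * (of_int (n $ i) / L) * x $ i))"
      by (simp add: cis_conv_exp sum_distrib_left exp_sum)
    finally have p: "phase (lat L n) 0 x = (\<Prod>i\<in>UNIV. cis (2 * pi * (of_int (n $ i) / L) * x $ i))" .
    show ?thesis
    proof (cases "x \<in> cube L")
      case True
      then have "x $ i \<in> {- L / 2..L / 2}" for i unfolding mem_cube abs_le_half atLeastAtMost_iff by blast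
      then show ?thesis using True p by simp
    next
      case False
      then obtain i where "x $ i \<notin> {- L / 2..L / 2}" unfolding mem_cube abs_le_half atLeastAtMost_iff by blast
      then have "?f i (x $ i) = 0" by simp
      then have "(\<Prod>i\<in>UNIV. ?f i (x $ i)) = 0" by (intro prod_zero) auto
      then show ?thesis using False by simp
    qed
  qed
  then have "(\<integral>x. indicator (cube L) (x::real^'n) *\<^sub>R phase (lat L n) 0 x \<partial>lborel) = (\<integral>x. (\<Prod>i\<in>UNIV. ?f i ((x::real^'n) $ i)) \<partial>lborel)"
    by simp
  also have "\<dots> = (\<Prod>i\<in>UNIV. \<integral>x. ?f i x \<partial>lborel)"
    by (rule integral_lborel_prod) (rule borel_integrable_compact, use L in \<open>auto intro!: continuous_intros\<close>)
  also have "\<dots> = (\<Prod>i\<in>UNIV. if n $ i = 0 then of_real L else 0)"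
    by (simp only: integral_cis_interval[OF L])
  also have "\<dots> = (if n = 0 then of_real (L ^ CARD('n)) else 0)"
  proof (cases "n = 0")
    case False
    then obtain i where "n $ i \<noteq> 0" by (auto simp: vec_eq_iff)
    then have "(\<Prod>i\<in>UNIV. if n $ i = 0 then complex_of_real L else 0) = 0"
      by (intro prod_zero) auto
    then show ?thesis using False by simp
  qed simp
  finally show ?thesis .
qed

text \<open>The functions have modulus at most one and squared norm \<open>V\<close>, as characters
  on a cube do. The inequality is the nonnegativity of the squared distance from \<open>f\<close> to
  its projection \<open>S\<close>, whose inner products with \<open>f\<close> and with itself all
  equal \<open>T\<close>.\<close>

lemma (in finite_measure) bessel:
  fixes e :: "'k \<Rightarrow> 'a \<Rightarrow> complex"
  assumes F: "finite F" and em: "\<And>k. e k \<in> borel_measurable M" and e1: "\<And>k x. norm (e k x) \<le> 1"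
    and fm: "f \<in> borel_measurable M" and fB: "\<And>x. norm (f x) \<le> B" and V: "V > 0"
    and orth: "\<And>k l. (\<integral>x. e k x * cnj (e l x) \<partial>M) = (if k = l then of_real V else 0)"
  shows "(\<Sum>k\<in>F. (norm (\<integral>x. f x * cnj (e k x) \<partial>M))\<^sup>2) \<le> V * (\<integral>x. (norm (f x))\<^sup>2 \<partial>M)"
proof -
  define b where "b k = (\<integral>x. f x * cnj (e k x) \<partial>M)" for k
  define T where "T = (\<Sum>k\<in>F. (norm (b k))\<^sup>2) / V"
  define S where "S x = (\<Sum>k\<in>F. b k / of_real V * e k x)" for x
  have Sm: "S \<in> borel_measurable M" unfolding S_def[abs_def] using em by measurable
  have bdd: "integrable M (\<lambda>x. g x * cnj (h x))"
    if "g \<in> borel_measurable M" "h \<in> borel_measurable M" "\<And>x. norm (g x) \<le> C" "\<And>x. norm (h x) \<le> D"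
    for g h :: "'a \<Rightarrow> complex" and C D
  proof (rule integrable_const_bound[where B = "C * D"])
    have "(\<lambda>x. cnj (h x)) \<in> borel_measurable M"
      by (rule measurable_compose[OF that(2)]) (intro borel_measurable_continuous_onI continuous_intros)
    then show "(\<lambda>x. g x * cnj (h x)) \<in> borel_measurable M" using that(1) by measurable
    have "0 \<le> C" for x :: 'a using order_trans[OF norm_ge_zero that(3)] .
    then show "AE x in M. norm (g x * cnj (h x)) \<le> C * D"
      using that(3,4) by (auto simp only: norm_mult complex_mod_cnj norm_ge_zero intro!: mult_mono)
  qed
  define C where "C = (\<Sum>k\<in>F. norm (b k / of_real V))"
  have SC: "norm (S x) \<le> C" for x
    unfolding S_def C_def
    by (rule order_trans[OF norm_sum sum_mono]) (use mult_left_mono[OF e1 norm_ge_zero] in \<open>simp only: norm_mult mult_1_right\<close>)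
  note i_fe = bdd[OF fm em fB e1] and i_ee = bdd[OF em em e1 e1] and i_ff = bdd[OF fm fm fB fB]
    and i_fS = bdd[OF fm Sm fB SC] and i_Sf = bdd[OF Sm fm SC fB] and i_SS = bdd[OF Sm Sm SC SC]
  have fS: "(\<integral>x. f x * cnj (S x) \<partial>M) = of_real T"
  proof -
    have "(\<integral>x. f x * cnj (S x) \<partial>M) = (\<integral>x. (\<Sum>k\<in>F. cnj (b k) / of_real V * (f x * cnj (e k x))) \<partial>M)"
      unfolding S_def by (intro Bochner_Integration.integral_cong) (auto simp: sum_distrib_left mult_ac)
    also have "\<dots> = (\<Sum>k\<in>F. cnj (b k) / of_real V * b k)"
      by (subst Bochner_Integration.integral_sum) (intro integrable_mult_right i_fe, simp add: b_def)
    also have "\<dots> = of_real T"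
      unfolding T_def of_real_divide of_real_sum sum_divide_distrib
      by (rule sum.cong) (simp_all only: complex_norm_square times_divide_eq_left times_divide_eq_right mult.commute)
    finally show ?thesis .
  qed
  have Sf: "(\<integral>x. S x * cnj (f x) \<partial>M) = of_real T"
  proof -
    have "(\<integral>x. S x * cnj (f x) \<partial>M) = (\<integral>x. cnj (f x * cnj (S x)) \<partial>M)" by (simp add: mult.commute)
    also have "\<dots> = cnj (\<integral>x. f x * cnj (S x) \<partial>M)" by (rule integral_bounded_linear[OF bounded_linear_cnj i_fS])
    finally show ?thesis by (simp add: fS)
  qed
  have SS: "(\<integral>x. S x * cnj (S x) \<partial>M) = of_real T"
  proof -
    have "(\<integral>x. S x * cnj (S x) \<partial>M) = (\<integral>x. (\<Sum>k\<in>F. \<Sum>l\<in>F. b k / of_real V * (cnj (b l) / of_real V) * (e k x * cnj (e l x))) \<partial>M)"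
      unfolding S_def by (intro Bochner_Integration.integral_cong) (auto simp: sum_product mult_ac)
    also have "\<dots> = (\<Sum>k\<in>F. \<Sum>l\<in>F. b k / of_real V * (cnj (b l) / of_real V) * (if k = l then of_real V else 0))"
      by (subst Bochner_Integration.integral_sum | intro Bochner_Integration.integrable_sum integrable_mult_right i_ee sum.cong refl
        | simp only: integral_mult_right_zero orth)+
    also have "\<dots> = (\<Sum>k\<in>F. b k / of_real V * (cnj (b k) / of_real V) * of_real V)"
      using F by (intro sum.cong refl) (simp add: if_distrib[where f = "\<lambda>x. _ * x"] cong: if_cong)
    also have "\<dots> = of_real T"
      unfolding T_def of_real_divide of_real_sum sum_divide_distrib using V
      by (intro sum.cong) (simp_all add: complex_norm_square[symmetric])
    finally show ?thesis .
  qed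
  have "complex_of_real (\<integral>x. (norm (f x - S x))\<^sup>2 \<partial>M) = (\<integral>x. of_real ((norm (f x - S x))\<^sup>2) \<partial>M)"
    by (rule integral_complex_of_real[symmetric])
  also have "\<dots> = (\<integral>x. f x * cnj (f x) - f x * cnj (S x) - S x * cnj (f x) + S x * cnj (S x) \<partial>M)"
    by (intro Bochner_Integration.integral_cong refl) (simp only: complex_norm_square, simp add: algebra_simps)
  also have "\<dots> = (\<integral>x. f x * cnj (f x) \<partial>M) - of_real T"
    by (simp add: i_ff i_fS i_Sf i_SS fS Sf SS)
  also have "(\<integral>x. f x * cnj (f x) \<partial>M) = complex_of_real (\<integral>x. (norm (f x))\<^sup>2 \<partial>M)"
    by (subst integral_complex_of_real[symmetric]) (simp only: complex_norm_square)
  finally have "(\<integral>x. (norm (f x - S x))\<^sup>2 \<partial>M) = (\<integral>x. (norm (f x))\<^sup>2 \<partial>M) - T"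
    by (simp only: of_real_diff[symmetric] of_real_eq_iff)
  moreover have "(\<integral>x. (norm (f x - S x))\<^sup>2 \<partial>M) \<ge> 0" by (rule integral_nonneg_AE) simp
  ultimately have "V * T \<le> V * (\<integral>x. (norm (f x))\<^sup>2 \<partial>M)" using V by (intro mult_left_mono) auto
  then show ?thesis using V by (simp add: T_def b_def)
qed

lemma bessel_cube:
  fixes f :: "real^'n::finite \<Rightarrow> complex"
  assumes L: "L > 0" and F: "finite F" and fm: "f \<in> borel_measurable borel" and fB: "\<And>x. norm (f x) \<le> B"
  shows "(\<Sum>k\<in>F. (norm (\<integral>x. indicator (cube L) x *\<^sub>R (f x * phase (- lat L k) 0 x) \<partial>lborel))\<^sup>2)
     \<le> L ^ CARD('n) * (\<integral>x. indicator (cube L) x * (norm (f x))\<^sup>2 \<partial>lborel)"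
proof -
  let ?V = "L ^ CARD('n)"
  define M where "M = restrict_space lborel (cube L :: (real^'n) set)"
  have vol: "emeasure lborel (cube L :: (real^'n) set) = ennreal ?V"
  proof -
    have "emeasure lborel (cube L :: (real^'n) set) = ennreal (\<Prod>b\<in>(Basis::(real^'n) set). L)"
    proof -
      have "((\<chi> i. L / 2) - (\<chi> i. - L / 2)) \<bullet> b = L" "(\<chi> i. - L / 2) \<bullet> b \<le> (\<chi> i. L / 2) \<bullet> b"
        if "b \<in> Basis" for b :: "real^'n"
        using that L by (auto simp: Basis_vec_def inner_axis)
      then show ?thesis unfolding cube_def by (simp add: emeasure_lborel_cbox)
    qed
    then show ?thesis by simp
  qed
  have int: "(\<integral>x. g x \<partial>M) = (\<integral>x. indicator (cube L) x *\<^sub>R g x \<partial>lborel)" for g :: "real^'n \<Rightarrow> complex"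
    unfolding M_def by (subst integral_restrict_space) auto
  have sp: "space M = cube L" "emeasure M (space M) = ennreal ?V"
    by (simp_all add: M_def space_restrict_space emeasure_restrict_space vol)
  interpret finite_measure M by (rule finite_measureI) (subst sp(2), simp)
  have meas: "g \<in> borel_measurable borel \<Longrightarrow> g \<in> borel_measurable M" for g :: "real^'n \<Rightarrow> complex"
    unfolding M_def by (intro measurable_restrict_space1) simp
  have "(\<Sum>k\<in>F. (norm (\<integral>x. f x * cnj (phase (lat L k) 0 x) \<partial>M))\<^sup>2) \<le> ?V * (\<integral>x. (norm (f x))\<^sup>2 \<partial>M)"
  proof (rule bessel[OF F _ _ _ fB])
    show "(\<integral>x. phase (lat L k) 0 x * cnj (phase (lat L l) 0 x) \<partial>M) = (if k = l then of_real ?V else 0)" for k l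
      using integral_cube_phase[OF L, of "k - l"] by (simp add: int cnj_phase phase_mult_phase)
  qed (use L fm in \<open>auto intro: meas\<close>)
  also have "(\<integral>x. (norm (f x))\<^sup>2 \<partial>M) = (\<integral>x. indicator (cube L) x * (norm (f x))\<^sup>2 \<partial>lborel)"
    unfolding M_def by (subst integral_restrict_space) auto
  finally show ?thesis by (simp add: int cnj_phase)
qed

text \<open>Multiplying by the conjugate of \<open>H a\<close> reduces to a real function
  \<open>G\<close>. If \<open>H a\<close> were nonzero, \<open>G\<close> would be positive near
  \<open>a\<close>; the integral against \<open>h ^ N\<close> would receive at least a multiple of
  \<open>r' ^ N\<close> from there, while negative contributions are at most a multiple of
  \<open>r ^ N\<close> with \<open>r < r'\<close>. For large \<open>N\<close> the total cannot be
  zero.\<close>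

lemma concentration_at_maximum:
  fixes H :: "'a::euclidean_space \<Rightarrow> complex" and h :: "'a \<Rightarrow> real"
  assumes K: "compact K" and a: "a \<in> interior K" and H: "continuous_on K H" and h: "continuous_on K h"
    and h0: "\<And>x. x \<in> K \<Longrightarrow> 0 \<le> h x" and ha: "h a = 1" and h1: "\<And>x. x \<in> K \<Longrightarrow> x \<noteq> a \<Longrightarrow> h x < 1"
    and zero: "\<And>N. (\<integral>x. indicator K x *\<^sub>R (H x * of_real (h x ^ N)) \<partial>lborel) = 0"
  shows "H a = 0"
proof (rule ccontr)
  assume Ha: "H a \<noteq> 0"
  have aK: "a \<in> K" using a interior_subset by blast
  have Kb [measurable]: "K \<in> sets borel" using K by (simp add: borel_compact)
  define G where "G x = Re (H x * cnj (H a))" for x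
  define g where "g = G a / 2"
  have g: "g > 0" using Ha by (simp add: g_def G_def complex_mult_cnj power2_eq_square sum_power2_gt_zero_iff complex_eq_iff)
    (metis Ha complex_eq_iff not_sum_squares_lt_zero sum_squares_gt_zero_iff zero_complex.simps)
  have Gc: "continuous_on K G" unfolding G_def by (intro continuous_intros H)
  have intK: "integrable lborel (\<lambda>x. indicator K x *\<^sub>R f x)" if "continuous_on K f" for f :: "'a \<Rightarrow> 'b::{banach,second_countable_topology}"
    by (rule borel_integrable_compact[OF K that])
  have zero': "(\<integral>x. indicator K x * (G x * h x ^ N) \<partial>lborel) = 0" for N
  proof -
    have "indicator K x * (G x * h x ^ N) = Re (indicator K x *\<^sub>R (H x * of_real (h x ^ N)) * cnj (H a))" for x
      by (simp add: G_def algebra_simps)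
    then have "(\<integral>x. indicator K x * (G x * h x ^ N) \<partial>lborel) = (\<integral>x. Re (indicator K x *\<^sub>R (H x * of_real (h x ^ N)) * cnj (H a)) \<partial>lborel)"
      by (intro Bochner_Integration.integral_cong refl)
    also have "\<dots> = Re (\<integral>x. indicator K x *\<^sub>R (H x * of_real (h x ^ N)) * cnj (H a) \<partial>lborel)"
      by (rule integral_bounded_linear[OF bounded_linear_Re]) (intro integrable_mult_left intK continuous_intros H h)
    also have "\<dots> = 0" by (simp only: integral_mult_left_zero zero) simp
    finally show ?thesis .
  qed
  obtain B where B: "\<And>x. x \<in> K \<Longrightarrow> norm (G x) \<le> B"
    using compact_imp_bounded[OF compact_continuous_image[OF Gc K]] unfolding bounded_iff by auto
  have B0: "B \<ge> 0" using B[OF aK] norm_ge_zero order_trans by blast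
  obtain e where e: "e > 0" "ball a e \<subseteq> K" using a mem_interior by blast
  obtain \<delta> where \<delta>: "\<delta> > 0" "\<And>x. x \<in> K \<Longrightarrow> dist x a < \<delta> \<Longrightarrow> dist (G x) (G a) < g"
    using Gc aK g unfolding continuous_on_iff by blast
  \<comment> \<open>Away from \<open>a\<close> the maximum of \<open>h\<close> is attained by
    compactness and is therefore below one; if nothing remains of \<open>K\<close>, zero will
    do.\<close>
  obtain r where r: "0 \<le> r" "r < 1" "\<And>x. x \<in> K - ball a \<delta> \<Longrightarrow> h x \<le> r"
  proof (cases "K - ball a \<delta> = {}")
    case True then show thesis by (intro that[of 0]) auto
  next
    case False
    have "compact (K - ball a \<delta>)" using K by (simp add: compact_diff)
    moreover have "continuous_on (K - ball a \<delta>) h" using h continuous_on_subset by blast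
    ultimately obtain x where x: "x \<in> K - ball a \<delta>" "\<And>y. y \<in> K - ball a \<delta> \<Longrightarrow> h y \<le> h x"
      using continuous_attains_sup[OF _ False] by blast
    moreover have "x \<noteq> a" using x(1) \<delta>(1) by auto
    ultimately show thesis using h0[of x] h1[of x] by (intro that[of "h x"]) auto
  qed
  define r' where "r' = (1 + r) / 2"
  have r': "r < r'" "0 < r'" "r' < 1" using r by (auto simp: r'_def)
  obtain \<delta>' where \<delta>': "\<delta>' > 0" "\<And>x. x \<in> K \<Longrightarrow> dist x a < \<delta>' \<Longrightarrow> dist (h x) (h a) < 1 - r'"
    using h aK r' unfolding continuous_on_iff by (metis diff_gt_0_iff_gt)
  \<comment> \<open>Three requirements at once: the ball lies in \<open>K\<close>, \<open>G\<close>
    is at least \<open>g\<close> on it, and \<open>h\<close> is at least \<open>r'\<close> on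
    it.\<close>
  define \<eta> where "\<eta> = min e (min \<delta> \<delta>')"
  have \<eta>: "\<eta> > 0" "\<eta> \<le> e" "\<eta> \<le> \<delta>" "\<eta> \<le> \<delta>'" using e \<delta> \<delta>' by (auto simp: \<eta>_def)
  define m where "m = measure lborel (ball a \<eta>)"
  define V where "V = measure lborel K"
  have fin: "emeasure lborel (ball a \<eta>) < \<infinity>" "emeasure lborel K < \<infinity>"
    using emeasure_lborel_ball_finite emeasure_compact_finite[OF K] by (auto simp: less_top)
  have m: "m > 0" unfolding m_def by (rule content_ball_pos[OF \<eta>(1)])
  have key: "g * r' ^ N * m \<le> B * r ^ N * V" for N
  proof -
    have "(\<integral>x. indicator (ball a \<eta>) x * (g * r' ^ N) - indicator K x * (B * r ^ N) \<partial>lborel) \<le> (\<integral>x. indicator K x * (G x * h x ^ N) \<partial>lborel)"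
    proof (rule Bochner_Integration.integral_mono)
      show "integrable lborel (\<lambda>x. indicator (ball a \<eta>) x * (g * r' ^ N) - indicator K x * (B * r ^ N))"
        using fin by (intro Bochner_Integration.integrable_diff integrable_mult_left integrable_real_indicator) auto
      show "integrable lborel (\<lambda>x. indicator K x * (G x * h x ^ N))"
        using intK[OF continuous_on_mult[OF Gc continuous_on_power[OF h]]] by simp
      fix x
      show "indicator (ball a \<eta>) x * (g * r' ^ N) - indicator K x * (B * r ^ N) \<le> indicator K x * (G x * h x ^ N)"
      proof (cases "x \<in> K")
        case False
        then have "x \<notin> ball a \<eta>" using e \<eta> by (auto simp: subset_iff)
        then show ?thesis using False by simp
      next
        case True
        have Br: "0 \<le> B * r ^ N" using B0 r by simp
        show ?thesis
        proof (cases "x \<in> ball a \<delta>")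
          case xd: True
          then have "dist x a < \<delta>" by (simp add: dist_commute)
          from \<delta>(2)[OF True this] have "\<bar>G x - G a\<bar> < G a / 2" by (simp only: dist_real_def g_def)
          then have Gg: "G x \<ge> g" unfolding g_def by linarith
          show ?thesis
          proof (cases "x \<in> ball a \<eta>")
            case xe: True
            then have "dist x a < \<delta>'" using \<eta> by (simp add: dist_commute)
            from \<delta>'(2)[OF True this] have "\<bar>h x - 1\<bar> < 1 - r'" by (simp only: dist_real_def ha)
            then have "h x \<ge> r'" by linarith
            then have "g * r' ^ N \<le> G x * h x ^ N"
              using Gg g r' by (intro mult_mono power_mono) auto
            then show ?thesis using True xe Br by simp
          next
            case False
            have "0 \<le> G x * h x ^ N" using Gg g h0[OF True] by simp
            then show ?thesis using True False Br by simp
          qed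
        next
          case False
          then have "h x \<le> r" using r True by auto
          then have "\<bar>G x\<bar> * h x ^ N \<le> B * r ^ N" using B[OF True] h0[OF True] by (intro mult_mono power_mono) auto
          moreover have "- (\<bar>G x\<bar> * h x ^ N) \<le> G x * h x ^ N"
            using h0[OF True] mult_right_mono[of "- \<bar>G x\<bar>" "G x" "h x ^ N"] by simp
          moreover have "x \<notin> ball a \<eta>" using False \<eta> by auto
          ultimately show ?thesis using True by simp
        qed
      qed
    qed
    moreover have "(\<integral>x. indicator (ball a \<eta>) x * (g * r' ^ N) - indicator K x * (B * r ^ N) \<partial>lborel) = m * (g * r' ^ N) - V * (B * r ^ N)"
      unfolding m_def V_def using fin
      by (subst Bochner_Integration.integral_diff) (auto intro!: integrable_mult_left integrable_real_indicator)
    ultimately show ?thesis using zero'[of N] by (simp add: mult_ac)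
  qed
  have "g * m \<le> (B * V) * (r / r') ^ N" for N
    using key[of N] r' by (simp add: power_divide field_simps)
  moreover have "(\<lambda>N. (B * V) * (r / r') ^ N) \<longlonglongrightarrow> (B * V) * 0"
    using r r' by (intro tendsto_mult tendsto_const LIMSEQ_power_zero) (auto simp: divide_less_eq)
  ultimately have "g * m \<le> (B * V) * 0" by (intro LIMSEQ_le_const) auto
  then show False using g m by (simp add: mult_le_0_iff)
qed

text \<open>The powers of \<open>h x = \<Prod>i. (1 + cos (2 \<pi> (x i - a i) / L)) / 2\<close> are trigonometric polynomials
  and concentrate at \<open>a\<close>.\<close>

lemma fourier_coefficients_unique:
  fixes H :: "real^'n::finite \<Rightarrow> complex"
  assumes L: "L > 0" and H: "continuous_on (cube L) H" and a: "a \<in> interior (cube L)"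
    and zero: "\<And>n. (\<integral>x. indicator (cube L) x *\<^sub>R (H x * phase (lat L n) 0 x) \<partial>lborel) = 0"
  shows "H a = 0"
proof -
  define c where "c i x = (1 + cos (2 * pi * ((x $ i - a $ i) / L))) / 2" for i and x :: "real^'n"
  define \<delta> :: "'n \<Rightarrow> int^'n" where "\<delta> i = axis i 1" for i
  define w where "w i = 2 * pi * a $ i / L" for i
  \<comment> \<open>A raised cosine is a combination of three characters, so multiplying by it only
    shifts the indices of the vanishing coefficients.\<close>
  have c_phase: "complex_of_real (c i x) = 1 / 2 + (1 / 4) * cis (- w i) * phase (lat L (\<delta> i)) 0 x
      + (1 / 4) * cis (w i) * phase (lat L (- \<delta> i)) 0 x" for i x
  proof -
    have l: "lat L (\<delta> i) \<bullet> x = x $ i / L"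
      by (simp add: lat_def inner_vec_def of_int_vec_def \<delta>_def axis_def if_distrib[where f = "\<lambda>y. _ * (of_int y * _)"] cong: if_cong)
        (simp add: if_distrib[where f = "\<lambda>y. y * _"] if_distrib[where f = "of_int"] sum_divide_distrib[symmetric] cong: if_cong)
    have cos_cis: "complex_of_real (cos t) = (cis t + cis (- t)) / 2" for t
      by (simp add: complex_eq_iff)
    have "complex_of_real (c i x) = 1 / 2 + (1 / 4) * cis (2 * pi * ((x $ i - a $ i) / L)) + (1 / 4) * cis (- (2 * pi * ((x $ i - a $ i) / L)))"
      by (simp only: c_def of_real_divide of_real_add of_real_1 of_real_numeral cos_cis) (simp add: add_divide_distrib)
    also have "cis (2 * pi * ((x $ i - a $ i) / L)) = cis (- w i) * phase (lat L (\<delta> i)) 0 x"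
      by (simp add: phase_def l cis_mult w_def diff_divide_distrib algebra_simps)
    also have "cis (- (2 * pi * ((x $ i - a $ i) / L))) = cis (w i) * phase (lat L (- \<delta> i)) 0 x"
      by (simp add: phase_def l cis_mult w_def diff_divide_distrib algebra_simps)
    finally show ?thesis by (simp add: mult.assoc)
  qed
  \<comment> \<open>Products over lists of coordinates let the induction add one raised cosine at a
    time; the power \<open>h ^ N\<close> corresponds to the list repeated \<open>N\<close>
    times.\<close>
  define P where "P \<alpha> x = prod_list (map (\<lambda>i. c i x) \<alpha>)" for \<alpha> x
  have cc: "continuous_on A (c i)" for A i
    unfolding c_def by (intro continuous_intros) (use L in auto)
  have Pc: "continuous_on A (P \<alpha>)" for A \<alpha>
    unfolding P_def by (induction \<alpha>) (auto intro!: continuous_intros cc)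
  have int: "integrable lborel (\<lambda>x. indicator (cube L) x *\<^sub>R (H x * phase (lat L n) 0 x * of_real (P \<alpha> x)))" for n \<alpha>
    by (intro borel_integrable_compact compact_cube continuous_intros H Pc)
  have z: "(\<integral>x. indicator (cube L) x *\<^sub>R (H x * phase (lat L n) 0 x * of_real (P \<alpha> x)) \<partial>lborel) = 0" for \<alpha> n
  proof (induction \<alpha> arbitrary: n)
    case Nil
    then show ?case using zero by (simp add: P_def)
  next
    case (Cons i \<alpha>)
    let ?I = "\<lambda>n x. indicator (cube L) x *\<^sub>R (H x * phase (lat L n) 0 x * of_real (P \<alpha> x))"
    have "indicator (cube L) x *\<^sub>R (H x * phase (lat L n) 0 x * of_real (P (i # \<alpha>) x)) =
      1 / 2 * ?I n x + (1 / 4) * cis (- w i) * ?I (n + \<delta> i) x + (1 / 4) * cis (w i) * ?I (n - \<delta> i) x" for x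
    proof -
      have p: "phase (lat L (n + m)) 0 x = phase (lat L n) 0 x * phase (lat L m) 0 x" for m
        by (simp add: phase_mult_phase)
      have "of_real (P (i # \<alpha>) x) = of_real (c i x) * complex_of_real (P \<alpha> x)" by (simp add: P_def)
      then show ?thesis
        unfolding c_phase diff_conv_add_uminus[of n] p by (simp add: scaleR_conv_of_real algebra_simps)
    qed
    then have "(\<integral>x. indicator (cube L) x *\<^sub>R (H x * phase (lat L n) 0 x * of_real (P (i # \<alpha>) x)) \<partial>lborel) =
      (\<integral>x. 1 / 2 * ?I n x + (1 / 4) * cis (- w i) * ?I (n + \<delta> i) x + (1 / 4) * cis (w i) * ?I (n - \<delta> i) x \<partial>lborel)"
      by (simp only:)
    also have "\<dots> = 1 / 2 * (\<integral>x. ?I n x \<partial>lborel) + (1 / 4) * cis (- w i) * (\<integral>x. ?I (n + \<delta> i) x \<partial>lborel)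
       + (1 / 4) * cis (w i) * (\<integral>x. ?I (n - \<delta> i) x \<partial>lborel)"
      by (subst Bochner_Integration.integral_add Bochner_Integration.integral_add |
          intro Bochner_Integration.integrable_add integrable_mult_right int |
          simp only: integral_mult_right_zero)+
    also have "\<dots> = 0" by (simp only: Cons.IH) simp
    finally show ?case .
  qed
  obtain \<alpha>s :: "'n list" where \<alpha>s: "set \<alpha>s = UNIV" using finite_list[OF finite_class.finite_UNIV] by blast
  define h where "h = P \<alpha>s"
  have c01: "0 \<le> c i x" "c i x \<le> 1" for i x
    unfolding c_def using cos_ge_minus_one cos_le_one by (simp_all add: algebra_simps) (smt (verit) cos_ge_minus_one cos_le_one)+
  have P01: "0 \<le> P \<alpha> x" "P \<alpha> x \<le> 1" for \<alpha> x
    unfolding P_def by (induction \<alpha>) (use c01 in \<open>auto intro: mult_le_one\<close>)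
  have Plt: "P \<alpha> x < 1" if "i \<in> set \<alpha>" "c i x < 1" for \<alpha> i x
    using that
  proof (induction \<alpha>)
    case (Cons j \<alpha>)
    have "P (j # \<alpha>) x = c j x * P \<alpha> x" by (simp add: P_def)
    moreover have "c j x * P \<alpha> x \<le> c j x" "c j x * P \<alpha> x \<le> P \<alpha> x"
      using c01[of j x] P01[of \<alpha> x] by (simp_all add: mult_left_le mult_left_le_one_le)
    ultimately show ?case using Cons by auto
  qed simp
  show ?thesis
  proof (rule concentration_at_maximum[OF compact_cube a H, of h])
    show "continuous_on (cube L) h" unfolding h_def by (rule Pc)
    show "0 \<le> h x" for x unfolding h_def by (rule P01)
    show "h a = 1" unfolding h_def P_def by (induction \<alpha>s) (auto simp: c_def)
    show "h x < 1" if "x \<in> cube L" "x \<noteq> a" for x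
    proof -
      obtain i where i: "x $ i \<noteq> a $ i" using \<open>x \<noteq> a\<close> by (auto simp: vec_eq_iff)
      define t where "t = (x $ i - a $ i) / L"
      \<comment> \<open>Since \<open>a\<close> is interior, \<open>x\<close> and \<open>a\<close>
        differ by less than a full period in this coordinate; points on opposite faces could not be
        separated by the cosine.\<close>
      have "\<bar>x $ i\<bar> \<le> L / 2" "\<bar>a $ i\<bar> < L / 2" using that(1) a by (auto simp: mem_cube interior_cube)
      then have "\<bar>x $ i - a $ i\<bar> < L" by linarith
      then have t: "\<bar>t\<bar> < 1" "t \<noteq> 0" using L i by (auto simp: t_def abs_divide)
      have "cos (2 * pi * t) \<noteq> 1"
      proof
        assume "cos (2 * pi * t) = 1"
        then obtain k :: int where "2 * pi * t = of_int k * (2 * pi)"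
          using cos_one_2pi_int by auto
        then have "t = of_int k" by simp
        then show False using t by simp
      qed
      with cos_le_one[of "2 * pi * t"] have "cos (2 * pi * t) < 1" by linarith
      then have "c i x < 1" by (simp add: c_def t_def)
      then show ?thesis unfolding h_def using Plt \<alpha>s by auto
    qed
    show "(\<integral>x. indicator (cube L) x *\<^sub>R (H x * of_real (h x ^ N)) \<partial>lborel) = 0" for N
    proof -
      have "P (concat (replicate N \<alpha>s)) x = h x ^ N" for x
        by (induction N) (simp_all add: h_def P_def)
      then show ?thesis using z[of 0 "concat (replicate N \<alpha>s)"] by simp
    qed
  qed
qed

text \<open>Defined through the Fourier transform on the whole space, so that decay comes from
  \<open>schwartz_fourier\<close>. For functions supported in the cube it is the usual integral over
  the cube, by \<open>fourier_cube\<close>.\<close>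

definition fcoef :: "real \<Rightarrow> (real^'n::finite \<Rightarrow> complex) \<Rightarrow> int^'n \<Rightarrow> complex" where
  "fcoef L g n = fourier g (lat L n) / of_real (L ^ CARD('n))"

lemma fourier_cube:
  assumes "\<And>x. g x \<noteq> 0 \<Longrightarrow> x \<in> cube L"
  shows "fourier g \<xi> = (\<integral>x. indicator (cube L) x *\<^sub>R (g x * phase (- \<xi>) 0 x) \<partial>lborel)"
  unfolding fourier_phase
  by (intro Bochner_Integration.integral_cong) (use assms in \<open>auto simp: indicator_def mult.commute\<close>)

lemma norm_lat_ge:
  assumes "L > 0"
  shows "1 + norm (of_int_vec n) \<le> (1 + L) * (1 + norm (lat L n))"
proof -
  have n: "norm (of_int_vec n) = L * norm (lat L n)" using assms by (simp add: lat_def)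
  show ?thesis unfolding n using assms by (simp add: algebra_simps)
qed

lemma fcoef_decay:
  assumes L: "L > 0" and g: "schwartz (g :: real^'n::finite \<Rightarrow> complex)"
  shows "\<exists>B. \<forall>n. norm (fcoef L g n) * (1 + norm (of_int_vec n :: real^'n)) ^ N \<le> B"
proof -
  let ?B = "(1 + L) ^ N * schwartz_sum N (fourier g) / L ^ CARD('n)"
  have "norm (fcoef L g n) * (1 + norm (of_int_vec n :: real^'n)) ^ N \<le> ?B" for n
  proof -
    let ?y = "lat L n :: real^'n"
    have "(1 + norm (of_int_vec n :: real^'n)) ^ N \<le> (1 + L) ^ N * (1 + norm ?y) ^ N"
      unfolding power_mult_distrib[symmetric] by (intro power_mono norm_lat_ge L) simp
    then have "norm (fourier g ?y) * (1 + norm (of_int_vec n :: real^'n)) ^ N \<le>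
        norm (fourier g ?y) * ((1 + L) ^ N * (1 + norm ?y) ^ N)"
      by (rule mult_left_mono) simp
    also have "\<dots> = (1 + L) ^ N * ((1 + norm ?y) ^ N * norm (fourier g ?y))" by simp
    also have "\<dots> \<le> (1 + L) ^ N * schwartz_sum N (fourier g)"
      using schwartz_sum_upper[OF schwartz_fourier[OF g], of "[]" N N ?y] L
      by (intro mult_left_mono) auto
    finally show ?thesis
      using L by (simp add: fcoef_def norm_divide norm_power divide_right_mono)
  qed
  then show ?thesis by blast
qed

lemma norm_of_real_power: "norm (complex_of_real ((1 + norm x) ^ N)) = (1 + norm x) ^ N"
  by (simp only: norm_of_real) simp

lemma fcoef_abs_summable:
  assumes L: "L > 0" and g: "schwartz (g :: real^'n::finite \<Rightarrow> complex)"
  shows "(\<lambda>n. norm (fcoef L g n) * (1 + norm (of_int_vec n :: real^'n)) ^ N) summable_on UNIV"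
proof -
  \<comment> \<open>The d + 2 additional powers pay for the summation over the lattice.\<close>
  obtain B where B: "\<And>n. norm (fcoef L g n) * (1 + norm (of_int_vec n :: real^'n)) ^ (N + (CARD('n) + 2)) \<le> B"
    using fcoef_decay[OF L g] by metis
  have "(\<lambda>n. norm (fcoef L g n * of_real ((1 + norm (of_int_vec n :: real^'n)) ^ N))) summable_on UNIV"
  proof (rule abs_summable_on_lattice[of _ B])
    fix n
    have "(1 + norm (of_int_vec n :: real^'n)) ^ (CARD('n) + 2) > 0" by (intro zero_less_power) (simp add: add_pos_nonneg)
    then show "norm (fcoef L g n * of_real ((1 + norm (of_int_vec n :: real^'n)) ^ N)) \<le> B / (1 + norm (of_int_vec n :: real^'n)) ^ (CARD('n) + 2)"
      using B[of n] unfolding norm_mult norm_of_real_power by (simp only: pos_le_divide_eq power_add mult.assoc)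
  qed
  then show ?thesis unfolding norm_mult norm_of_real_power .
qed

lemma fcoef_summable_norm:
  assumes L: "L > 0" and g: "schwartz (g :: real^'n::finite \<Rightarrow> complex)"
  shows "(\<lambda>n. norm (fcoef L g n)) summable_on UNIV"
  using fcoef_abs_summable[OF assms, of 0] by simp

text \<open>Absolute summability of the coefficients makes the series a continuous function
  \<open>R\<close>. By orthogonality all coefficients of \<open>g - R\<close> vanish, so it is zero
  at interior points by \<open>fourier_coefficients_unique\<close>.\<close>

theorem fourier_series:
  assumes L: "L > 0" and g: "schwartz (g :: real^'n::finite \<Rightarrow> complex)"
    and supp: "\<And>x. g x \<noteq> 0 \<Longrightarrow> x \<in> interior (cube L)" and a: "a \<in> interior (cube L)"
  shows "((\<lambda>n. fcoef L g n * phase (lat L n) 0 a) has_sum g a) UNIV"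
proof -
  define c where "c = fcoef L g"
  define R where "R x = (\<Sum>\<^sub>\<infinity>n. c n * phase (lat L n) 0 x)" for x
  have sc: "(\<lambda>n. norm (c n)) summable_on UNIV"
    unfolding c_def by (rule fcoef_summable_norm[OF L g])
  have R: "((\<lambda>n. c n * phase (lat L n) 0 x) has_sum R x) UNIV" for x
    unfolding R_def by (rule has_sum_infsum, rule abs_summable_summable) (simp add: norm_mult sc)
  have unif: "uniform_limit UNIV (\<lambda>F x. \<Sum>n\<in>F. c n * phase (lat L n) 0 x) R (finite_subsets_at_top UNIV)"
    unfolding R_def by (rule Weierstrass_m_test_general[OF _ sc]) (simp add: norm_mult)
  have Rc: "continuous_on UNIV R"
    by (rule uniform_limit_theorem[OF _ unif]) (auto intro!: always_eventually continuous_intros)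
  define H where "H x = g x - R x" for x
  have Hc: "continuous_on (cube L) H"
    unfolding H_def by (intro continuous_intros continuous_on_subset[OF Rc] continuous_on_subset[OF schwartz_continuous[OF g]]) auto
  have gsup: "\<And>x. g x \<noteq> 0 \<Longrightarrow> x \<in> cube L" using supp interior_subset by blast
  let ?V = "L ^ CARD('n)"
  have Vint: "integrable lborel (\<lambda>x::real^'n. indicator (cube L) x :: real)"
    using borel_integrable_compact[OF compact_cube[of L], of "\<lambda>_. 1::real"] by simp
  have "(\<integral>x. indicator (cube L) x *\<^sub>R (H x * phase (lat L m) 0 x) \<partial>lborel) = 0" for m
  proof -
    define I where "I = (\<integral>x. indicator (cube L) x *\<^sub>R (H x * phase (lat L m) 0 x) \<partial>lborel)"
    define W where "W = (\<integral>x. indicator (cube L) (x::real^'n) \<partial>lborel :: real)"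
    have W: "W \<ge> 0" unfolding W_def by (rule integral_nonneg_AE) simp
    have "norm I \<le> \<epsilon> * W" if \<epsilon>: "\<epsilon> > 0" for \<epsilon>
    proof -
      have "\<forall>\<^sub>F F in finite_subsets_at_top UNIV. \<forall>x. dist (\<Sum>n\<in>F. c n * phase (lat L n) 0 x) (R x) < \<epsilon>"
        using uniform_limitD[OF unif \<epsilon>] by simp
      \<comment> \<open>Once a partial sum contains the index \<open>- m\<close>, its coefficient
        against the character of \<open>m\<close> is exact and only the uniform error remains. The
        sign comes from pairing without conjugation.\<close>
      moreover have "\<forall>\<^sub>F F in finite_subsets_at_top UNIV. - m \<in> F"
        unfolding eventually_finite_subsets_at_top by (intro exI[of _ "{- m}"]) auto
      moreover have "\<forall>\<^sub>F F in finite_subsets_at_top (UNIV :: (int^'n) set). finite F"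
        by (rule eventually_finite_subsets_at_top_weakI)
      ultimately have "\<forall>\<^sub>F F in finite_subsets_at_top UNIV. (\<forall>x. dist (\<Sum>n\<in>F. c n * phase (lat L n) 0 x) (R x) < \<epsilon>) \<and> - m \<in> F \<and> finite F"
        by eventually_elim blast
      then obtain F where F: "finite F" "- m \<in> F" "\<And>x. dist (\<Sum>n\<in>F. c n * phase (lat L n) 0 x) (R x) < \<epsilon>"
        using eventually_happens'[OF finite_subsets_at_top_neq_bot] by blast
      define RF where "RF x = (\<Sum>n\<in>F. c n * phase (lat L n) 0 x)" for x :: "real^'n"
      have RFc: "continuous_on A RF" for A unfolding RF_def by (intro continuous_intros)
      have gc: "continuous_on A g" for A using schwartz_continuous[OF g] continuous_on_subset by blast
      have i1: "integrable lborel (\<lambda>x. indicator (cube L) x *\<^sub>R (g x * phase (lat L m) 0 x))"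
        by (intro borel_integrable_compact compact_cube continuous_intros gc)
      have i2: "integrable lborel (\<lambda>x. indicator (cube L) x *\<^sub>R (RF x * phase (lat L m) 0 x))"
        by (intro borel_integrable_compact compact_cube continuous_intros RFc)
      have i3: "integrable lborel (\<lambda>x. indicator (cube L) x *\<^sub>R (H x * phase (lat L m) 0 x))"
        by (intro borel_integrable_compact compact_cube continuous_intros Hc)
      have "(\<integral>x. indicator (cube L) x *\<^sub>R (RF x * phase (lat L m) 0 x) \<partial>lborel) =
          (\<integral>x. (\<Sum>n\<in>F. c n * (indicator (cube L) x *\<^sub>R phase (lat L (n + m)) 0 x)) \<partial>lborel)"
        by (intro Bochner_Integration.integral_cong refl)
           (simp add: RF_def sum_distrib_right scaleR_sum_right phase_mult_phase mult.assoc)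
      also have "\<dots> = (\<Sum>n\<in>F. c n * (\<integral>x. indicator (cube L) (x::real^'n) *\<^sub>R phase (lat L (n + m)) 0 x \<partial>lborel))"
        by (subst Bochner_Integration.integral_sum)
           (intro integrable_mult_right borel_integrable_compact compact_cube continuous_intros, simp only: integral_mult_right_zero)
      also have "\<dots> = (\<Sum>n\<in>F. if n = - m then c n * of_real ?V else 0)"
        unfolding integral_cube_phase[OF L] by (intro sum.cong refl) (auto simp: add_eq_0_iff2)
      also have "\<dots> = c (- m) * of_real ?V" using F by simp
      also have "\<dots> = fourier g (lat L (- m))" using L by (simp add: c_def fcoef_def)
      also have "\<dots> = (\<integral>x. indicator (cube L) x *\<^sub>R (g x * phase (lat L m) 0 x) \<partial>lborel)"
        by (subst fourier_cube[OF gsup]) simp_all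
      finally have eq: "(\<integral>x. indicator (cube L) x *\<^sub>R (RF x * phase (lat L m) 0 x) \<partial>lborel) =
          (\<integral>x. indicator (cube L) x *\<^sub>R (g x * phase (lat L m) 0 x) \<partial>lborel)" .
      have "I = (\<integral>x. indicator (cube L) x *\<^sub>R (H x * phase (lat L m) 0 x) - (indicator (cube L) x *\<^sub>R (g x * phase (lat L m) 0 x) - indicator (cube L) x *\<^sub>R (RF x * phase (lat L m) 0 x)) \<partial>lborel)"
        unfolding I_def
        by (simp only: Bochner_Integration.integral_diff i1 i2 i3 Bochner_Integration.integrable_diff eq) simp
      also have "norm \<dots> \<le> (\<integral>x. \<epsilon> * indicator (cube L) (x::real^'n) \<partial>lborel)"
      proof (rule Bochner_Integration.integral_norm_bound_integral)
        show "integrable lborel (\<lambda>x::real^'n. \<epsilon> * indicator (cube L) x)" using Vint by simp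
        fix x :: "real^'n"
        have "norm ((RF x - R x) * phase (lat L m) 0 x) \<le> \<epsilon>"
          using F(3)[of x] by (simp add: norm_mult RF_def dist_norm less_imp_le)
        then show "norm (indicator (cube L) x *\<^sub>R (H x * phase (lat L m) 0 x) - (indicator (cube L) x *\<^sub>R (g x * phase (lat L m) 0 x) - indicator (cube L) x *\<^sub>R (RF x * phase (lat L m) 0 x))) \<le> \<epsilon> * indicator (cube L) x"
          by (cases "x \<in> cube L") (simp_all add: H_def algebra_simps)
      qed (intro Bochner_Integration.integrable_diff i1 i2 i3)
      finally show ?thesis by (simp add: W_def)
    qed
    then have le: "norm I \<le> \<epsilon> * W" if "\<epsilon> > 0" for \<epsilon> using that .
    have "norm I \<le> 0"
    proof (rule field_le_epsilon)
      fix \<epsilon> :: real assume "\<epsilon> > 0"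
      then have "norm I \<le> (\<epsilon> / (W + 1)) * W" using W by (intro le) simp
      also have "\<dots> \<le> \<epsilon>" using W \<open>\<epsilon> > 0\<close> by (simp add: field_simps)
      finally show "norm I \<le> 0 + \<epsilon>" by simp
    qed
    then show ?thesis unfolding I_def by simp
  qed
  from fourier_coefficients_unique[OF L Hc a this] have "g a = R a" by (simp add: H_def)
  then show ?thesis using R[of a] by (simp add: c_def)
qed

subsection \<open>Series of Schwartz functions\<close>

lemma tempered_zero: "tempered u \<Longrightarrow> u (\<lambda>x. 0) = 0"
  using tempered_cmult[OF _ schwartz_zero, of u 0] by simp

lemma tempered_sum:
  assumes "tempered u" "\<And>k. k \<in> F \<Longrightarrow> schwartz (f k)"
  shows "u (\<lambda>x. \<Sum>k\<in>F. f k x) = (\<Sum>k\<in>F. u (f k))"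
  using assms(2)
proof (induction F rule: infinite_finite_induct)
  case (insert k F)
  then have "u (\<lambda>x. f k x + (\<Sum>k\<in>F. f k x)) = u (f k) + u (\<lambda>x. \<Sum>k\<in>F. f k x)"
    by (intro tempered_add assms(1) schwartz_sum_fun) auto
  then show ?case using insert by simp
qed (simp_all add: tempered_zero assms(1))

section \<open>Termwise differentiation and convergence in Schwartz space\<close>

lemma frechet_derivative_eq_sum:
  fixes f :: "real^'n::finite \<Rightarrow> complex"
  assumes "smooth f"
  shows "frechet_derivative f (at x) h = (\<Sum>j\<in>UNIV. of_real (h $ j) * partial_deriv j f x)"
proof -
  let ?D = "frechet_derivative f (at x)"
  have lin: "linear ?D" using smooth_has_derivative[OF assms] has_derivative_linear by blast
  have "h = (\<Sum>j\<in>UNIV. (h $ j) *\<^sub>R axis j 1)" using basis_expansion[of h] by (simp add: scalar_mult_eq_scaleR)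
  then have "?D h = ?D (\<Sum>j\<in>UNIV. (h $ j) *\<^sub>R axis j 1)" by simp
  also have "\<dots> = (\<Sum>j\<in>UNIV. (h $ j) *\<^sub>R ?D (axis j 1))"
    by (simp add: linear_sum[OF lin] linear_scale[OF lin])
  finally show ?thesis by (simp add: partial_deriv_def scaleR_conv_of_real[where 'a = complex])
qed

lemma norm_tail_le:
  fixes a :: "nat \<Rightarrow> 'a::banach"
  assumes M: "summable M" and le: "\<And>k. norm (a k) \<le> M k" and s: "a sums s"
  shows "norm ((\<Sum>k<n. a k) - s) \<le> suminf M - (\<Sum>k<n. M k)"
proof -
  have a: "summable a" "s = suminf a" using s by (auto simp: sums_iff)
  have "norm ((\<Sum>k<n. a k) - s) = norm (\<Sum>k. a (k + n))"
    using suminf_minus_initial_segment[OF a(1), of n] a(2) by (simp add: norm_minus_commute)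
  also have "\<dots> \<le> (\<Sum>k. M (k + n))"
    by (rule norm_suminf_le) (use M le in \<open>auto simp: summable_iff_shift\<close>)
  also have "\<dots> = suminf M - (\<Sum>k<n. M k)" using suminf_minus_initial_segment[OF M, of n] .
  finally show ?thesis .
qed

text \<open>The summable bounds on partial derivatives control the full derivative:
  \<open>\<tau> n\<close>, the sum of the tails over the coordinates, bounds the error as a linear
  map uniformly in \<open>x\<close>.\<close>

lemma partial_deriv_series:
  fixes f :: "nat \<Rightarrow> real^'n::finite \<Rightarrow> complex"
  assumes f: "\<And>k. smooth (f k)" and M: "\<And>j. summable (M j)"
    and le: "\<And>j k x. norm (partial_deriv j (f k) x) \<le> M j k"
    and \<Phi>: "\<And>x. (\<lambda>k. f k x) sums \<Phi> x"
  shows "\<Phi> differentiable_on UNIV" "(\<lambda>k. partial_deriv j (f k) x) sums partial_deriv j \<Phi> x"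
proof -
  define S where "S j x = (\<Sum>k. partial_deriv j (f k) x)" for j x
  have S: "(\<lambda>k. partial_deriv j (f k) x) sums S j x" for j x
    unfolding S_def by (intro summable_sums summable_comparison_test'[OF M[of j]] le)
  define f' where "f' k x h = (\<Sum>j\<in>UNIV. of_real (h $ j) * partial_deriv j (f k) x)" for k x h
  define g' where "g' x h = (\<Sum>j\<in>UNIV. of_real (h $ j) * S j x)" for x h
  define \<tau> where "\<tau> n = (\<Sum>j\<in>UNIV. suminf (M j) - (\<Sum>k<n. M j k))" for n
  have "(\<lambda>n. suminf (M j) - (\<Sum>k<n. M j k)) \<longlonglongrightarrow> suminf (M j) - suminf (M j)" for j
    by (intro tendsto_intros summable_LIMSEQ M)
  then have "\<tau> \<longlonglongrightarrow> (\<Sum>j\<in>(UNIV::'n set). (0::real))" unfolding \<tau>_def by (intro tendsto_sum) simp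
  then have \<tau>: "\<tau> \<longlonglongrightarrow> 0" by simp
  have bound: "norm ((\<Sum>k<n. f' k x h) - g' x h) \<le> \<tau> n * norm h" for n x h
  proof -
    have "(\<Sum>k<n. f' k x h) - g' x h = (\<Sum>j\<in>UNIV. of_real (h $ j) * ((\<Sum>k<n. partial_deriv j (f k) x) - S j x))"
      unfolding f'_def g'_def
      by (subst sum.swap) (simp add: sum_subtractf sum_distrib_left right_diff_distrib)
    also have "norm \<dots> \<le> (\<Sum>j\<in>UNIV. norm h * (suminf (M j) - (\<Sum>k<n. M j k)))"
      by (rule order_trans[OF norm_sum sum_mono])
         (unfold norm_mult norm_of_real, intro mult_mono component_le_norm_cart norm_tail_le[OF M le S], simp_all)
    also have "\<dots> = \<tau> n * norm h" by (simp add: \<tau>_def sum_distrib_left mult.commute)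
    finally show ?thesis .
  qed
  have "\<exists>g. \<forall>x\<in>UNIV. (\<lambda>n. f n x) sums (g x) \<and> (g has_derivative g' x) (at x within UNIV)"
  proof (rule has_derivative_series[of UNIV f f' g' 0 "\<Phi> 0"])
    show "(f n has_derivative f' n x) (at x within UNIV)" for n x
      using smooth_has_derivative[OF f, of n x] unfolding f'_def frechet_derivative_eq_sum[OF f, symmetric]
      by (simp add: eta_contract_eq)
    show "\<forall>\<^sub>F n in sequentially. \<forall>x\<in>UNIV. \<forall>h. norm ((\<Sum>i<n. f' i x h) - g' x h) \<le> e * norm h" if "e > 0" for e
    proof -
      have "\<forall>\<^sub>F n in sequentially. \<tau> n < e" using order_tendstoD(2)[OF \<tau> that] .
      then show ?thesis
        by eventually_elim (use bound mult_right_mono[OF less_imp_le norm_ge_zero] order_trans in blast)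
    qed
  qed (use \<Phi> in auto)
  then obtain g where g: "\<And>x. (\<lambda>n. f n x) sums (g x)" "\<And>x. (g has_derivative g' x) (at x)" by auto
  have "g = \<Phi>" using g(1) \<Phi> sums_unique2 by blast
  then have D: "(\<Phi> has_derivative g' x) (at x)" for x using g(2) by simp
  then show "\<Phi> differentiable_on UNIV" by (auto simp: differentiable_on_def differentiable_def)
  have "g' x (axis j 1) = S j x" for j x
  proof -
    have "g' x (axis j 1) = (\<Sum>k\<in>UNIV. if k = j then S k x else 0)"
      unfolding g'_def by (rule sum.cong) (auto simp: axis_def)
    then show ?thesis by simp
  qed
  then show "(\<lambda>k. partial_deriv j (f k) x) sums partial_deriv j \<Phi> x"
    using S partial_deriv_unique[OF D] by simp
qed

text \<open>Summability of every seminorm means convergence of the partial sums in Schwartz space,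
  so a tempered distribution may be applied term by term. The order of the seminorms that control
  \<open>v\<close> is not known in advance, hence the assumption for all \<open>N\<close> and
  \<open>\<alpha>\<close>.\<close>

lemma schwartz_series:
  fixes f :: "nat \<Rightarrow> real^'n::finite \<Rightarrow> complex"
  assumes f: "\<And>k. schwartz (f k)" and summ: "\<And>N \<alpha>. summable (\<lambda>k. schwartz_seminorm N \<alpha> (f k))"
    and \<Phi>: "\<And>x. (\<lambda>k. f k x) sums \<Phi> x"
  shows "schwartz \<Phi>" "tempered v \<Longrightarrow> (\<lambda>k. v (f k)) sums v \<Phi>"
proof -
  have le: "norm (partial_derivs \<alpha> (f k) x) \<le> schwartz_seminorm 0 \<alpha> (f k)" for \<alpha> k x
    using schwartz_seminorm_upper[OF f, of x 0 \<alpha> k] by simp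
  have D: "(\<lambda>k. partial_derivs \<alpha> (f k) x) sums partial_derivs \<alpha> \<Phi> x" for \<alpha> x
  proof (induction \<alpha> arbitrary: x)
    case Nil
    then show ?case using \<Phi> by simp
  next
    case (Cons j \<alpha>)
    show ?case unfolding partial_derivs_Cons
      by (rule partial_deriv_series(2)[where M = "\<lambda>j k. schwartz_seminorm 0 (j # \<alpha>) (f k)"])
         (use summ Cons.IH le[of "_ # \<alpha>"] in \<open>auto simp: partial_derivs_Cons intro: smooth_partial_derivs schwartz_smooth f\<close>)
  qed
  have diff: "partial_derivs \<alpha> \<Phi> differentiable_on UNIV" for \<alpha>
    by (rule partial_deriv_series(1)[where f = "\<lambda>k. partial_derivs \<alpha> (f k)" and M = "\<lambda>j k. schwartz_seminorm 0 (j # \<alpha>) (f k)"])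
       (use summ D le[of "_ # \<alpha>"] in \<open>auto simp: partial_derivs_Cons intro: smooth_partial_derivs schwartz_smooth f\<close>)
  have smooth: "smooth \<Phi>" using diff by (simp add: smooth_def)
  have tail: "(1 + norm x) ^ N * norm ((\<Sum>k<n. partial_derivs \<alpha> (f k) x) - partial_derivs \<alpha> \<Phi> x) \<le>
      (\<Sum>k. schwartz_seminorm N \<alpha> (f k)) - (\<Sum>k<n. schwartz_seminorm N \<alpha> (f k))" for N \<alpha> n x
  proof -
    let ?c = "(1 + norm x) ^ N"
    have "norm ((\<Sum>k<n. ?c *\<^sub>R partial_derivs \<alpha> (f k) x) - ?c *\<^sub>R partial_derivs \<alpha> \<Phi> x) \<le>
      (\<Sum>k. schwartz_seminorm N \<alpha> (f k)) - (\<Sum>k<n. schwartz_seminorm N \<alpha> (f k))"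
      by (rule norm_tail_le[OF summ]) (use schwartz_seminorm_upper[OF f] in \<open>auto intro: sums_scaleR_right D\<close>)
    then show ?thesis by (simp add: scaleR_sum_right[symmetric] scaleR_diff_right[symmetric])
  qed
  show \<Phi>s: "schwartz \<Phi>"
  proof (rule schwartzI[OF smooth])
    show "\<exists>B. \<forall>x. (1 + norm x) ^ N * norm (partial_derivs \<alpha> \<Phi> x) \<le> B" for N \<alpha>
      using tail[where n = 0 and N = N and \<alpha> = \<alpha>] by auto
  qed
  assume v: "tempered v"
  obtain C N where C: "C \<ge> 0" "\<And>\<phi>. schwartz \<phi> \<Longrightarrow> norm (v \<phi>) \<le> C * schwartz_sum N \<phi>"
    using tempered_bound[OF v] by blast
  let ?A = "{\<alpha> :: 'n list. length \<alpha> \<le> N}"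
  define \<tau> where "\<tau> n = (\<Sum>\<alpha>\<in>?A. (\<Sum>k. schwartz_seminorm N \<alpha> (f k)) - (\<Sum>k<n. schwartz_seminorm N \<alpha> (f k)))" for n
  have "(\<lambda>n. (\<Sum>k. schwartz_seminorm N \<alpha> (f k)) - (\<Sum>k<n. schwartz_seminorm N \<alpha> (f k))) \<longlonglongrightarrow>
     (\<Sum>k. schwartz_seminorm N \<alpha> (f k)) - (\<Sum>k. schwartz_seminorm N \<alpha> (f k))" for \<alpha>
    by (intro tendsto_intros summable_LIMSEQ summ)
  then have "\<tau> \<longlonglongrightarrow> (\<Sum>\<alpha>\<in>?A. (0::real))" unfolding \<tau>_def by (intro tendsto_sum) simp
  then have "(\<lambda>n. C * (real (card ?A) * \<tau> n)) \<longlonglongrightarrow> C * (real (card ?A) * 0)"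
    by (intro tendsto_mult tendsto_const) simp
  then have lim: "(\<lambda>n. C * (real (card ?A) * \<tau> n)) \<longlonglongrightarrow> 0" by simp
  have le: "norm ((\<Sum>k<n. v (f k)) - v \<Phi>) \<le> C * (real (card ?A) * \<tau> n)" for n
  proof -
    have s1: "schwartz (\<lambda>x. \<Sum>k<n. f k x)" by (intro schwartz_sum_fun f)
    have s2: "schwartz (\<lambda>x. - 1 * \<Phi> x)" by (intro schwartz_cmult \<Phi>s)
    have "(\<Sum>k<n. v (f k)) - v \<Phi> = v (\<lambda>x. (\<Sum>k<n. f k x) + - 1 * \<Phi> x)"
      unfolding tempered_add[OF v s1 s2] tempered_sum[OF v f] tempered_cmult[OF v \<Phi>s] by simp
    also have "norm \<dots> \<le> C * schwartz_sum N (\<lambda>x. (\<Sum>k<n. f k x) + - 1 * \<Phi> x)"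
      by (intro C schwartz_add s1 s2)
    also have "\<dots> \<le> C * (real (card ?A) * \<tau> n)"
    proof (intro mult_left_mono C(1) schwartz_sum_le)
      fix \<alpha> :: "'n list" and x :: "real^'n" assume \<alpha>: "length \<alpha> \<le> N"
      have ps: "partial_derivs \<alpha> (\<lambda>x. \<Sum>k\<in>K. f k x) = (\<lambda>x. \<Sum>k\<in>K. partial_derivs \<alpha> (f k) x)" if "finite K" for K
        using that
      proof induction
        case empty
        have "partial_derivs \<alpha> (\<lambda>x. 0) = (\<lambda>x. 0)" for \<alpha> :: "'n list"
          by (induction \<alpha>) (auto simp: partial_derivs_Cons)
        then show ?case by simp
      next
        case (insert k K)
        then show ?case by (simp add: partial_derivs_add smooth_sum schwartz_smooth f)
      qed
      have "partial_derivs \<alpha> (\<lambda>x. (\<Sum>k<n. f k x) + - 1 * \<Phi> x) x = (\<Sum>k<n. partial_derivs \<alpha> (f k) x) - partial_derivs \<alpha> \<Phi> x"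
        unfolding partial_derivs_add[OF schwartz_smooth[OF s1] schwartz_smooth[OF s2]] partial_derivs_cmult[OF smooth]
        by (simp add: ps)
      then have "(1 + norm x) ^ N * norm (partial_derivs \<alpha> (\<lambda>x. (\<Sum>k<n. f k x) + - 1 * \<Phi> x) x) \<le>
        (\<Sum>k. schwartz_seminorm N \<alpha> (f k)) - (\<Sum>k<n. schwartz_seminorm N \<alpha> (f k))"
        using tail by simp
      also have "\<dots> \<le> \<tau> n" unfolding \<tau>_def
        by (rule member_le_sum) (use \<alpha> in \<open>auto intro!: sum_le_suminf summ schwartz_seminorm_nonneg f\<close>)
      finally show "(1 + norm x) ^ N * norm (partial_derivs \<alpha> (\<lambda>x. (\<Sum>k<n. f k x) + - 1 * \<Phi> x) x) \<le> \<tau> n" .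
    qed
    finally show ?thesis .
  qed
  have "(\<lambda>n. (\<Sum>k<n. v (f k)) - v \<Phi>) \<longlonglongrightarrow> 0"
    by (rule Lim_null_comparison[OF always_eventually lim]) (rule allI, rule le)
  then show "(\<lambda>k. v (f k)) sums v \<Phi>" unfolding sums_def by (simp add: LIM_zero_iff)
qed

section \<open>Series indexed by the lattice\<close>

lemma lattice_bij:
  obtains b :: "nat \<Rightarrow> int^'n::finite" where "bij_betw b UNIV UNIV"
proof -
  have "inj (\<lambda>k::int. (\<chi> i. k) :: int^'n)" by (auto simp: inj_def vec_eq_iff)
  then have "infinite (range (\<lambda>k::int. (\<chi> i. k) :: int^'n))" by (simp add: finite_image_iff infinite_UNIV_int)
  then have "infinite (UNIV :: (int^'n) set)" using finite_subset subset_UNIV by blast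
  then show thesis using that bij_betw_from_nat_into[of "UNIV :: (int^'n) set"] by simp
qed

lemma lattice_has_sum_iff:
  fixes g :: "int^'n::finite \<Rightarrow> 'a::banach"
  assumes "(\<lambda>n. norm (g n)) summable_on UNIV" and b: "bij_betw (b :: nat \<Rightarrow> int^'n) UNIV UNIV"
  shows "(g has_sum S) UNIV \<longleftrightarrow> (\<lambda>k. g (b k)) sums S"
proof -
  have "(g has_sum infsum g UNIV) UNIV" by (rule has_sum_infsum, rule abs_summable_summable) fact
  then have 1: "(\<lambda>k. g (b k)) sums infsum g UNIV"
    using has_sum_reindex_bij_betw[OF b, of g] has_sum_imp_sums by blast
  show ?thesis
  proof
    assume "(g has_sum S) UNIV"
    then show "(\<lambda>k. g (b k)) sums S" using has_sum_reindex_bij_betw[OF b, of g] has_sum_imp_sums by blast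
  next
    assume "(\<lambda>k. g (b k)) sums S"
    then have "S = infsum g UNIV" using 1 sums_unique2 by blast
    then show "(g has_sum S) UNIV" using \<open>(g has_sum infsum g UNIV) UNIV\<close> by simp
  qed
qed

lemma summable_on_finite_sum:
  fixes f :: "'k \<Rightarrow> 'i \<Rightarrow> real"
  assumes "finite A" "\<And>k. k \<in> A \<Longrightarrow> f k summable_on I"
  shows "(\<lambda>i. \<Sum>k\<in>A. f k i) summable_on I"
  using assms by induction (auto intro: summable_on_add)

text \<open>An enumeration reduces the claim to sequences but gives only ordered convergence of the
  pairings. Continuity of \<open>v\<close> makes the pairings absolutely summable, which restores
  the unordered sum.\<close>

lemma schwartz_lattice_series:
  fixes f :: "int^'n::finite \<Rightarrow> real^'n \<Rightarrow> complex"
  assumes f: "\<And>n. schwartz (f n)" and summ: "\<And>N \<alpha>. (\<lambda>n. schwartz_seminorm N \<alpha> (f n)) summable_on UNIV"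
    and \<Phi>: "\<And>x. ((\<lambda>n. f n x) has_sum \<Phi> x) UNIV"
  shows "schwartz \<Phi>" "tempered v \<Longrightarrow> ((\<lambda>n. v (f n)) has_sum v \<Phi>) UNIV"
proof -
  obtain b :: "nat \<Rightarrow> int^'n" where b: "bij_betw b UNIV UNIV" by (rule lattice_bij)
  have summ': "summable (\<lambda>k. schwartz_seminorm N \<alpha> (f (b k)))" for N \<alpha>
    using has_sum_infsum[OF summ[of N \<alpha>]] has_sum_reindex_bij_betw[OF b, of "\<lambda>n. schwartz_seminorm N \<alpha> (f n)"]
      has_sum_imp_sums sums_summable by blast
  have \<Phi>': "(\<lambda>k. f (b k) x) sums \<Phi> x" for x
    using \<Phi>[of x] has_sum_reindex_bij_betw[OF b, of "\<lambda>n. f n x"] has_sum_imp_sums by blast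
  show "schwartz \<Phi>" by (rule schwartz_series(1)[of "\<lambda>k. f (b k)"]) (use f summ' \<Phi>' in auto)
  assume v: "tempered v"
  have s: "(\<lambda>k. v (f (b k))) sums v \<Phi>" by (rule schwartz_series(2)[of "\<lambda>k. f (b k)"]) (use f summ' \<Phi>' v in auto)
  obtain C N where C: "C \<ge> 0" "\<And>\<phi>. schwartz \<phi> \<Longrightarrow> norm (v \<phi>) \<le> C * schwartz_sum N \<phi>"
    using tempered_bound[OF v] by blast
  have "(\<lambda>n. norm (v (f n))) summable_on UNIV"
  proof (rule summable_on_comparison_test)
    show "(\<lambda>n. C * schwartz_sum N (f n)) summable_on UNIV"
      unfolding schwartz_sum_def by (intro summable_on_cmult_right summable_on_finite_sum summ) simp
  qed (use C f in auto)
  then show "((\<lambda>n. v (f n)) has_sum v \<Phi>) UNIV" using s lattice_has_sum_iff[OF _ b, of "\<lambda>n. v (f n)"] by blast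
qed

text \<open>On the support of \<open>\<phi>\<close> a frequency cut-off \<open>g\<close> equals its Fourier series, so the pairing with
  \<open>g \<phi>\<close> is a discrete convolution of pairings with modulations of \<open>\<phi>\<close>.\<close>

lemma tempered_modulation_expansion:
  fixes g \<phi> :: "real^'n::finite \<Rightarrow> complex"
  assumes L: "L > 0" and g: "schwartz g" and gs: "\<And>x. g x \<noteq> 0 \<Longrightarrow> x \<in> interior (cube L)"
    and \<phi>: "schwartz \<phi>" and \<phi>s: "\<And>x. \<phi> x \<noteq> 0 \<Longrightarrow> x \<in> interior (cube L)" and v: "tempered v"
  shows "((\<lambda>n. fcoef L g n * v (\<lambda>x. phase (y + lat L n) 0 x * \<phi> x)) has_sum v (\<lambda>x. phase y 0 x * (g x * \<phi> x))) UNIV"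
proof -
  define f where "f n x = fcoef L g n * (phase (y + lat L n) 0 x * \<phi> x)" for n x
  have fs: "schwartz (f n)" for n unfolding f_def by (intro schwartz_cmult schwartz_phase_mult \<phi>)
  have "((\<lambda>n. v (f n)) has_sum v (\<lambda>x. phase y 0 x * (g x * \<phi> x))) UNIV"
  proof (rule schwartz_lattice_series(2)[OF fs _ _ v])
    fix N :: nat and \<alpha> :: "'n list"
    obtain C K where C: "C \<ge> 0" "\<And>\<phi> x y s. schwartz \<phi> \<Longrightarrow>
      (1 + norm x) ^ N * norm (partial_derivs \<alpha> (\<lambda>x. phase y s x * \<phi> x) x)
        \<le> C * (1 + norm y + \<bar>s\<bar>) ^ length \<alpha> * schwartz_sum K (\<phi> :: real^'n \<Rightarrow> complex)"
      using phase_mult_bound'[of N \<alpha>] by blast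
    \<comment> \<open>The frequencies grow at most linearly in \<open>n\<close>, and each derivative
      of the modulated function costs one such factor; the rapidly decaying coefficients absorb
      them.\<close>
    define D where "D = 1 + 1 / L + norm y"
    have D: "1 + norm (y + lat L n) \<le> D * (1 + norm (of_int_vec n :: real^'n))" for n
    proof -
      have "norm (y + lat L n) \<le> norm y + (1 / L) * norm (of_int_vec n :: real^'n)"
        using norm_triangle_ineq[of y "lat L n"] L by (simp add: lat_def)
      moreover have "1 + a \<le> (1 + c + b) * (1 + k)" if "a \<le> b + c * k" "0 \<le> b" "0 \<le> c" "0 \<le> k" for a b c k :: real
      proof -
        have "(1 + c + b) * (1 + k) = 1 + k + c + c * k + b + b * k" by (simp add: algebra_simps)
        then show ?thesis using that mult_nonneg_nonneg[OF that(2,4)] by linarith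
      qed
      ultimately show ?thesis unfolding D_def using L by simp
    qed
    have "schwartz_seminorm N \<alpha> (f n) \<le> (C * D ^ length \<alpha> * schwartz_sum K \<phi>) * (norm (fcoef L g n) * (1 + norm (of_int_vec n :: real^'n)) ^ length \<alpha>)" for n
      unfolding schwartz_seminorm_def
    proof (rule cSUP_least)
      fix x
      have "(1 + norm x) ^ N * norm (partial_derivs \<alpha> (f n) x) =
          norm (fcoef L g n) * ((1 + norm x) ^ N * norm (partial_derivs \<alpha> (\<lambda>x. phase (y + lat L n) 0 x * \<phi> x) x))"
        unfolding f_def by (simp add: partial_derivs_cmult schwartz_smooth schwartz_phase_mult \<phi> norm_mult)
      also have "\<dots> \<le> norm (fcoef L g n) * (C * (1 + norm (y + lat L n) + \<bar>0\<bar>) ^ length \<alpha> * schwartz_sum K \<phi>)"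
        by (intro mult_left_mono C \<phi>) simp
      also have "\<dots> \<le> norm (fcoef L g n) * (C * (D * (1 + norm (of_int_vec n :: real^'n))) ^ length \<alpha> * schwartz_sum K \<phi>)"
        using D[of n] C(1) by (intro mult_left_mono mult_right_mono power_mono schwartz_sum_nonneg \<phi>) auto
      finally show "(1 + norm x) ^ N * norm (partial_derivs \<alpha> (f n) x) \<le>
        (C * D ^ length \<alpha> * schwartz_sum K \<phi>) * (norm (fcoef L g n) * (1 + norm (of_int_vec n :: real^'n)) ^ length \<alpha>)"
        by (simp add: power_mult_distrib mult_ac)
    qed simp
    then show "(\<lambda>n. schwartz_seminorm N \<alpha> (f n)) summable_on UNIV"
      by (intro summable_on_comparison_test[OF summable_on_cmult_right[OF fcoef_abs_summable[OF L g]]])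
         (auto intro: schwartz_seminorm_nonneg fs)
  next
    fix x
    show "((\<lambda>n. f n x) has_sum phase y 0 x * (g x * \<phi> x)) UNIV"
    proof (cases "x \<in> interior (cube L)")
      case True
      have "((\<lambda>n. (phase y 0 x * \<phi> x) * (fcoef L g n * phase (lat L n) 0 x)) has_sum (phase y 0 x * \<phi> x) * g x) UNIV"
        by (intro has_sum_cmult_right fourier_series L g gs True)
      then show ?thesis by (simp add: f_def phase_mult_phase[of y 0 x _ 0, simplified, symmetric] mult_ac)
    next
      \<comment> \<open>Outside the cube the Fourier series need not represent \<open>g\<close>, but
        \<open>\<phi>\<close> vanishes there and makes both sides zero.\<close>
      case False
      then have "\<phi> x = 0" using \<phi>s by blast
      then show ?thesis by (simp add: f_def)
    qed
  qed
  then show ?thesis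
    unfolding f_def by (simp add: tempered_cmult[OF v] schwartz_phase_mult \<phi>)
qed

subsection \<open>Fourier inversion for compactly supported smooth functions\<close>

lemma fourier_phase_mult: "fourier (\<lambda>x. phase y 0 x * \<phi> x) \<eta> = fourier \<phi> (\<eta> - y)"
  unfolding fourier_phase by (simp add: mult.assoc[symmetric] phase_mult_phase)

lemma phase_commute: "phase y 0 x = phase x 0 y"
  by (simp add: phase_def inner_commute)

text \<open>Averaging the Fourier series of \<open>\<phi>\<close>, modulated by \<open>\<theta>\<close>, over a cell of frequencies \<open>\<theta>\<close> turns the
  series into the inversion integral.\<close>

lemma inv_fourier_fourier:
  fixes \<phi> :: "real^'n::finite \<Rightarrow> complex"
  assumes \<phi>: "schwartz \<phi>" and supp: "\<And>x i. \<phi> x \<noteq> 0 \<Longrightarrow> \<bar>x $ i\<bar> \<le> R"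
  shows "inv_fourier (fourier \<phi>) x = \<phi> x"
proof -
  \<comment> \<open>Large enough for the support of \<open>\<phi>\<close> and the point
    \<open>x\<close> to lie in the interior of the cube.\<close>
  define L where "L = 2 * (\<bar>R\<bar> + norm x + 1)"
  have L: "L > 0" unfolding L_def by (simp add: add_nonneg_pos)
  have L2: "L / 2 = \<bar>R\<bar> + norm x + 1" by (simp add: L_def)
  have xc: "x \<in> interior (cube L)"
    unfolding interior_cube L2
  proof
    show "\<bar>x $ i\<bar> < \<bar>R\<bar> + norm x + 1" for i
      using component_le_norm_cart[of x i] abs_ge_zero[of R] by linarith
  qed
  have \<phi>c: "z \<in> interior (cube L)" if "\<phi> z \<noteq> 0" for z
    unfolding interior_cube L2
  proof
    show "\<bar>z $ i\<bar> < \<bar>R\<bar> + norm x + 1" for i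
      using supp[OF that, of i] abs_ge_self[of R] norm_ge_zero[of x] by linarith
  qed
  have "((\<lambda>m. fourier \<phi> (\<theta> + (1 / L) *\<^sub>R of_int_vec m) * phase x 0 (\<theta> + (1 / L) *\<^sub>R of_int_vec m)) has_sum of_real (L ^ CARD('n)) * \<phi> x) UNIV" for \<theta>
  proof -
    let ?g = "\<lambda>z. phase (- \<theta>) 0 z * \<phi> z"
    have "((\<lambda>m. (of_real (L ^ CARD('n)) * phase \<theta> 0 x) * (fcoef L ?g m * phase (lat L m) 0 x)) has_sum
        (of_real (L ^ CARD('n)) * phase \<theta> 0 x) * ?g x) UNIV"
      by (intro has_sum_cmult_right fourier_series L schwartz_phase_mult \<phi> xc \<phi>c) auto
    moreover have "(of_real (L ^ CARD('n)) * phase \<theta> 0 x) * (fcoef L ?g m * phase (lat L m) 0 x) =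
        fourier \<phi> (\<theta> + lat L m) * phase x 0 (\<theta> + lat L m)" for m
    proof -
      have "fcoef L ?g m = fourier \<phi> (\<theta> + lat L m) / of_real (L ^ CARD('n))"
        unfolding fcoef_def fourier_phase_mult by (simp add: add.commute)
      moreover have "phase x 0 (\<theta> + lat L m) = phase \<theta> 0 x * phase (lat L m) 0 x"
        unfolding phase_commute[of x] by (simp add: phase_mult_phase)
      ultimately show ?thesis using L by simp
    qed
    moreover have "phase \<theta> 0 x * ?g x = \<phi> x" by (simp add: mult.assoc[symmetric] phase_mult_phase)
    ultimately show ?thesis by (simp add: lat_def mult.assoc)
  qed
  \<comment> \<open>The lattice sum does not depend on the offset \<theta>, so the integral is this
    constant times the volume of the cell, which cancels the normalisation of the
    coefficients.\<close>
  then have "(\<integral>\<xi>. fourier \<phi> \<xi> * phase x 0 \<xi> \<partial>lborel) = (\<integral>\<xi>. indicator (cell (1 / L)) (\<xi>::real^'n) *\<^sub>R (of_real (L ^ CARD('n)) * \<phi> x) \<partial>lborel)"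
    using schwartz_integrable[OF schwartz_phase_mult[OF schwartz_fourier[OF \<phi>], of x 0]] L
    by (intro integral_tiling) (simp_all add: mult.commute)
  also have "\<dots> = measure lborel (cell (1 / L) :: (real^'n) set) *\<^sub>R (of_real (L ^ CARD('n)) * \<phi> x)"
    using emeasure_cell[of "1 / L", where 'n = 'n] L
    by (subst integral_scaleR_left) (auto intro!: integrable_real_indicator)
  also have "measure lborel (cell (1 / L) :: (real^'n) set) = (1 / L) ^ CARD('n)"
    using emeasure_cell[of "1 / L", where 'n = 'n] L by (simp add: measure_def)
  finally show ?thesis
    using L by (simp add: inv_fourier_def phase_def scaleR_conv_of_real power_divide)
qed

subsection \<open>Interpolation between $\ell^1$, $\ell^2$ and $\ell^\infty$\<close>

lemma nn_integral_powr_from_0: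
  assumes "\<alpha> > - 1" "b \<ge> 0"
  shows "(\<integral>\<^sup>+x. ennreal (x powr \<alpha>) * indicator {0..b} x \<partial>lborel) = ennreal (b powr (\<alpha> + 1) / (\<alpha> + 1))"
proof -
  have "((\<lambda>x. if x \<in> {0..b} then x powr \<alpha> else 0) has_integral (b powr (\<alpha> + 1) / (\<alpha> + 1))) UNIV"
    unfolding has_integral_restrict_UNIV by (rule has_integral_powr_from_0[OF assms])
  then have "(\<integral>\<^sup>+x. ennreal (if x \<in> {0..b} then x powr \<alpha> else 0) \<partial>lborel) = ennreal (b powr (\<alpha> + 1) / (\<alpha> + 1))"
    by (intro nn_integral_has_integral_lborel) auto
  moreover have "ennreal (if x \<in> {0..b} then x powr \<alpha> else 0) = ennreal (x powr \<alpha>) * indicator {0..b} x" for x :: real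
    by (simp add: indicator_def)
  ultimately show ?thesis by simp
qed

lemma nn_integral_powr_to_inf:
  assumes "\<alpha> < - 1" "b > 0"
  shows "(\<integral>\<^sup>+x. ennreal (x powr \<alpha>) * indicator {b..} x \<partial>lborel) = ennreal (b powr (\<alpha> + 1) / - (\<alpha> + 1))"
proof -
  have "((\<lambda>x. if x \<in> {b..} then x powr \<alpha> else 0) has_integral (- (b powr (\<alpha> + 1)) / (\<alpha> + 1))) UNIV"
    unfolding has_integral_restrict_UNIV by (rule has_integral_powr_to_inf[OF assms])
  then have "(\<integral>\<^sup>+x. ennreal (if x \<in> {b..} then x powr \<alpha> else 0) \<partial>lborel) = ennreal (- (b powr (\<alpha> + 1)) / (\<alpha> + 1))"
    by (intro nn_integral_has_integral_lborel) auto
  moreover have "ennreal (if x \<in> {b..} then x powr \<alpha> else 0) = ennreal (x powr \<alpha>) * indicator {b..} x" for x :: real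
    by (simp add: indicator_def)
  moreover have "- (b powr (\<alpha> + 1)) / (\<alpha> + 1) = b powr (\<alpha> + 1) / - (\<alpha> + 1)"
    by (metis minus_divide_left minus_divide_right)
  ultimately show ?thesis by simp
qed

text \<open>Level sets of \<open>f / 2\<close> rather than of \<open>f\<close>: when a sequence is
  split in two, wherever half of the value reaches \<open>x\<close> one of the two parts reaches
  \<open>x\<close>. The halving costs the factor \<open>2 powr p\<close>.\<close>

lemma layer_cake:
  fixes f :: "'m::countable \<Rightarrow> real"
  assumes p: "p > 0" and f: "\<And>m. f m \<ge> 0"
  shows "(\<integral>\<^sup>+m. ennreal (f m powr p) \<partial>count_space UNIV) =
    ennreal (2 powr p * p) * (\<integral>\<^sup>+x. ennreal (x powr (p - 1)) * (\<integral>\<^sup>+m. indicator {0..f m / 2} x \<partial>count_space UNIV) \<partial>lborel)"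
proof -
  have "ennreal (f m powr p) = ennreal (2 powr p * p) * (\<integral>\<^sup>+x. ennreal (x powr (p - 1)) * indicator {0..f m / 2} x \<partial>lborel)" for m
  proof -
    have "2 powr p * p * ((f m / 2) powr p / p) = f m powr p" using p f[of m] by (simp add: powr_divide)
    moreover have "(\<integral>\<^sup>+x. ennreal (x powr (p - 1)) * indicator {0..f m / 2} x \<partial>lborel) = ennreal ((f m / 2) powr p / p)"
      using nn_integral_powr_from_0[of "p - 1" "f m / 2"] p f[of m] by simp
    moreover have "ennreal (2 powr p * p) * ennreal ((f m / 2) powr p / p) = ennreal (2 powr p * p * ((f m / 2) powr p / p))"
      by (rule ennreal_mult'[symmetric]) (use p in simp)
    ultimately show ?thesis by simp
  qed
  then have "(\<integral>\<^sup>+m. ennreal (f m powr p) \<partial>count_space UNIV) =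
    (\<integral>\<^sup>+m. ennreal (2 powr p * p) * (\<integral>\<^sup>+x. ennreal (x powr (p - 1)) * indicator {0..f m / 2} x \<partial>lborel) \<partial>count_space UNIV)"
    by (intro nn_integral_cong)
  also have "\<dots> = ennreal (2 powr p * p) * (\<integral>\<^sup>+m. (\<integral>\<^sup>+x. ennreal (x powr (p - 1)) * indicator {0..f m / 2} x \<partial>lborel) \<partial>count_space UNIV)"
    by (rule nn_integral_cmult) simp
  also have "(\<integral>\<^sup>+m. (\<integral>\<^sup>+x. ennreal (x powr (p - 1)) * indicator {0..f m / 2} x \<partial>lborel) \<partial>count_space UNIV)
      = (\<integral>\<^sup>+x. (\<integral>\<^sup>+m. ennreal (x powr (p - 1)) * indicator {0..f m / 2} x \<partial>count_space UNIV) \<partial>lborel)"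
    by (rule nn_integral_count_space_Fubini[symmetric]) measurable
  also have "\<dots> = (\<integral>\<^sup>+x. ennreal (x powr (p - 1)) * (\<integral>\<^sup>+m. indicator {0..f m / 2} x \<partial>count_space UNIV) \<partial>lborel)"
    by (intro nn_integral_cong nn_integral_cmult) simp
  finally show ?thesis .
qed

lemma ennreal_add_mult:
  "0 \<le> u \<Longrightarrow> 0 \<le> s \<Longrightarrow> 0 \<le> w \<Longrightarrow> 0 \<le> t \<Longrightarrow> ennreal (u * s + w * t) = ennreal u * ennreal s + ennreal w * ennreal t"
  by (simp add: ennreal_mult')

lemma ennreal_mult_indicator: "ennreal (c * indicator S x) = ennreal c * indicator S x"
  by (simp add: indicator_def)

text \<open>\<open>A\<close> bounds both the column sums and the row sums, hence the operator on l^1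
  and on l^infinity; \<open>B\<close> bounds it on l^2. Row sums and l^2 inputs run over finite
  sets, so that no convergence enters before the limit in \<open>interpolation\<close>.\<close>

locale kernel_bounds =
  fixes K :: "'m::countable \<Rightarrow> 'k::countable \<Rightarrow> complex" and A B :: real
  assumes A: "A > 0" and B: "B \<ge> 0"
    and l1: "\<And>k. (\<integral>\<^sup>+m. ennreal (norm (K m k)) \<partial>count_space UNIV) \<le> ennreal A"
    and linf: "\<And>m F. finite F \<Longrightarrow> (\<Sum>k\<in>F. norm (K m k)) \<le> A"
    and l2: "\<And>F a. finite F \<Longrightarrow>
      (\<integral>\<^sup>+m. ennreal ((norm (\<Sum>k\<in>F. K m k * a k))\<^sup>2) \<partial>count_space UNIV) \<le> ennreal (B\<^sup>2 * (\<Sum>k\<in>F. (norm (a k))\<^sup>2))"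
begin

lemma l1_bound:
  assumes "finite F"
  shows "(\<integral>\<^sup>+m. ennreal (norm (\<Sum>k\<in>F. K m k * a k)) \<partial>count_space UNIV) \<le> ennreal (A * (\<Sum>k\<in>F. norm (a k)))"
proof -
  have "(\<integral>\<^sup>+m. ennreal (norm (\<Sum>k\<in>F. K m k * a k)) \<partial>count_space UNIV) \<le>
      (\<integral>\<^sup>+m. (\<Sum>k\<in>F. ennreal (norm (a k)) * ennreal (norm (K m k))) \<partial>count_space UNIV)"
  proof (rule nn_integral_mono)
    fix m
    have "norm (\<Sum>k\<in>F. K m k * a k) \<le> (\<Sum>k\<in>F. norm (a k) * norm (K m k))"
      by (rule order_trans[OF norm_sum]) (simp add: norm_mult mult.commute)
    then show "ennreal (norm (\<Sum>k\<in>F. K m k * a k)) \<le> (\<Sum>k\<in>F. ennreal (norm (a k)) * ennreal (norm (K m k)))"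
      by (simp add: ennreal_mult'[symmetric] sum_ennreal ennreal_leI)
  qed
  also have "\<dots> = (\<Sum>k\<in>F. ennreal (norm (a k)) * (\<integral>\<^sup>+m. ennreal (norm (K m k)) \<partial>count_space UNIV))"
    by (subst nn_integral_sum) (auto simp: nn_integral_cmult)
  also have "\<dots> \<le> (\<Sum>k\<in>F. ennreal (norm (a k)) * ennreal A)"
    by (intro sum_mono mult_left_mono l1) simp
  also have "\<dots> = ennreal (A * (\<Sum>k\<in>F. norm (a k)))"
    using A by (simp add: ennreal_mult'[symmetric] sum_ennreal sum_distrib_left mult.commute)
  finally show ?thesis .
qed

text \<open>Marcinkiewicz interpolation: at height \<open>x\<close> the sequence is split at \<open>A x\<close>
  into a part treated in $\ell^1$ and a part treated in $\ell^2$.\<close>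

lemma level_bound_lower:
  assumes F: "finite F" and x: "x > 0"
  shows "(\<integral>\<^sup>+m. indicator {0..norm (\<Sum>k\<in>F. K m k * a k) / 2} x \<partial>count_space UNIV) \<le>
    ennreal (\<Sum>k\<in>F. A * norm (a k) * x powr - 1 * indicator {0..norm (a k) / A} x
       + B\<^sup>2 * (norm (a k))\<^sup>2 * x powr - 2 * indicator {norm (a k) / A..} x)"
proof -
  let ?T = "\<lambda>a m. \<Sum>k\<in>F. K m k * a k"
  \<comment> \<open>Scaling the threshold by \<open>A\<close> makes the l^1 and the l^2
    contributions carry the same power of \<open>A\<close> after integration in
    \<open>x\<close>.\<close>
  define a1 where "a1 k = (if A * x < norm (a k) then a k else 0)" for k
  define a2 where "a2 k = (if A * x < norm (a k) then 0 else a k)" for k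
  have "(\<integral>\<^sup>+m. indicator {0..norm (?T a m) / 2} x \<partial>count_space UNIV) \<le>
     (\<integral>\<^sup>+m. ennreal (x powr - 1) * ennreal (norm (?T a1 m)) + ennreal (x powr - 2) * ennreal ((norm (?T a2 m))\<^sup>2) \<partial>count_space UNIV)"
  proof (rule nn_integral_mono)
    fix m
    show "indicator {0..norm (?T a m) / 2} x \<le> ennreal (x powr - 1) * ennreal (norm (?T a1 m)) + ennreal (x powr - 2) * ennreal ((norm (?T a2 m))\<^sup>2)"
    proof (cases "x \<le> norm (?T a m) / 2")
      case True
      have "?T a m = ?T a1 m + ?T a2 m"
        unfolding sum.distrib[symmetric] by (rule sum.cong) (auto simp: a1_def a2_def)
      then have "norm (?T a m) \<le> norm (?T a1 m) + norm (?T a2 m)" by (simp only: norm_triangle_ineq)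
      with True consider "x \<le> norm (?T a1 m)" | "x \<le> norm (?T a2 m)" by linarith
      then have "1 \<le> x powr - 1 * norm (?T a1 m) + x powr - 2 * (norm (?T a2 m))\<^sup>2"
      proof cases
        case 1
        then have "1 \<le> x powr - 1 * norm (?T a1 m)" using x by (simp add: powr_minus field_simps)
        then show ?thesis by (simp add: add_increasing2)
      next
        case 2
        then have "x\<^sup>2 \<le> (norm (?T a2 m))\<^sup>2" using x by (intro power_mono) auto
        then have "1 \<le> x powr - 2 * (norm (?T a2 m))\<^sup>2" using x by (simp add: powr_minus field_simps powr_numeral)
        then show ?thesis by (simp add: add_increasing)
      qed
      then have "1 \<le> ennreal (x powr - 1 * norm (?T a1 m) + x powr - 2 * (norm (?T a2 m))\<^sup>2)" by (simp only: ennreal_ge_1)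
      also have "\<dots> = ennreal (x powr - 1) * ennreal (norm (?T a1 m)) + ennreal (x powr - 2) * ennreal ((norm (?T a2 m))\<^sup>2)"
        by (rule ennreal_add_mult) auto
      finally show ?thesis using True x by simp
    qed simp
  qed
  also have "\<dots> = ennreal (x powr - 1) * (\<integral>\<^sup>+m. ennreal (norm (?T a1 m)) \<partial>count_space UNIV)
      + ennreal (x powr - 2) * (\<integral>\<^sup>+m. ennreal ((norm (?T a2 m))\<^sup>2) \<partial>count_space UNIV)"
    by (simp add: nn_integral_add nn_integral_cmult)
  also have "\<dots> \<le> ennreal (x powr - 1) * ennreal (A * (\<Sum>k\<in>F. norm (a1 k))) + ennreal (x powr - 2) * ennreal (B\<^sup>2 * (\<Sum>k\<in>F. (norm (a2 k))\<^sup>2))"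
    by (intro add_mono mult_left_mono l1_bound l2 F) auto
  also have "\<dots> = ennreal (x powr - 1 * (A * (\<Sum>k\<in>F. norm (a1 k))) + x powr - 2 * (B\<^sup>2 * (\<Sum>k\<in>F. (norm (a2 k))\<^sup>2)))"
    using A by (intro ennreal_add_mult[symmetric]) (auto intro!: mult_nonneg_nonneg sum_nonneg)
  also have "x powr - 1 * (A * (\<Sum>k\<in>F. norm (a1 k))) + x powr - 2 * (B\<^sup>2 * (\<Sum>k\<in>F. (norm (a2 k))\<^sup>2)) =
      (\<Sum>k\<in>F. A * norm (a1 k) * x powr - 1 + B\<^sup>2 * (norm (a2 k))\<^sup>2 * x powr - 2)"
    by (simp add: sum.distrib sum_distrib_left mult_ac)
  also have "\<dots> \<le> (\<Sum>k\<in>F. A * norm (a k) * x powr - 1 * indicator {0..norm (a k) / A} x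
       + B\<^sup>2 * (norm (a k))\<^sup>2 * x powr - 2 * indicator {norm (a k) / A..} x)"
  proof (rule sum_mono)
    fix k
    show "A * norm (a1 k) * x powr - 1 + B\<^sup>2 * (norm (a2 k))\<^sup>2 * x powr - 2 \<le>
      A * norm (a k) * x powr - 1 * indicator {0..norm (a k) / A} x + B\<^sup>2 * (norm (a k))\<^sup>2 * x powr - 2 * indicator {norm (a k) / A..} x"
    proof (cases "A * x < norm (a k)")
      case True
      then have "x \<le> norm (a k) / A" using A by (simp add: pos_le_divide_eq mult.commute)
      then show ?thesis using True x A by (simp add: a1_def a2_def)
    next
      case False
      then have "norm (a k) / A \<le> x" using A by (simp add: pos_divide_le_eq mult.commute)
      then show ?thesis using False x A by (simp add: a1_def a2_def)
    qed
  qed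
  finally show ?thesis by (simp add: ennreal_leI)
qed

text \<open>Entries of size at most \<open>x / A\<close> contribute at most \<open>x\<close> to the
  output, by the row sums. Where the output is at least \<open>2 * x\<close>, the large entries must
  therefore contribute at least \<open>x\<close>, and the l^2 bound limits the number of such
  places.\<close>

lemma level_bound_upper:
  assumes F: "finite F" and x: "x > 0"
  shows "(\<integral>\<^sup>+m. indicator {0..norm (\<Sum>k\<in>F. K m k * a k) / 2} x \<partial>count_space UNIV) \<le>
    ennreal (\<Sum>k\<in>F. B\<^sup>2 * (norm (a k))\<^sup>2 * x powr - 2 * indicator {0..A * norm (a k)} x)"
proof -
  let ?T = "\<lambda>a m. \<Sum>k\<in>F. K m k * a k"
  define a1 where "a1 k = (if x < A * norm (a k) then a k else 0)" for k
  define a2 where "a2 k = (if x < A * norm (a k) then 0 else a k)" for k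
  have small: "norm (?T a2 m) \<le> x" for m
  proof -
    have "norm (?T a2 m) \<le> (\<Sum>k\<in>F. norm (K m k) * (x / A))"
    proof (rule order_trans[OF norm_sum sum_mono])
      fix k
      have "norm (a2 k) \<le> x / A" using x A by (auto simp: a2_def field_simps)
      then show "norm (K m k * a2 k) \<le> norm (K m k) * (x / A)"
        unfolding norm_mult by (rule mult_left_mono) simp
    qed
    also have "\<dots> = (\<Sum>k\<in>F. norm (K m k)) * (x / A)" by (rule sum_distrib_right[symmetric])
    also have "\<dots> \<le> A * (x / A)" using x A by (intro mult_right_mono linf F) auto
    finally show ?thesis using A by simp
  qed
  have "(\<integral>\<^sup>+m. indicator {0..norm (?T a m) / 2} x \<partial>count_space UNIV) \<le>
     (\<integral>\<^sup>+m. ennreal (x powr - 2) * ennreal ((norm (?T a1 m))\<^sup>2) \<partial>count_space UNIV)"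
  proof (rule nn_integral_mono)
    fix m
    show "indicator {0..norm (?T a m) / 2} x \<le> ennreal (x powr - 2) * ennreal ((norm (?T a1 m))\<^sup>2)"
    proof (cases "x \<le> norm (?T a m) / 2")
      case True
      have "?T a m = ?T a1 m + ?T a2 m"
        unfolding sum.distrib[symmetric] by (rule sum.cong) (auto simp: a1_def a2_def)
      then have "norm (?T a m) \<le> norm (?T a1 m) + norm (?T a2 m)" by (simp only: norm_triangle_ineq)
      with True small[of m] have "x \<le> norm (?T a1 m)" by linarith
      then have "x\<^sup>2 \<le> (norm (?T a1 m))\<^sup>2" using x by (intro power_mono) auto
      then have "1 \<le> x powr - 2 * (norm (?T a1 m))\<^sup>2" using x by (simp add: powr_minus field_simps powr_numeral)
      then have "1 \<le> ennreal (x powr - 2 * (norm (?T a1 m))\<^sup>2)" by (simp only: ennreal_ge_1)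
      also have "\<dots> = ennreal (x powr - 2) * ennreal ((norm (?T a1 m))\<^sup>2)"
        by (rule ennreal_mult') simp
      finally show ?thesis using True x by simp
    qed simp
  qed
  also have "\<dots> = ennreal (x powr - 2) * (\<integral>\<^sup>+m. ennreal ((norm (?T a1 m))\<^sup>2) \<partial>count_space UNIV)"
    by (simp add: nn_integral_cmult)
  also have "\<dots> \<le> ennreal (x powr - 2) * ennreal (B\<^sup>2 * (\<Sum>k\<in>F. (norm (a1 k))\<^sup>2))"
    by (intro mult_left_mono l2 F) auto
  also have "\<dots> = ennreal (x powr - 2 * (B\<^sup>2 * (\<Sum>k\<in>F. (norm (a1 k))\<^sup>2)))"
    by (rule ennreal_mult'[symmetric]) simp
  also have "x powr - 2 * (B\<^sup>2 * (\<Sum>k\<in>F. (norm (a1 k))\<^sup>2)) = (\<Sum>k\<in>F. B\<^sup>2 * (norm (a1 k))\<^sup>2 * x powr - 2)"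
    by (simp add: sum_distrib_left mult_ac)
  also have "\<dots> \<le> (\<Sum>k\<in>F. B\<^sup>2 * (norm (a k))\<^sup>2 * x powr - 2 * indicator {0..A * norm (a k)} x)"
    by (rule sum_mono) (use x in \<open>auto simp: a1_def\<close>)
  finally show ?thesis by (simp add: ennreal_leI)
qed

text \<open>The integrals of powers that arise between the exponents diverge as \<open>p\<close>
  tends to 1 or 2, where the direct l^1 and l^2 bounds take over. The value depends only on
  \<open>p\<close> and \<open>B\<close>, not on \<open>A\<close>.\<close>

definition interp_const :: "real \<Rightarrow> real" where
  "interp_const p = (if p = 1 then 1 else if p = 2 then B\<^sup>2
     else if p < 2 then 2 powr p * p * (1 / (p - 1) + B\<^sup>2 / (2 - p))
     else 2 powr p * p * (B\<^sup>2 / (p - 2)))"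

lemma interp_const_nonneg: "p \<ge> 1 \<Longrightarrow> interp_const p \<ge> 0"
  by (auto simp: interp_const_def intro!: mult_nonneg_nonneg add_nonneg_nonneg)

text \<open>The level bounds are integrated against \<open>x powr (p - 1)\<close> term by term, and
  every term yields the same power of \<open>A\<close>. Entries are assumed nonzero because the tail
  integral for \<open>p < 2\<close> starts at \<open>norm (a k) / A\<close>, which must be
  positive.\<close>

lemma interpolation_nonzero:
  assumes p: "p \<ge> 1" and F: "finite F" and nz: "\<And>k. k \<in> F \<Longrightarrow> a k \<noteq> 0"
  shows "(\<integral>\<^sup>+m. ennreal (norm (\<Sum>k\<in>F. K m k * a k) powr p) \<partial>count_space UNIV) \<le>
    ennreal (interp_const p * A powr \<bar>p - 2\<bar> * (\<Sum>k\<in>F. norm (a k) powr p))"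
proof -
  let ?f = "\<lambda>m. norm (\<Sum>k\<in>F. K m k * a k)"
  have pull: "(\<Sum>k\<in>F. u * norm (a k) powr p * c) = u * c * (\<Sum>k\<in>F. norm (a k) powr p)" for u c
    by (simp add: sum_distrib_left mult_ac)
  consider "p = 1" | "p = 2" | "1 < p" "p < 2" | "p > 2" using p by linarith
  then show ?thesis
  proof cases
    case 1
    then show ?thesis using l1_bound[OF F, of a] A by (simp add: interp_const_def)
  next
    case 2
    then show ?thesis using l2[OF F, of a] A by (simp add: interp_const_def powr_numeral)
  next
    case 3
    let ?g = "\<lambda>k x. (ennreal (A * norm (a k)) * (ennreal (x powr (p - 2)) * indicator {0..norm (a k) / A} x)
        + ennreal (B\<^sup>2 * (norm (a k))\<^sup>2) * (ennreal (x powr (p - 3)) * indicator {norm (a k) / A..} x)) :: ennreal"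
    have "(\<integral>\<^sup>+x. ennreal (x powr (p - 1)) * (\<integral>\<^sup>+m. indicator {0..?f m / 2} x \<partial>count_space UNIV) \<partial>lborel) \<le>
      (\<integral>\<^sup>+x. (\<Sum>k\<in>F. ?g k x) \<partial>lborel)"
    proof (rule nn_integral_mono)
      fix x :: real
      show "ennreal (x powr (p - 1)) * (\<integral>\<^sup>+m. indicator {0..?f m / 2} x \<partial>count_space UNIV) \<le> (\<Sum>k\<in>F. ?g k x)"
      proof (cases "x > 0")
        case True
        have "ennreal (x powr (p - 1)) * (\<integral>\<^sup>+m. indicator {0..?f m / 2} x \<partial>count_space UNIV) \<le>
          ennreal (x powr (p - 1)) * ennreal (\<Sum>k\<in>F. A * norm (a k) * x powr - 1 * indicator {0..norm (a k) / A} x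
            + B\<^sup>2 * (norm (a k))\<^sup>2 * x powr - 2 * indicator {norm (a k) / A..} x)"
          by (intro mult_left_mono level_bound_lower F True) simp
        also have "\<dots> = ennreal (\<Sum>k\<in>F. x powr (p - 1) * (A * norm (a k) * x powr - 1 * indicator {0..norm (a k) / A} x
            + B\<^sup>2 * (norm (a k))\<^sup>2 * x powr - 2 * indicator {norm (a k) / A..} x))"
          by (simp add: ennreal_mult'[symmetric] sum_distrib_left)
        also have "\<dots> = (\<Sum>k\<in>F. ennreal (x powr (p - 1) * (A * norm (a k) * x powr - 1 * indicator {0..norm (a k) / A} x
            + B\<^sup>2 * (norm (a k))\<^sup>2 * x powr - 2 * indicator {norm (a k) / A..} x)))"
          using A by (intro sum_ennreal[symmetric]) auto
        also have "\<dots> = (\<Sum>k\<in>F. ?g k x)"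
        proof (rule sum.cong[OF refl])
          fix k
          have "x powr (p - 1) * x powr - 1 = x powr (p - 2)" "x powr (p - 1) * x powr - 2 = x powr (p - 3)"
            unfolding powr_add[symmetric] by simp_all
          then have "x powr (p - 1) * (A * norm (a k) * x powr - 1 * indicator {0..norm (a k) / A} x
              + B\<^sup>2 * (norm (a k))\<^sup>2 * x powr - 2 * indicator {norm (a k) / A..} x) =
             A * norm (a k) * (x powr (p - 2) * indicator {0..norm (a k) / A} x) + B\<^sup>2 * (norm (a k))\<^sup>2 * (x powr (p - 3) * indicator {norm (a k) / A..} x)"
          proof -
            have "P * (c * u * i + e * w * j) = c * (X * i) + e * (Y * j)"
              if "P * u = X" "P * w = Y" for P c u i e w j X Y :: real
              unfolding that[symmetric] by (simp add: algebra_simps)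
            then show "x powr (p - 1) * x powr - 1 = x powr (p - 2) \<Longrightarrow> x powr (p - 1) * x powr - 2 = x powr (p - 3) \<Longrightarrow> ?thesis"
              by blast
          qed
          then show "ennreal (x powr (p - 1) * (A * norm (a k) * x powr - 1 * indicator {0..norm (a k) / A} x
              + B\<^sup>2 * (norm (a k))\<^sup>2 * x powr - 2 * indicator {norm (a k) / A..} x)) = ?g k x"
            unfolding ennreal_mult_indicator[symmetric]
            by (simp only:) (rule ennreal_add_mult, use A in auto)
        qed
        finally show ?thesis .
      next
        \<comment> \<open>For negative \<open>x\<close> the intervals are empty. At
          \<open>x = 0\<close> the count may be infinite, but the factor
          \<open>0 powr (p - 1)\<close> is zero.\<close>
        case False
        then show ?thesis
        proof (cases "x = 0")
          case nz: False
          then have "(\<integral>\<^sup>+m. indicator {0..?f m / 2} x \<partial>count_space UNIV) = (0::ennreal)" using False by simp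
          then show ?thesis by simp
        qed simp
      qed
    qed
    also have "\<dots> = (\<Sum>k\<in>F. \<integral>\<^sup>+x. ?g k x \<partial>lborel)"
      by (rule nn_integral_sum) auto
    also have "\<dots> = (\<Sum>k\<in>F. ennreal (A powr (2 - p) * norm (a k) powr p * (1 / (p - 1) + B\<^sup>2 / (2 - p))))"
    proof (rule sum.cong[OF refl])
      fix k assume k: "k \<in> F"
      define b where "b = norm (a k)"
      have b: "b > 0" using nz[OF k] by (simp add: b_def)
      have "(\<integral>\<^sup>+x. ?g k x \<partial>lborel) = ennreal (A * b) * ennreal ((b / A) powr (p - 2 + 1) / (p - 2 + 1))
         + ennreal (B\<^sup>2 * b\<^sup>2) * ennreal ((b / A) powr (p - 3 + 1) / - (p - 3 + 1))"
        unfolding b_def[symmetric] using 3 b A nn_integral_powr_from_0[of "p - 2" "b / A"] nn_integral_powr_to_inf[of "p - 3" "b / A"]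
        by (simp add: nn_integral_add nn_integral_cmult)
      also have "\<dots> = ennreal (A * b * ((b / A) powr (p - 1) / (p - 1)) + B\<^sup>2 * b\<^sup>2 * ((b / A) powr (p - 2) / (2 - p)))"
        using 3 b A by (simp add: ennreal_mult'[symmetric] ennreal_plus[symmetric] del: ennreal_plus)
      also have "A * b * ((b / A) powr (p - 1) / (p - 1)) + B\<^sup>2 * b\<^sup>2 * ((b / A) powr (p - 2) / (2 - p)) =
          A powr (2 - p) * b powr p * (1 / (p - 1) + B\<^sup>2 / (2 - p))"
      proof -
        have "A * b * (b / A) powr (p - 1) = A powr (2 - p) * b powr p"
        proof -
          have "b powr p = b powr (p - 1) * b" "A powr (2 - p) = A / A powr (p - 1)"
            using b A powr_add[of b "p - 1" 1] powr_diff[of A 1 "p - 1"] by simp_all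
          then show ?thesis using A b by (simp add: powr_divide)
        qed
        moreover have "b\<^sup>2 * (b / A) powr (p - 2) = A powr (2 - p) * b powr p"
        proof -
          have "b powr p = b powr (p - 2) * b\<^sup>2" "A powr (2 - p) = 1 / A powr (p - 2)"
            using b A powr_add[of b "p - 2" 2] powr_minus_divide[of A "p - 2"] by (simp_all add: powr_numeral)
          then show ?thesis using A b by (simp add: powr_divide)
        qed
        ultimately show ?thesis by (simp add: distrib_left mult.assoc times_divide_eq_right[symmetric] del: times_divide_eq_right)
            (simp add: mult_ac)
      qed
      finally show "(\<integral>\<^sup>+x. ?g k x \<partial>lborel) = ennreal (A powr (2 - p) * norm (a k) powr p * (1 / (p - 1) + B\<^sup>2 / (2 - p)))"
        by (simp add: b_def)
    qed
    also have "\<dots> = ennreal (\<Sum>k\<in>F. A powr (2 - p) * norm (a k) powr p * (1 / (p - 1) + B\<^sup>2 / (2 - p)))"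
      using 3 by (intro sum_ennreal) (auto intro!: mult_nonneg_nonneg add_nonneg_nonneg)
    finally have "(\<integral>\<^sup>+m. ennreal (?f m powr p) \<partial>count_space UNIV) \<le>
        ennreal (2 powr p * p) * ennreal (\<Sum>k\<in>F. A powr (2 - p) * norm (a k) powr p * (1 / (p - 1) + B\<^sup>2 / (2 - p)))"
      using 3 by (subst layer_cake) (auto intro: mult_left_mono)
    also have "\<dots> = ennreal (2 powr p * p * (\<Sum>k\<in>F. A powr (2 - p) * norm (a k) powr p * (1 / (p - 1) + B\<^sup>2 / (2 - p))))"
      using 3 by (intro ennreal_mult'[symmetric]) auto
    also have "2 powr p * p * (\<Sum>k\<in>F. A powr (2 - p) * norm (a k) powr p * (1 / (p - 1) + B\<^sup>2 / (2 - p))) =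
        interp_const p * A powr \<bar>p - 2\<bar> * (\<Sum>k\<in>F. norm (a k) powr p)"
      unfolding pull using 3 by (simp add: interp_const_def)
    finally show ?thesis .
  next
    case 4
    let ?g = "\<lambda>k x. (ennreal (B\<^sup>2 * (norm (a k))\<^sup>2) * (ennreal (x powr (p - 3)) * indicator {0..A * norm (a k)} x)) :: ennreal"
    have "(\<integral>\<^sup>+x. ennreal (x powr (p - 1)) * (\<integral>\<^sup>+m. indicator {0..?f m / 2} x \<partial>count_space UNIV) \<partial>lborel) \<le>
      (\<integral>\<^sup>+x. (\<Sum>k\<in>F. ?g k x) \<partial>lborel)"
    proof (rule nn_integral_mono)
      fix x :: real
      show "ennreal (x powr (p - 1)) * (\<integral>\<^sup>+m. indicator {0..?f m / 2} x \<partial>count_space UNIV) \<le> (\<Sum>k\<in>F. ?g k x)"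
      proof (cases "x > 0")
        case True
        have "ennreal (x powr (p - 1)) * (\<integral>\<^sup>+m. indicator {0..?f m / 2} x \<partial>count_space UNIV) \<le>
          ennreal (x powr (p - 1)) * ennreal (\<Sum>k\<in>F. B\<^sup>2 * (norm (a k))\<^sup>2 * x powr - 2 * indicator {0..A * norm (a k)} x)"
          by (intro mult_left_mono level_bound_upper F True) simp
        also have "\<dots> = ennreal (\<Sum>k\<in>F. x powr (p - 1) * (B\<^sup>2 * (norm (a k))\<^sup>2 * x powr - 2 * indicator {0..A * norm (a k)} x))"
          by (simp add: ennreal_mult'[symmetric] sum_distrib_left)
        also have "\<dots> = (\<Sum>k\<in>F. ennreal (x powr (p - 1) * (B\<^sup>2 * (norm (a k))\<^sup>2 * x powr - 2 * indicator {0..A * norm (a k)} x)))"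
          by (intro sum_ennreal[symmetric]) auto
        also have "\<dots> = (\<Sum>k\<in>F. ?g k x)"
        proof (rule sum.cong[OF refl])
          fix k
          have "x powr (p - 1) * x powr - 2 = x powr (p - 3)"
            unfolding powr_add[symmetric] by simp
          then have "x powr (p - 1) * (B\<^sup>2 * (norm (a k))\<^sup>2 * x powr - 2 * indicator {0..A * norm (a k)} x) =
             B\<^sup>2 * (norm (a k))\<^sup>2 * (x powr (p - 3) * indicator {0..A * norm (a k)} x)"
          proof -
            have "P * (e * w * j) = e * (Y * j)" if "P * w = Y" for P e w j Y :: real
              unfolding that[symmetric] by (simp add: algebra_simps)
            then show "x powr (p - 1) * x powr - 2 = x powr (p - 3) \<Longrightarrow> ?thesis"
              by blast
          qed
          then show "ennreal (x powr (p - 1) * (B\<^sup>2 * (norm (a k))\<^sup>2 * x powr - 2 * indicator {0..A * norm (a k)} x)) = ?g k x"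
            unfolding ennreal_mult_indicator[symmetric]
            by (simp only:) (rule ennreal_mult', auto)
        qed
        finally show ?thesis .
      next
        case False
        then show ?thesis
        proof (cases "x = 0")
          case nz: False
          then have "(\<integral>\<^sup>+m. indicator {0..?f m / 2} x \<partial>count_space UNIV) = (0::ennreal)" using False by simp
          then show ?thesis by simp
        qed simp
      qed
    qed
    also have "\<dots> = (\<Sum>k\<in>F. \<integral>\<^sup>+x. ?g k x \<partial>lborel)"
      by (rule nn_integral_sum) auto
    also have "\<dots> = (\<Sum>k\<in>F. ennreal (A powr (p - 2) * norm (a k) powr p * (B\<^sup>2 / (p - 2))))"
    proof (rule sum.cong[OF refl])
      fix k assume k: "k \<in> F"
      define b where "b = norm (a k)"
      have b: "b > 0" using nz[OF k] by (simp add: b_def)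
      have "(\<integral>\<^sup>+x. ?g k x \<partial>lborel) = ennreal (B\<^sup>2 * b\<^sup>2) * ennreal ((A * b) powr (p - 3 + 1) / (p - 3 + 1))"
        unfolding b_def[symmetric] using 4 b A nn_integral_powr_from_0[of "p - 3" "A * b"]
        by (simp add: nn_integral_cmult)
      also have "\<dots> = ennreal (B\<^sup>2 * b\<^sup>2 * ((A * b) powr (p - 2) / (p - 2)))"
        using 4 b A by (simp add: ennreal_mult'[symmetric])
      also have "B\<^sup>2 * b\<^sup>2 * ((A * b) powr (p - 2) / (p - 2)) = A powr (p - 2) * b powr p * (B\<^sup>2 / (p - 2))"
      proof -
        have "b powr p = b powr (p - 2) * b\<^sup>2"
          using b powr_add[of b "p - 2" 2] by (simp add: powr_numeral)
        then show ?thesis using A b by (simp add: powr_mult)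
      qed
      finally show "(\<integral>\<^sup>+x. ?g k x \<partial>lborel) = ennreal (A powr (p - 2) * norm (a k) powr p * (B\<^sup>2 / (p - 2)))"
        by (simp add: b_def)
    qed
    also have "\<dots> = ennreal (\<Sum>k\<in>F. A powr (p - 2) * norm (a k) powr p * (B\<^sup>2 / (p - 2)))"
      using 4 by (intro sum_ennreal) auto
    finally have "(\<integral>\<^sup>+m. ennreal (?f m powr p) \<partial>count_space UNIV) \<le>
        ennreal (2 powr p * p) * ennreal (\<Sum>k\<in>F. A powr (p - 2) * norm (a k) powr p * (B\<^sup>2 / (p - 2)))"
      using 4 by (subst layer_cake) (auto intro: mult_left_mono)
    also have "\<dots> = ennreal (2 powr p * p * (\<Sum>k\<in>F. A powr (p - 2) * norm (a k) powr p * (B\<^sup>2 / (p - 2))))"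
      using 4 by (intro ennreal_mult'[symmetric]) auto
    also have "2 powr p * p * (\<Sum>k\<in>F. A powr (p - 2) * norm (a k) powr p * (B\<^sup>2 / (p - 2))) =
        interp_const p * A powr \<bar>p - 2\<bar> * (\<Sum>k\<in>F. norm (a k) powr p)"
      unfolding pull using 4 by (simp add: interp_const_def)
    finally show ?thesis .
  qed
qed

lemma interpolation_finite:
  assumes p: "p \<ge> 1" and F: "finite F"
  shows "(\<integral>\<^sup>+m. ennreal (norm (\<Sum>k\<in>F. K m k * a k) powr p) \<partial>count_space UNIV) \<le>
    ennreal (interp_const p * A powr \<bar>p - 2\<bar> * (\<Sum>k\<in>F. norm (a k) powr p))"
proof -
  let ?F = "{k \<in> F. a k \<noteq> 0}"
  have 1: "(\<Sum>k\<in>F. K m k * a k) = (\<Sum>k\<in>?F. K m k * a k)" for m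
    using F by (intro sum.mono_neutral_right) auto
  have 2: "(\<Sum>k\<in>F. norm (a k) powr p) = (\<Sum>k\<in>?F. norm (a k) powr p)"
    using F by (intro sum.mono_neutral_right) auto
  show ?thesis unfolding 1 2 by (rule interpolation_nonzero) (use p F in auto)
qed

lemma filterlim_initial_segments:
  "filterlim (\<lambda>n. {k::'k. to_nat k < n}) (finite_subsets_at_top UNIV) sequentially"
  unfolding filterlim_finite_subsets_at_top
proof (intro allI impI)
  fix X :: "'k set" assume X: "finite X \<and> X \<subseteq> UNIV"
  have fin: "finite {k::'k. to_nat k < n}" for n
    by (rule finite_imageD[of to_nat]) (auto intro: finite_subset[of _ "{..<n}"] inj_on_subset[OF inj_to_nat])
  have "to_nat k < n" if "k \<in> X" "n \<ge> Suc (Max (to_nat ` X))" for k n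
  proof -
    have "to_nat k \<le> Max (to_nat ` X)" using X that(1) by (intro Max_ge) auto
    then show ?thesis using that(2) by linarith
  qed
  then show "\<forall>\<^sub>F n in sequentially. finite {k::'k. to_nat k < n} \<and> X \<subseteq> {k. to_nat k < n} \<and> {k. to_nat k < n} \<subseteq> UNIV"
    using fin by (intro eventually_sequentiallyI[of "Suc (Max (to_nat ` X))"]) blast
qed

text \<open>Fatou's lemma along the initial segments of an enumeration: \<open>has_sum\<close> gives
  convergence at each \<open>m\<close>, and the finite estimate is uniform in the segment.\<close>

lemma interpolation:
  assumes p: "p \<ge> 1" and b: "\<And>m. ((\<lambda>k. K m k * a k) has_sum b m) UNIV"
  shows "(\<integral>\<^sup>+m. ennreal (norm (b m) powr p) \<partial>count_space UNIV) \<le>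
    ennreal (interp_const p * A powr \<bar>p - 2\<bar>) * (\<integral>\<^sup>+k. ennreal (norm (a k) powr p) \<partial>count_space UNIV)"
proof -
  let ?F = "\<lambda>n. {k::'k. to_nat k < n}"
  have fin: "finite (?F n)" for n
    by (rule finite_imageD[of to_nat]) (auto intro: finite_subset[of _ "{..<n}"] inj_on_subset[OF inj_to_nat])
  let ?C = "ennreal (interp_const p * A powr \<bar>p - 2\<bar>)"
  have lim: "(\<lambda>n. \<Sum>k\<in>?F n. K m k * a k) \<longlonglongrightarrow> b m" for m
    using b[of m] filterlim_initial_segments unfolding has_sum_def by (rule filterlim_compose)
  have lim': "(\<lambda>n. ennreal (norm (\<Sum>k\<in>?F n. K m k * a k) powr p)) \<longlonglongrightarrow> ennreal (norm (b m) powr p)" for m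
    using p by (intro tendsto_ennrealI tendsto_powr' tendsto_norm lim tendsto_const) auto
  have "(\<integral>\<^sup>+m. ennreal (norm (b m) powr p) \<partial>count_space UNIV) =
      (\<integral>\<^sup>+m. liminf (\<lambda>n. ennreal (norm (\<Sum>k\<in>?F n. K m k * a k) powr p)) \<partial>count_space UNIV)"
    by (rule nn_integral_cong, rule lim_imp_Liminf[OF sequentially_bot, symmetric], rule lim')
  also have "\<dots> \<le> liminf (\<lambda>n. \<integral>\<^sup>+m. ennreal (norm (\<Sum>k\<in>?F n. K m k * a k) powr p) \<partial>count_space UNIV)"
    by (rule nn_integral_liminf) simp
  also have "\<dots> \<le> liminf (\<lambda>n. ?C * (\<integral>\<^sup>+k. ennreal (norm (a k) powr p) \<partial>count_space UNIV))"
  proof (intro Liminf_mono always_eventually allI)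
    fix n
    have "(\<integral>\<^sup>+m. ennreal (norm (\<Sum>k\<in>?F n. K m k * a k) powr p) \<partial>count_space UNIV) \<le>
        ennreal (interp_const p * A powr \<bar>p - 2\<bar> * (\<Sum>k\<in>?F n. norm (a k) powr p))"
      by (rule interpolation_finite[OF p fin])
    also have "\<dots> = ?C * (\<Sum>k\<in>?F n. ennreal (norm (a k) powr p))"
      using interp_const_nonneg[OF p] by (simp add: ennreal_mult' sum_ennreal)
    also have "(\<Sum>k\<in>?F n. ennreal (norm (a k) powr p)) = (\<integral>\<^sup>+k. ennreal (norm (a k) powr p) * indicator (?F n) k \<partial>count_space UNIV)"
      by (subst nn_integral_count_space_indicator[symmetric]) (auto simp: nn_integral_count_space_finite fin)
    also have "\<dots> \<le> (\<integral>\<^sup>+k. ennreal (norm (a k) powr p) \<partial>count_space UNIV)"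
      by (intro nn_integral_mono) (simp add: indicator_def)
    finally show "(\<integral>\<^sup>+m. ennreal (norm (\<Sum>k\<in>?F n. K m k * a k) powr p) \<partial>count_space UNIV) \<le>
       ?C * (\<integral>\<^sup>+k. ennreal (norm (a k) powr p) \<partial>count_space UNIV)" by (simp add: mult_left_mono)
  qed
  finally show ?thesis by (simp add: Liminf_const)
qed

end

subsection \<open>The kernel of the localized Schroedinger propagator\<close>

lemma nn_integral_count_space_le_finite:
  fixes f :: "'k::countable \<Rightarrow> ennreal"
  assumes "\<And>F. finite F \<Longrightarrow> (\<Sum>k\<in>F. f k) \<le> c"
  shows "(\<integral>\<^sup>+k. f k \<partial>count_space UNIV) \<le> c"
proof -
  let ?F = "\<lambda>n. {k::'k. to_nat k < n}"
  have fin: "finite (?F n)" for n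
    by (rule finite_imageD[of to_nat]) (auto intro: finite_subset[of _ "{..<n}"] inj_on_subset[OF inj_to_nat])
  have lim: "(\<lambda>n. f k * indicator (?F n) k) \<longlonglongrightarrow> f k" for k
    by (rule tendsto_eventually, rule eventually_sequentiallyI[of "Suc (to_nat k)"]) auto
  have "(\<integral>\<^sup>+k. f k \<partial>count_space UNIV) = (\<integral>\<^sup>+k. liminf (\<lambda>n. f k * indicator (?F n) k) \<partial>count_space UNIV)"
    by (rule nn_integral_cong, rule lim_imp_Liminf[OF sequentially_bot, symmetric], rule lim)
  also have "\<dots> \<le> liminf (\<lambda>n. \<integral>\<^sup>+k. f k * indicator (?F n) k \<partial>count_space UNIV)"
    by (rule nn_integral_liminf) simp
  also have "\<dots> \<le> liminf (\<lambda>n::nat. c)"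
  proof (intro Liminf_mono always_eventually allI)
    fix n
    have "(\<integral>\<^sup>+k. f k * indicator (?F n) k \<partial>count_space UNIV) = (\<Sum>k\<in>?F n. f k)"
      by (subst nn_integral_count_space_indicator[symmetric]) (auto simp: nn_integral_count_space_finite fin)
    also have "\<dots> \<le> c" by (rule assms[OF fin])
    finally show "(\<integral>\<^sup>+k. f k * indicator (?F n) k \<partial>count_space UNIV) \<le> c" .
  qed
  finally show ?thesis by (simp add: Liminf_const)
qed

lemma integral_cube_trig_poly:
  fixes a :: "int^'n::finite \<Rightarrow> complex"
  assumes L: "L > 0" and F: "finite F"
  shows "(\<integral>x. indicator (cube L) x * (norm (\<Sum>k\<in>F. a k * phase (- lat L k) 0 x))\<^sup>2 \<partial>lborel) = L ^ CARD('n) * (\<Sum>k\<in>F. (norm (a k))\<^sup>2)"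
proof -
  let ?S = "\<lambda>x. \<Sum>k\<in>F. a k * phase (- lat L k) 0 x"
  have "complex_of_real (\<integral>x. indicator (cube L) x * (norm (?S x))\<^sup>2 \<partial>lborel) =
      (\<integral>x. complex_of_real (indicator (cube L) x * (norm (?S x))\<^sup>2) \<partial>lborel)"
    by (rule integral_complex_of_real[symmetric])
  also have "\<dots> = (\<integral>x. (\<Sum>k\<in>F. \<Sum>l\<in>F. a k * cnj (a l) * (indicator (cube L) x *\<^sub>R phase (lat L (l - k)) 0 x)) \<partial>lborel)"
  proof (rule Bochner_Integration.integral_cong[OF refl])
    fix x
    have "complex_of_real ((norm (?S x))\<^sup>2) = (\<Sum>k\<in>F. \<Sum>l\<in>F. a k * cnj (a l) * phase (lat L (l - k)) 0 x)"
      unfolding complex_norm_square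
      by (simp add: sum_product cnj_phase mult_ac phase_mult_phase)
    then show "complex_of_real (indicator (cube L) x * (norm (?S x))\<^sup>2) =
       (\<Sum>k\<in>F. \<Sum>l\<in>F. a k * cnj (a l) * (indicator (cube L) x *\<^sub>R phase (lat L (l - k)) 0 x))"
      by (cases "x \<in> cube L") simp_all
  qed
  also have "\<dots> = (\<Sum>k\<in>F. \<Sum>l\<in>F. a k * cnj (a l) * (\<integral>x. indicator (cube L) x *\<^sub>R phase (lat L (l - k)) 0 x \<partial>lborel))"
  proof -
    have i: "integrable lborel (\<lambda>x::real^'n. a k * cnj (a l) * (indicator (cube L) x *\<^sub>R phase (lat L (l - k)) 0 x))" for k l
      by (intro integrable_mult_right borel_integrable_compact compact_cube continuous_intros)
    show ?thesis
      by (simp only: Bochner_Integration.integral_sum Bochner_Integration.integrable_sum i integral_mult_right_zero)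
  qed
  also have "\<dots> = (\<Sum>k\<in>F. a k * cnj (a k) * of_real (L ^ CARD('n)))"
    unfolding integral_cube_phase[OF L] using F
    by (intro sum.cong refl) (simp add: if_distrib[where f = "\<lambda>x. _ * x"] cong: if_cong)
  also have "\<dots> = complex_of_real (L ^ CARD('n) * (\<Sum>k\<in>F. (norm (a k))\<^sup>2))"
    by (simp add: sum_distrib_left complex_norm_square[symmetric] mult.commute)
  finally show ?thesis by (simp only: of_real_eq_iff)
qed

lemma norm_phase_sum_le: "norm (\<Sum>k\<in>F. a k * phase (y k) 0 x) \<le> (\<Sum>k\<in>F. norm (a k))"
  by (rule order_trans[OF norm_sum]) (simp add: norm_mult)

text \<open>The left side collects Fourier coefficients of \<open>g\<close> times a trigonometric
  polynomial. Bessel's inequality, the sup bound \<open>B\<close> and orthogonality give the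
  estimate; only the modulus of \<open>g\<close> enters, so a unimodular factor such as the chirp
  costs nothing.\<close>

lemma fcoef_convolution_l2:
  fixes g :: "real^'n::finite \<Rightarrow> complex"
  assumes L: "L > 0" and gc: "continuous_on UNIV g" and gs: "\<And>x. g x \<noteq> 0 \<Longrightarrow> x \<in> cube L"
    and B: "\<And>x. norm (g x) \<le> B" and F: "finite F"
  shows "(\<integral>\<^sup>+m. ennreal ((norm (\<Sum>k\<in>F. fcoef L g (k - m) * a k))\<^sup>2) \<partial>count_space UNIV) \<le> ennreal (B\<^sup>2 * (\<Sum>k\<in>F. (norm (a k))\<^sup>2))"
proof (rule nn_integral_count_space_le_finite)
  fix M :: "(int^'n) set" assume M: "finite M"
  let ?V = "L ^ CARD('n)"
  have V: "?V > 0" using L by simp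
  define h where "h x = g x * (\<Sum>k\<in>F. a k * phase (- lat L k) 0 x)" for x
  have B0: "B \<ge> 0" using order_trans[OF norm_ge_zero B] .
  have hc: "continuous_on UNIV h" unfolding h_def by (intro continuous_intros gc)
  have hB: "norm (h x) \<le> B * (\<Sum>k\<in>F. norm (a k))" for x
    unfolding h_def norm_mult by (intro mult_mono B norm_phase_sum_le B0) simp
  have fc: "fourier g \<xi> = (\<integral>x. indicator (cube L) x *\<^sub>R (g x * phase (- \<xi>) 0 x) \<partial>lborel)" for \<xi>
    by (rule fourier_cube) (rule gs)
  \<comment> \<open>The kernel has argument \<open>k - m\<close>, so the coefficient of
    \<open>h\<close> is taken at \<open>- m\<close>; the reindexing by \<open>uminus\<close> below
    restores the form needed for Bessel's inequality.\<close>
  have coef: "(\<Sum>k\<in>F. fcoef L g (k - m) * a k) = (\<integral>x. indicator (cube L) x *\<^sub>R (h x * phase (- lat L (- m)) 0 x) \<partial>lborel) / of_real ?V" for m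
  proof -
    have i: "integrable lborel (\<lambda>x::real^'n. indicator (cube L) x *\<^sub>R (g x * phase (- lat L (k - m)) 0 x) * a k)" for k
      by (intro integrable_mult_left borel_integrable_compact compact_cube continuous_intros continuous_on_subset[OF gc]) auto
    have "(\<Sum>k\<in>F. fcoef L g (k - m) * a k) = (\<Sum>k\<in>F. (\<integral>x. indicator (cube L) x *\<^sub>R (g x * phase (- lat L (k - m)) 0 x) * a k \<partial>lborel)) / of_real ?V"
      unfolding fcoef_def fc by (simp only: integral_mult_left_zero sum_divide_distrib times_divide_eq_left)
    also have "(\<Sum>k\<in>F. (\<integral>x. indicator (cube L) x *\<^sub>R (g x * phase (- lat L (k - m)) 0 x) * a k \<partial>lborel)) =
      (\<integral>x. (\<Sum>k\<in>F. indicator (cube L) x *\<^sub>R (g x * phase (- lat L (k - m)) 0 x) * a k) \<partial>lborel)"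
      by (rule Bochner_Integration.integral_sum[symmetric]) (rule i)
    also have "\<dots> = (\<integral>x. indicator (cube L) x *\<^sub>R (h x * phase (- lat L (- m)) 0 x) \<partial>lborel)"
    proof (rule Bochner_Integration.integral_cong[OF refl])
      fix x
      have "phase (- lat L (k - m)) 0 x = phase (- lat L k) 0 x * phase (- lat L (- m)) 0 x" for k
        by (simp add: phase_mult_phase)
      then show "(\<Sum>k\<in>F. indicator (cube L) x *\<^sub>R (g x * phase (- lat L (k - m)) 0 x) * a k) =
          indicator (cube L) x *\<^sub>R (h x * phase (- lat L (- m)) 0 x)"
        by (simp add: h_def sum_distrib_left sum_distrib_right scaleR_sum_right mult_ac)
    qed
    finally show ?thesis .
  qed
  have "(\<Sum>m\<in>M. (norm (\<Sum>k\<in>F. fcoef L g (k - m) * a k))\<^sup>2) =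
      (\<Sum>m\<in>M. (norm (\<integral>x. indicator (cube L) x *\<^sub>R (h x * phase (- lat L (- m)) 0 x) \<partial>lborel))\<^sup>2) / ?V\<^sup>2"
    unfolding coef using L by (simp add: norm_divide norm_power power_divide sum_divide_distrib)
  also have "(\<Sum>m\<in>M. (norm (\<integral>x. indicator (cube L) x *\<^sub>R (h x * phase (- lat L (- m)) 0 x) \<partial>lborel))\<^sup>2) =
      (\<Sum>n\<in>uminus ` M. (norm (\<integral>x. indicator (cube L) x *\<^sub>R (h x * phase (- lat L n) 0 x) \<partial>lborel))\<^sup>2)"
    by (subst sum.reindex) (auto simp: inj_on_def)
  also have "\<dots> \<le> ?V * (\<integral>x. indicator (cube L) x * (norm (h x))\<^sup>2 \<partial>lborel)"
    by (rule bessel_cube[OF L _ _ hB]) (use M hc in \<open>auto intro: borel_measurable_continuous_onI\<close>)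
  also have "(\<integral>x. indicator (cube L) x * (norm (h x))\<^sup>2 \<partial>lborel) \<le>
      (\<integral>x. B\<^sup>2 * (indicator (cube L) x * (norm (\<Sum>k\<in>F. a k * phase (- lat L k) 0 x))\<^sup>2) \<partial>lborel)"
  proof (rule Bochner_Integration.integral_mono)
    have "integrable lborel (\<lambda>x. indicator (cube L) x *\<^sub>R (norm (h x))\<^sup>2)"
      by (intro borel_integrable_compact compact_cube continuous_intros continuous_on_subset[OF hc]) auto
    then show "integrable lborel (\<lambda>x. indicator (cube L) x * (norm (h x))\<^sup>2)" by simp
    have "integrable lborel (\<lambda>x::real^'n. indicator (cube L) x *\<^sub>R (norm (\<Sum>k\<in>F. a k * phase (- lat L k) 0 x))\<^sup>2)"
      by (intro borel_integrable_compact compact_cube continuous_intros)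
    then show "integrable lborel (\<lambda>x::real^'n. B\<^sup>2 * (indicator (cube L) x * (norm (\<Sum>k\<in>F. a k * phase (- lat L k) 0 x))\<^sup>2))" by simp
    fix x
    have "(norm (h x))\<^sup>2 \<le> B\<^sup>2 * (norm (\<Sum>k\<in>F. a k * phase (- lat L k) 0 x))\<^sup>2"
      unfolding h_def norm_mult power_mult_distrib using B[of x] by (intro mult_right_mono power_mono) auto
    then show "indicator (cube L) x * (norm (h x))\<^sup>2 \<le> B\<^sup>2 * (indicator (cube L) x * (norm (\<Sum>k\<in>F. a k * phase (- lat L k) 0 x))\<^sup>2)"
      by (cases "x \<in> cube L") simp_all
  qed
  also have "(\<integral>x. B\<^sup>2 * (indicator (cube L) x * (norm (\<Sum>k\<in>F. a k * phase (- lat L k) 0 x))\<^sup>2) \<partial>lborel) = B\<^sup>2 * (?V * (\<Sum>k\<in>F. (norm (a k))\<^sup>2))"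
    by (simp only: integral_mult_right_zero integral_cube_trig_poly[OF L F])
  finally have "(\<Sum>m\<in>M. (norm (\<Sum>k\<in>F. fcoef L g (k - m) * a k))\<^sup>2) \<le> ?V * (B\<^sup>2 * (?V * (\<Sum>k\<in>F. (norm (a k))\<^sup>2))) / ?V\<^sup>2"
    using V by (simp add: divide_right_mono mult_left_mono)
  also have "\<dots> = B\<^sup>2 * (\<Sum>k\<in>F. (norm (a k))\<^sup>2)" using L by (simp add: power2_eq_square)
  finally show "(\<Sum>m\<in>M. ennreal ((norm (\<Sum>k\<in>F. fcoef L g (k - m) * a k))\<^sup>2)) \<le> ennreal (B\<^sup>2 * (\<Sum>k\<in>F. (norm (a k))\<^sup>2))"
    by (simp add: sum_ennreal ennreal_leI)
qed

section \<open>The l^1 norm of the coefficients of a chirp\<close>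

lemma partial_derivs_support:
  assumes A: "closed A" and g: "smooth g" and s: "\<And>x. g x \<noteq> 0 \<Longrightarrow> x \<in> A"
  shows "partial_derivs \<alpha> g x \<noteq> 0 \<Longrightarrow> x \<in> A"
proof (induction \<alpha> arbitrary: x)
  case (Cons i \<alpha>)
  show ?case
  proof (rule ccontr)
    assume x: "x \<notin> A"
    have "((\<lambda>x. 0::complex) has_derivative (\<lambda>h. 0)) (at x)" by simp
    then have "(partial_derivs \<alpha> g has_derivative (\<lambda>h. 0)) (at x)"
      by (rule has_derivative_transform_within_open[of _ _ _ _ "- A"]) (use A x Cons.IH in auto)
    then have "partial_derivs (i # \<alpha>) g x = 0"
      unfolding partial_derivs_Cons by (simp add: partial_deriv_unique)
    then show False using Cons.prems by simp
  qed
qed (use s in simp)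

lemma fourier_partial_derivs_replicate:
  assumes "schwartz \<phi>"
  shows "fourier (partial_derivs (replicate K i) \<phi>) \<xi> = (2 * pi * \<i> * of_real (\<xi> $ i)) ^ K * fourier \<phi> \<xi>"
proof (induction K)
  case (Suc K)
  have "schwartz (partial_derivs (replicate K i) \<phi>)"
    using assms by (induction K) (auto simp: partial_derivs_Cons intro: schwartz_op_schwartz[OF schwartz_op_partial_deriv])
  then show ?case using Suc by (simp add: partial_derivs_Cons fourier_partial_deriv mult.assoc)
qed simp

lemma schwartz_partial_derivs: "schwartz \<phi> \<Longrightarrow> schwartz (partial_derivs \<alpha> \<phi>)"
  by (induction \<alpha>) (auto simp: partial_derivs_Cons intro: schwartz_op_schwartz[OF schwartz_op_partial_deriv])

text \<open>The largest coordinate controls the norm up to the dimension, and since the base is at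
  least one the exponent may be raised to \<open>2 * (CARD('n) + 1)\<close>. This even exponent is
  what squared coefficients of pure derivatives of order d + 1 produce.\<close>

lemma weight_bound:
  fixes n :: "int^'n::finite"
  assumes S: "S \<ge> 1"
  shows "(1 + norm (of_int_vec n :: real^'n) / S) ^ (CARD('n) + 2) \<le>
    (1 + real CARD('n)) ^ (2 * (CARD('n) + 1)) * (1 + (\<Sum>i\<in>UNIV. (\<bar>of_int (n $ i)\<bar> / S) ^ (2 * (CARD('n) + 1))))"
proof -
  let ?d = "CARD('n)" and ?N = "norm (of_int_vec n :: real^'n)"
  let ?a = "\<lambda>i. \<bar>real_of_int (n $ i)\<bar>"
  obtain i where i: "\<And>j. ?a j \<le> ?a i"
  proof -
    have "Max (range ?a) \<in> range ?a" by (intro Max_in) auto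
    then obtain i where "Max (range ?a) = ?a i" by blast
    then have "?a j \<le> ?a i" for j using Max_ge[of "range ?a" "?a j"] by simp
    then show thesis by (rule that)
  qed
  define t where "t = max 1 (?a i / S)"
  have t: "t \<ge> 1" by (simp add: t_def)
  have "?N \<le> (\<Sum>j\<in>UNIV. \<bar>(of_int_vec n :: real^'n) $ j\<bar>)" by (rule norm_le_l1_cart)
  also have "\<dots> \<le> (\<Sum>j\<in>(UNIV::'n set). ?a i)" using i by (intro sum_mono) simp
  finally have "?N / S \<le> real ?d * ?a i / S" using S by (intro divide_right_mono) auto
  also have "\<dots> \<le> real ?d * t" unfolding times_divide_eq_right[symmetric] t_def by (intro mult_left_mono) auto
  finally have "1 + ?N / S \<le> (1 + real ?d) * t" using t by (simp add: distrib_right)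
  moreover have "1 \<le> 1 + ?N / S" using S by simp
  ultimately have "(1 + ?N / S) ^ (?d + 2) \<le> (1 + ?N / S) ^ (2 * (?d + 1))"
    by (intro power_increasing) auto
  also have "\<dots> \<le> ((1 + real ?d) * t) ^ (2 * (?d + 1))"
    using \<open>1 + ?N / S \<le> (1 + real ?d) * t\<close> \<open>1 \<le> 1 + ?N / S\<close> by (intro power_mono) auto
  also have "\<dots> = (1 + real ?d) ^ (2 * (?d + 1)) * t ^ (2 * (?d + 1))" by (rule power_mult_distrib)
  also have "t ^ (2 * (?d + 1)) \<le> 1 + (?a i / S) ^ (2 * (?d + 1))"
    using S by (simp add: t_def max_def)
  also have "(?a i / S) ^ (2 * (?d + 1)) \<le> (\<Sum>i\<in>UNIV. (?a i / S) ^ (2 * (?d + 1)))"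
    using S by (intro member_le_sum[where f = "\<lambda>i. (?a i / S) ^ (2 * (?d + 1))"]) auto
  finally show ?thesis by (simp add: mult_left_mono)
qed

text \<open>Bernstein's argument with the weight \<open>1 + \<bar>n\<bar> / S\<close>, \<open>S = 1 + \<bar>s\<bar>\<close>: a derivative of the chirp costs
  one factor \<open>S\<close>, so the weighted $\ell^2$ norm of the coefficients is bounded, while the inverse
  weight has mass \<open>O(S^d)\<close>; Cauchy--Schwarz yields \<open>S^(d/2)\<close>.\<close>

lemma fcoef_phase_summable:
  fixes \<zeta> :: "real^'n::finite \<Rightarrow> complex"
  assumes L: "L > 0" and \<zeta>: "schwartz \<zeta>" and \<zeta>s: "\<And>x. \<zeta> x \<noteq> 0 \<Longrightarrow> x \<in> cube L"
  shows "\<exists>C>0. \<forall>s F. finite F \<longrightarrow>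
    (\<Sum>n\<in>F. norm (fcoef L (\<lambda>x. phase 0 s x * \<zeta> x) n)) \<le> C * (1 + \<bar>s\<bar>) powr (real CARD('n) / 2)"
proof -
  let ?d = "CARD('n)" and ?V = "L ^ CARD('n)"
  let ?g = "\<lambda>s x. phase 0 s x * \<zeta> x"
  define K where "K = ?d + 1"
  have V: "?V > 0" using L by simp
  have gS: "schwartz (?g s)" for s by (rule schwartz_phase_mult[OF \<zeta>])
  \<comment> \<open>Derivatives stay supported in the cube and are bounded there, so Bessel's
    inequality bounds their coefficients in l^2 by the sup norm.\<close>
  have l2: "\<exists>C. \<forall>s F. finite F \<longrightarrow> (\<Sum>n\<in>F. (norm (fcoef L (partial_derivs \<alpha> (?g s)) n))\<^sup>2) \<le> (C * (1 + \<bar>s\<bar>) ^ length \<alpha>)\<^sup>2" for \<alpha>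
  proof -
    obtain C1 K1 where C1: "\<And>\<phi> x y s. schwartz \<phi> \<Longrightarrow>
      (1 + norm x) ^ 0 * norm (partial_derivs \<alpha> (\<lambda>x. phase y s x * \<phi> x) x)
        \<le> C1 * (1 + norm y + \<bar>s\<bar>) ^ length \<alpha> * schwartz_sum K1 (\<phi> :: real^'n \<Rightarrow> complex)"
      using phase_mult_bound'[of 0 \<alpha>] by blast
    let ?C = "C1 * schwartz_sum K1 \<zeta>"
    have "(\<Sum>n\<in>F. (norm (fcoef L (partial_derivs \<alpha> (?g s)) n))\<^sup>2) \<le> (?C * (1 + \<bar>s\<bar>) ^ length \<alpha>)\<^sup>2" if F: "finite F" for s and F :: "(int^'n) set"
    proof -
      let ?h = "partial_derivs \<alpha> (?g s)"
      define B where "B = ?C * (1 + \<bar>s\<bar>) ^ length \<alpha>"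
      have hS: "schwartz ?h" by (rule schwartz_partial_derivs[OF gS])
      have hB: "norm (?h x) \<le> B" for x
        using C1[OF \<zeta>, of x 0 s] by (simp add: B_def mult_ac)
      have hs: "?h x \<noteq> 0 \<Longrightarrow> x \<in> cube L" for x
        by (rule partial_derivs_support[of "cube L" "?g s"])
           (use \<zeta>s in \<open>auto simp: compact_imp_closed compact_cube intro: schwartz_smooth gS\<close>)
      have fc: "fourier ?h \<xi> = (\<integral>x. indicator (cube L) x *\<^sub>R (?h x * phase (- \<xi>) 0 x) \<partial>lborel)" for \<xi>
        by (rule fourier_cube) (rule hs)
      have "(\<Sum>n\<in>F. (norm (fcoef L ?h n))\<^sup>2) = (\<Sum>n\<in>F. (norm (\<integral>x. indicator (cube L) x *\<^sub>R (?h x * phase (- lat L n) 0 x) \<partial>lborel))\<^sup>2) / ?V\<^sup>2"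
        unfolding fcoef_def fc using L by (simp add: norm_divide norm_power power_divide sum_divide_distrib)
      also have "\<dots> \<le> (?V * (\<integral>x. indicator (cube L) x * (norm (?h x))\<^sup>2 \<partial>lborel)) / ?V\<^sup>2"
        by (intro divide_right_mono bessel_cube[OF L F schwartz_measurable[OF hS] hB]) simp
      also have "\<dots> \<le> (?V * (?V * B\<^sup>2)) / ?V\<^sup>2"
      proof (intro divide_right_mono mult_left_mono)
        \<comment> \<open>The constant \<open>B\<close> is written as a one-term trigonometric
          polynomial, so that \<open>integral_cube_trig_poly\<close> supplies the volume of the
          cube.\<close>
        have "(\<integral>x. indicator (cube L) x * (norm (?h x))\<^sup>2 \<partial>lborel) \<le> (\<integral>x. indicator (cube L) x * (norm (\<Sum>k\<in>{0::int^'n}. of_real B * phase (- lat L k) 0 x))\<^sup>2 \<partial>lborel)"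
        proof (rule Bochner_Integration.integral_mono)
          have "integrable lborel (\<lambda>x. indicator (cube L) x *\<^sub>R (norm (?h x))\<^sup>2)"
            by (intro borel_integrable_compact compact_cube continuous_intros continuous_on_subset[OF schwartz_continuous[OF hS]]) auto
          then show "integrable lborel (\<lambda>x. indicator (cube L) x * (norm (?h x))\<^sup>2)" by simp
          have "integrable lborel (\<lambda>x::real^'n. indicator (cube L) x *\<^sub>R (norm (\<Sum>k\<in>{0::int^'n}. of_real B * phase (- lat L k) 0 x))\<^sup>2)"
            by (intro borel_integrable_compact compact_cube continuous_intros)
          then show "integrable lborel (\<lambda>x::real^'n. indicator (cube L) x * (norm (\<Sum>k\<in>{0::int^'n}. of_real B * phase (- lat L k) 0 x))\<^sup>2)" by simp
          fix x :: "real^'n"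
          have "(norm (?h x))\<^sup>2 \<le> B\<^sup>2" using hB by (intro power_mono) auto
          then show "indicator (cube L) x * (norm (?h x))\<^sup>2 \<le> indicator (cube L) x * (norm (\<Sum>k\<in>{0::int^'n}. of_real B * phase (- lat L k) 0 x))\<^sup>2"
            by (cases "x \<in> cube L") (simp_all add: norm_mult)
        qed
        also have "\<dots> = ?V * B\<^sup>2" by (subst integral_cube_trig_poly[OF L]) simp_all
        finally show "(\<integral>x. indicator (cube L) x * (norm (?h x))\<^sup>2 \<partial>lborel) \<le> ?V * B\<^sup>2" .
      qed (use V in auto)
      also have "\<dots> = B\<^sup>2" using L by (simp add: power2_eq_square)
      finally show ?thesis by (simp only: B_def)
    qed
    then show ?thesis by blast
  qed
  obtain C0 where C0: "\<And>s F. finite F \<Longrightarrow> (\<Sum>n\<in>F. (norm (fcoef L (?g s) n))\<^sup>2) \<le> C0\<^sup>2"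
    using l2[of "[]"] by auto
  have "\<exists>C. \<forall>i s F. finite F \<longrightarrow> (\<Sum>n\<in>F. (norm (fcoef L (partial_derivs (replicate K i) (?g s)) n))\<^sup>2) \<le> (C i * (1 + \<bar>s\<bar>) ^ K)\<^sup>2"
    using l2[of "replicate K _"] by (simp only: length_replicate) metis
  then obtain C where C: "\<And>i s F. finite F \<Longrightarrow> (\<Sum>n\<in>F. (norm (fcoef L (partial_derivs (replicate K i) (?g s)) n))\<^sup>2) \<le> (C i * (1 + \<bar>s\<bar>) ^ K)\<^sup>2"
    by blast
  obtain C2 where C2: "C2 \<ge> 0" "\<And>S. S \<ge> 1 \<Longrightarrow> (\<integral>\<^sup>+m. ennreal (1 / (1 + norm (of_int_vec (m::int^'n)) / S) ^ (?d + 2)) \<partial>count_space UNIV) \<le> ennreal (C2 * S ^ ?d)"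
    using lattice_sum_bound[where 'n = 'n] by blast
  \<comment> \<open>Bound for the weighted square sum: \<open>C0\<close> comes from the constant
    term of \<open>weight_bound\<close>, the other summands from pure derivatives of order
    \<open>K\<close>, whose growth \<open>S ^ K\<close> cancels against the weight.\<close>
  define M where "M = (1 + real ?d) ^ (2 * K) * (C0\<^sup>2 + (\<Sum>i\<in>UNIV. (L / (2 * pi)) ^ (2 * K) * (C i)\<^sup>2))"
  have M: "M \<ge> 0" unfolding M_def by (intro mult_nonneg_nonneg add_nonneg_nonneg sum_nonneg) (use L in auto)
  have "(\<Sum>n\<in>F. norm (fcoef L (?g s) n)) \<le> (sqrt (M * C2) + 1) * (1 + \<bar>s\<bar>) powr (real ?d / 2)"
    if F: "finite F" for s and F :: "(int^'n) set"
  proof -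
    define S where "S = 1 + \<bar>s\<bar>"
    have S: "S \<ge> 1" by (simp add: S_def)
    let ?c = "\<lambda>n. norm (fcoef L (?g s) n)"
    define w where "w n = (1 + norm (of_int_vec n :: real^'n) / S) ^ (?d + 2)" for n
    have wpos: "w n > 0" for n unfolding w_def using S by (intro zero_less_power) (simp add: add_pos_nonneg)
    have comp: "(?c n)\<^sup>2 * (\<bar>of_int (n $ i)\<bar> / S) ^ (2 * K) =
        (L / (2 * pi)) ^ (2 * K) * (norm (fcoef L (partial_derivs (replicate K i) (?g s)) n))\<^sup>2 / S ^ (2 * K)" for n i
    proof -
      have "norm (fcoef L (partial_derivs (replicate K i) (?g s)) n) = (2 * pi * (\<bar>of_int (n $ i)\<bar> / L)) ^ K * ?c n"
        unfolding fcoef_def fourier_partial_derivs_replicate[OF gS]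
        using L by (simp add: norm_divide norm_mult norm_power lat_def abs_mult power_mult_distrib)
      then show ?thesis using L S
        by (simp add: power_mult[of _ 2 K, unfolded mult.commute[of 2 K]] power_mult power_mult_distrib power_divide power2_eq_square field_simps)
    qed
    have "(\<Sum>n\<in>F. (?c n)\<^sup>2 * w n) \<le> (\<Sum>n\<in>F. (?c n)\<^sup>2 * ((1 + real ?d) ^ (2 * K) * (1 + (\<Sum>i\<in>UNIV. (\<bar>of_int (n $ i)\<bar> / S) ^ (2 * K)))))"
      unfolding K_def w_def by (intro sum_mono mult_left_mono weight_bound S) simp
    also have "\<dots> = (1 + real ?d) ^ (2 * K) * ((\<Sum>n\<in>F. (?c n)\<^sup>2) + (\<Sum>i\<in>UNIV. \<Sum>n\<in>F. (?c n)\<^sup>2 * (\<bar>of_int (n $ i)\<bar> / S) ^ (2 * K)))"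
      by (subst sum.swap) (simp add: sum_distrib_left sum.distrib[symmetric] distrib_left mult_ac)
    also have "\<dots> \<le> (1 + real ?d) ^ (2 * K) * (C0\<^sup>2 + (\<Sum>i\<in>UNIV. (L / (2 * pi)) ^ (2 * K) * (C i)\<^sup>2))"
    proof (intro mult_left_mono add_mono C0 F sum_mono)
      fix i
      have "(\<Sum>n\<in>F. (?c n)\<^sup>2 * (\<bar>of_int (n $ i)\<bar> / S) ^ (2 * K)) =
          (L / (2 * pi)) ^ (2 * K) * (\<Sum>n\<in>F. (norm (fcoef L (partial_derivs (replicate K i) (?g s)) n))\<^sup>2) / S ^ (2 * K)"
        unfolding comp by (simp only: sum_distrib_left sum_divide_distrib)
      also have "\<dots> \<le> (L / (2 * pi)) ^ (2 * K) * (C i * S ^ K)\<^sup>2 / S ^ (2 * K)"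
        using C[OF F, of i s] S L by (intro divide_right_mono mult_left_mono) (auto simp: S_def)
      also have "\<dots> = (L / (2 * pi)) ^ (2 * K) * (C i)\<^sup>2"
        using S by (simp add: power_mult_distrib power_mult[symmetric] mult.commute)
      finally show "(\<Sum>n\<in>F. (?c n)\<^sup>2 * (\<bar>of_int (n $ i)\<bar> / S) ^ (2 * K)) \<le> (L / (2 * pi)) ^ (2 * K) * (C i)\<^sup>2" .
    qed simp
    finally have cw: "(\<Sum>n\<in>F. (?c n)\<^sup>2 * w n) \<le> M" by (simp only: M_def)
    have "ennreal (\<Sum>n\<in>F. 1 / w n) = (\<Sum>n\<in>F. ennreal (1 / w n))"
      using wpos by (intro sum_ennreal[symmetric]) (simp add: less_imp_le)
    also have "\<dots> = (\<integral>\<^sup>+n. ennreal (1 / w n) * indicator F n \<partial>count_space UNIV)"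
      by (subst nn_integral_count_space_indicator[symmetric]) (auto simp: nn_integral_count_space_finite F)
    also have "\<dots> \<le> (\<integral>\<^sup>+n. ennreal (1 / w n) \<partial>count_space UNIV)"
      by (intro nn_integral_mono) (simp add: indicator_def)
    also have "\<dots> \<le> ennreal (C2 * S ^ ?d)" unfolding w_def by (rule C2(2)[OF S])
    finally have "ennreal (\<Sum>n\<in>F. 1 / w n) \<le> ennreal (C2 * S ^ ?d)" .
    moreover have "0 \<le> C2 * S ^ ?d" using C2(1) S by simp
    ultimately have iw: "(\<Sum>n\<in>F. 1 / w n) \<le> C2 * S ^ ?d" by (simp only: ennreal_le_iff)
    have "(\<Sum>n\<in>F. ?c n)\<^sup>2 = (\<Sum>n\<in>F. (?c n * sqrt (w n)) * (1 / sqrt (w n)))\<^sup>2"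
    proof -
      have "sqrt (w n) \<noteq> 0" for n using wpos[of n] by simp
      then show ?thesis by simp
    qed
    also have "\<dots> \<le> (\<Sum>n\<in>F. (?c n * sqrt (w n))\<^sup>2) * (\<Sum>n\<in>F. (1 / sqrt (w n))\<^sup>2)"
      by (rule Cauchy_Schwarz_ineq_sum)
    also have "\<dots> = (\<Sum>n\<in>F. (?c n)\<^sup>2 * w n) * (\<Sum>n\<in>F. 1 / w n)"
      using wpos by (simp add: power_mult_distrib power_divide less_imp_le)
    also have "\<dots> \<le> M * (C2 * S ^ ?d)"
      using cw iw M wpos by (intro mult_mono sum_nonneg) (auto simp: less_imp_le)
    finally have sq: "(\<Sum>n\<in>F. ?c n)\<^sup>2 \<le> (M * C2) * S ^ ?d" by (simp add: mult.assoc)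
    have "(\<Sum>n\<in>F. ?c n) \<le> sqrt ((M * C2) * S ^ ?d)" by (rule real_le_rsqrt[OF sq])
    also have "\<dots> = sqrt (M * C2) * S powr (real ?d / 2)"
      using S by (simp add: real_sqrt_mult powr_half_sqrt_powr powr_realpow)
    \<comment> \<open>Adding one secures a strictly positive constant.\<close>
    also have "\<dots> \<le> (sqrt (M * C2) + 1) * S powr (real ?d / 2)" by (intro mult_right_mono) auto
    finally show ?thesis by (simp only: S_def)
  qed
  moreover have "sqrt (M * C2) + 1 > 0" using M C2(1) by (intro add_nonneg_pos) auto
  ultimately show ?thesis by blast
qed

text \<open>As the kernel depends on \<open>k - m\<close> only, its row and column sums are sums of
  the same coefficients. The l^2 bound is the sup bound of \<open>\<zeta>\<close>, because the phase
  has modulus one.\<close>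

lemma kernel_bounds_phase:
  fixes \<zeta> :: "real^'n::finite \<Rightarrow> complex"
  assumes L: "L > 0" and \<zeta>: "schwartz \<zeta>" and \<zeta>s: "\<And>x. \<zeta> x \<noteq> 0 \<Longrightarrow> x \<in> cube L"
    and B: "\<And>x. norm (\<zeta> x) \<le> B" and C: "C > 0"
    and sum: "\<And>F. finite F \<Longrightarrow> (\<Sum>n\<in>F. norm (fcoef L (\<lambda>x. phase 0 s x * \<zeta> x) n)) \<le> C"
  shows "kernel_bounds (\<lambda>m k. fcoef L (\<lambda>x. phase 0 s x * \<zeta> x) (k - m)) C B"
proof
  let ?c = "fcoef L (\<lambda>x. phase 0 s x * \<zeta> x)"
  show "C > 0" by fact
  show "B \<ge> 0" using order_trans[OF norm_ge_zero B] .
  show "(\<integral>\<^sup>+m. ennreal (norm (?c (k - m))) \<partial>count_space UNIV) \<le> ennreal C" for k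
  proof (rule nn_integral_count_space_le_finite)
    fix F :: "(int^'n) set" assume F: "finite F"
    have "(\<Sum>m\<in>F. norm (?c (k - m))) = (\<Sum>n\<in>(\<lambda>m. k - m) ` F. norm (?c n))"
      by (subst sum.reindex) (auto simp: inj_on_def)
    also have "\<dots> \<le> C" using F by (intro sum) auto
    finally show "(\<Sum>m\<in>F. ennreal (norm (?c (k - m)))) \<le> ennreal C" by (simp add: sum_ennreal ennreal_leI)
  qed
  show "(\<Sum>k\<in>F. norm (?c (k - m))) \<le> C" if F: "finite F" for m F
  proof -
    have "(\<Sum>k\<in>F. norm (?c (k - m))) = (\<Sum>n\<in>(\<lambda>k. k - m) ` F. norm (?c n))"
      by (subst sum.reindex) (auto simp: inj_on_def)
    also have "\<dots> \<le> C" using F by (intro sum) auto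
    finally show ?thesis .
  qed
  show "(\<integral>\<^sup>+m. ennreal ((norm (\<Sum>k\<in>F. ?c (k - m) * a k))\<^sup>2) \<partial>count_space UNIV) \<le> ennreal (B\<^sup>2 * (\<Sum>k\<in>F. (norm (a k))\<^sup>2))"
    if "finite F" for F a
    by (rule fcoef_convolution_l2[OF L _ _ _ that])
       (use \<zeta>s B in \<open>auto simp: norm_mult intro: schwartz_continuous schwartz_phase_mult \<zeta>\<close>)
qed

subsection \<open>The estimate on a unit cube of frequencies\<close>

lemma measurable_lattice_has_sum:
  fixes f :: "int^'n::finite \<Rightarrow> real^'m::finite \<Rightarrow> complex"
  assumes f: "\<And>n. f n \<in> borel_measurable borel" and S: "\<And>x. ((\<lambda>n. f n x) has_sum S x) UNIV"
  shows "S \<in> borel_measurable borel"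
proof -
  obtain b :: "nat \<Rightarrow> int^'n" where b: "bij_betw b UNIV UNIV" by (rule lattice_bij)
  have "(\<lambda>k. f (b k) x) sums S x" for x
    using S[of x] has_sum_reindex_bij_betw[OF b, of "\<lambda>n. f n x"] has_sum_imp_sums by blast
  then have "(\<lambda>N. \<Sum>k<N. f (b k) x) \<longlonglongrightarrow> S x" for x by (simp add: sums_def)
  then show ?thesis
    by (rule borel_measurable_LIMSEQ_metric[rotated]) (use f in auto)
qed

text \<open>A function of \<open>y\<close> defined by pairings is not evidently measurable; the
  estimate therefore carries measurability along, which the change of variables to dyadic scales
  needs.\<close>

lemma modulation_estimate:
  fixes \<zeta> \<psi> :: "real^'n::finite \<Rightarrow> complex"
  assumes L: "L > 0" and \<zeta>: "schwartz \<zeta>" and \<zeta>s: "\<And>x. \<zeta> x \<noteq> 0 \<Longrightarrow> x \<in> interior (cube L)"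
    and \<psi>: "schwartz \<psi>" and \<zeta>\<psi>: "\<And>x. \<psi> x \<noteq> 0 \<Longrightarrow> \<zeta> x = 1" and p: "p \<ge> 1"
  shows "\<exists>C>0. \<forall>s v. tempered v \<longrightarrow>
    (\<lambda>y. v (\<lambda>x. phase y s x * \<psi> x)) \<in> borel_measurable borel \<and>
    (\<integral>\<^sup>+y. ennreal (norm (v (\<lambda>x. phase y s x * \<psi> x)) powr p) \<partial>lborel) \<le>
      ennreal (C * (1 + \<bar>s\<bar>) powr (real CARD('n) / 2 * \<bar>p - 2\<bar>)) *
      (\<integral>\<^sup>+y. ennreal (norm (v (\<lambda>x. phase y 0 x * \<psi> x)) powr p) \<partial>lborel)"
proof -
  let ?d = "CARD('n)"
  have \<psi>s: "\<psi> x \<noteq> 0 \<Longrightarrow> x \<in> interior (cube L)" for x using \<zeta>\<psi> \<zeta>s by fastforce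
  have \<zeta>s': "\<zeta> x \<noteq> 0 \<Longrightarrow> x \<in> cube L" for x using \<zeta>s interior_subset by blast
  obtain C where C: "C > 0" "\<And>s F. finite F \<Longrightarrow>
    (\<Sum>n\<in>F. norm (fcoef L (\<lambda>x. phase 0 s x * \<zeta> x) n)) \<le> C * (1 + \<bar>s\<bar>) powr (real ?d / 2)"
    using fcoef_phase_summable[OF L \<zeta> \<zeta>s'] by blast
  define B where "B = schwartz_sum 0 \<zeta>"
  have B: "norm (\<zeta> x) \<le> B" for x using schwartz_decay[OF \<zeta>, of x 0] by (simp add: B_def)
  have B0: "B \<ge> 0" using order_trans[OF norm_ge_zero B] .
  \<comment> \<open>The value of \<open>interp_const\<close>, written out before the locale is
    interpreted, so that it is visibly chosen independently of \<open>s\<close> and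
    \<open>v\<close>.\<close>
  define P where "P = (if p = 1 then 1 else if p = 2 then B\<^sup>2
     else if p < 2 then 2 powr p * p * (1 / (p - 1) + B\<^sup>2 / (2 - p))
     else 2 powr p * p * (B\<^sup>2 / (p - 2)))"
  have P0: "P \<ge> 0" unfolding P_def using p by (auto intro!: mult_nonneg_nonneg add_nonneg_nonneg)
  \<comment> \<open>Inserting \<open>\<zeta>\<close> changes nothing where \<open>\<psi>\<close>
    lives, and it turns the chirp into a compactly supported function with a Fourier series.\<close>
  have \<psi>1: "phase 0 s x * \<zeta> x * \<psi> x = phase 0 s x * \<psi> x" for s x using \<zeta>\<psi>[of x] by (cases "\<psi> x = 0") auto
  have "(\<lambda>y. v (\<lambda>x. phase y s x * \<psi> x)) \<in> borel_measurable borel \<and>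
    (\<integral>\<^sup>+y. ennreal (norm (v (\<lambda>x. phase y s x * \<psi> x)) powr p) \<partial>lborel) \<le>
      ennreal (((P + 1) * C powr \<bar>p - 2\<bar>) * (1 + \<bar>s\<bar>) powr (real ?d / 2 * \<bar>p - 2\<bar>)) *
      (\<integral>\<^sup>+y. ennreal (norm (v (\<lambda>x. phase y 0 x * \<psi> x)) powr p) \<partial>lborel)"
    if v: "tempered v" for s v
  proof -
    define A where "A = C * (1 + \<bar>s\<bar>) powr (real ?d / 2)"
    have A: "A > 0" using C(1) by (simp add: A_def)
    let ?c = "fcoef L (\<lambda>x. phase 0 s x * \<zeta> x)"
    define a where "a y = v (\<lambda>x. phase y 0 x * \<psi> x)" for y
    define b where "b y = v (\<lambda>x. phase y s x * \<psi> x)" for y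
    have ab: "((\<lambda>n. ?c n * a (y + lat L n)) has_sum b y) UNIV" for y
    proof -
      have "phase y 0 x * (phase 0 s x * \<zeta> x * \<psi> x) = phase y s x * \<psi> x" for x
        unfolding \<psi>1 by (simp add: mult.assoc[symmetric] phase_mult_phase)
      then have eq: "(\<lambda>x. phase y 0 x * (phase 0 s x * \<zeta> x * \<psi> x)) = (\<lambda>x. phase y s x * \<psi> x)" by (rule ext)
      have "((\<lambda>n. ?c n * v (\<lambda>x. phase (y + lat L n) 0 x * \<psi> x)) has_sum v (\<lambda>x. phase y 0 x * (phase 0 s x * \<zeta> x * \<psi> x))) UNIV"
        by (rule tempered_modulation_expansion[OF L schwartz_phase_mult[OF \<zeta>, of 0 s] _ \<psi> \<psi>s v]) (use \<zeta>s in auto)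
      then show ?thesis unfolding eq a_def b_def .
    qed
    \<comment> \<open>The character of frequency \<open>y\<close> is moved into the cut-off and the
      expansion taken at frequency zero. Then only the coefficients depend on \<open>y\<close>, and
      they do so continuously.\<close>
    have am: "a \<in> borel_measurable borel"
    proof (rule measurable_lattice_has_sum)
      fix y
      have "phase 0 0 x * (phase y 0 x * \<zeta> x * \<psi> x) = phase y 0 x * \<psi> x" for x
        using \<psi>1[of 0 x] by auto
      then have eq: "(\<lambda>x. phase 0 0 x * (phase y 0 x * \<zeta> x * \<psi> x)) = (\<lambda>x. phase y 0 x * \<psi> x)" by (rule ext)
      have "((\<lambda>n. fcoef L (\<lambda>x. phase y 0 x * \<zeta> x) n * v (\<lambda>x. phase (0 + lat L n) 0 x * \<psi> x)) has_sum
          v (\<lambda>x. phase 0 0 x * (phase y 0 x * \<zeta> x * \<psi> x))) UNIV"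
        by (rule tempered_modulation_expansion[OF L schwartz_phase_mult[OF \<zeta>, of y 0] _ \<psi> \<psi>s v]) (use \<zeta>s in auto)
      then show "((\<lambda>n. fcoef L (\<lambda>x. phase y 0 x * \<zeta> x) n * v (\<lambda>x. phase (lat L n) 0 x * \<psi> x)) has_sum a y) UNIV"
        unfolding eq a_def add_0 .
    next
      fix n
      have "continuous_on UNIV (fourier \<zeta>)" by (rule schwartz_continuous[OF schwartz_fourier[OF \<zeta>]])
      then have "continuous_on UNIV (\<lambda>y. fourier \<zeta> (lat L n - y))"
        by (rule continuous_on_compose2) (auto intro: continuous_intros)
      then show "(\<lambda>y. fcoef L (\<lambda>x. phase y 0 x * \<zeta> x) n * v (\<lambda>x. phase (lat L n) 0 x * \<psi> x)) \<in> borel_measurable borel"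
        unfolding fcoef_def fourier_phase_mult
        by (intro borel_measurable_continuous_onI continuous_intros) (use L in auto)
    qed
    have bm: "b \<in> borel_measurable borel"
      by (rule measurable_lattice_has_sum[OF _ ab]) (use am in measurable)
    interpret kernel_bounds "\<lambda>m k. ?c (k - m)" A B
      by (rule kernel_bounds_phase[OF L \<zeta> \<zeta>s' B A]) (use C(2) in \<open>simp_all add: A_def\<close>)
    have Pc: "interp_const p = P" by (simp add: interp_const_def P_def)
    have pt: "(\<integral>\<^sup>+m. ennreal (norm (b (x + lat L m)) powr p) \<partial>count_space UNIV) \<le>
       ennreal (P * A powr \<bar>p - 2\<bar>) * (\<integral>\<^sup>+k. ennreal (norm (a (x + lat L k)) powr p) \<partial>count_space UNIV)" for x
    proof (rule interpolation[OF p, where a = "\<lambda>k. a (x + lat L k)" and b = "\<lambda>m. b (x + lat L m)", unfolded Pc])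
      \<comment> \<open>Shifting the summation index by \<open>m\<close> turns the expansion at the
        sample point of index \<open>m\<close> into a row of the kernel.\<close>
      fix m :: "int^'n"
      have "bij_betw (\<lambda>k. k - m) UNIV UNIV" by (rule bij_betwI[of _ _ _ "\<lambda>n. n + m"]) auto
      from has_sum_reindex_bij_betw[OF this, of "\<lambda>n. ?c n * a (x + lat L m + lat L n)"] ab[of "x + lat L m"]
      show "((\<lambda>k. ?c (k - m) * a (x + lat L k)) has_sum b (x + lat L m)) UNIV" by simp
    qed
    have iL: "1 / L > 0" using L by simp
    have "(\<integral>\<^sup>+y. ennreal (norm (b y) powr p) \<partial>lborel) =
        (\<integral>\<^sup>+x. (\<integral>\<^sup>+m. ennreal (norm (b (x + lat L m)) powr p) \<partial>count_space UNIV) * indicator (cell (1 / L)) x \<partial>lborel)"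
      unfolding lat_def using bm by (intro nn_integral_tiling' iL) measurable
    also have "\<dots> \<le> (\<integral>\<^sup>+x. ennreal (P * A powr \<bar>p - 2\<bar>) * ((\<integral>\<^sup>+k. ennreal (norm (a (x + lat L k)) powr p) \<partial>count_space UNIV) * indicator (cell (1 / L)) x) \<partial>lborel)"
      unfolding mult.assoc[symmetric] by (intro nn_integral_mono mult_right_mono pt) simp
    also have "\<dots> = ennreal (P * A powr \<bar>p - 2\<bar>) * (\<integral>\<^sup>+x. (\<integral>\<^sup>+k. ennreal (norm (a (x + lat L k)) powr p) \<partial>count_space UNIV) * indicator (cell (1 / L)) x \<partial>lborel)"
    proof (rule nn_integral_cmult)
      have "(\<lambda>x. \<integral>\<^sup>+k. ennreal (norm (a (x + lat L k)) powr p) \<partial>count_space UNIV) \<in> borel_measurable lborel"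
      proof -
        interpret cs: sigma_finite_measure "count_space (UNIV :: (int^'n) set)" by (rule sigma_finite_measure_count_space)
        show ?thesis
        proof (rule cs.borel_measurable_nn_integral)
          show "(\<lambda>(x, k). ennreal (norm (a (x + lat L k)) powr p)) \<in> borel_measurable (lborel \<Otimes>\<^sub>M count_space UNIV)"
          proof -
            have "(\<lambda>p. ennreal (norm (a (snd p + lat L (fst p))) powr p')) \<in> borel_measurable (count_space UNIV \<Otimes>\<^sub>M lborel)" for p'
              by (rule measurable_pair_measure_countable1) (use am in auto)
            from measurable_compose[OF measurable_pair_swap' this, of p] show ?thesis
              by (simp add: case_prod_beta)
          qed
        qed
      qed
      then show "(\<lambda>x. (\<integral>\<^sup>+k. ennreal (norm (a (x + lat L k)) powr p) \<partial>count_space UNIV) * indicator (cell (1 / L)) x) \<in> borel_measurable lborel"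
        by measurable
    qed
    also have "(\<integral>\<^sup>+x. (\<integral>\<^sup>+k. ennreal (norm (a (x + lat L k)) powr p) \<partial>count_space UNIV) * indicator (cell (1 / L)) x \<partial>lborel) =
        (\<integral>\<^sup>+y. ennreal (norm (a y) powr p) \<partial>lborel)"
      unfolding lat_def using am by (intro nn_integral_tiling'[symmetric] iL) measurable
    also have "ennreal (P * A powr \<bar>p - 2\<bar>) * (\<integral>\<^sup>+y. ennreal (norm (a y) powr p) \<partial>lborel) \<le>
      ennreal (((P + 1) * C powr \<bar>p - 2\<bar>) * (1 + \<bar>s\<bar>) powr (real ?d / 2 * \<bar>p - 2\<bar>)) * (\<integral>\<^sup>+y. ennreal (norm (a y) powr p) \<partial>lborel)"
    proof (intro mult_right_mono ennreal_leI)
      have "A powr \<bar>p - 2\<bar> = C powr \<bar>p - 2\<bar> * (1 + \<bar>s\<bar>) powr (real ?d / 2 * \<bar>p - 2\<bar>)"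
        using C(1) by (simp add: A_def powr_mult powr_powr)
      then show "P * A powr \<bar>p - 2\<bar> \<le> ((P + 1) * C powr \<bar>p - 2\<bar>) * (1 + \<bar>s\<bar>) powr (real ?d / 2 * \<bar>p - 2\<bar>)"
        by (simp add: distrib_right mult.assoc)
    qed simp
    finally show ?thesis using bm unfolding a_def b_def by simp
  qed
  \<comment> \<open>Only \<open>P \<ge> 0\<close> is known; the added one keeps the constant
    positive.\<close>
  moreover have "(P + 1) * C powr \<bar>p - 2\<bar> > 0" using P0 C(1) by (intro mult_pos_pos) auto
  ultimately show ?thesis by blast
qed

subsection \<open>Rescaling to dyadic cubes\<close>

lemma decomposition_function_support:
  assumes "decomposition_function \<psi>" "\<psi> x \<noteq> 0"
  shows "\<bar>x $ i\<bar> \<le> 1"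
proof -
  have "x \<in> {x. \<psi> x \<noteq> 0}" using assms(2) by simp
  then have "x \<in> supp \<psi>" unfolding supp_def by (rule subsetD[OF closure_subset])
  then have "- 1 \<le> x $ i \<and> x $ i \<le> 1" using assms(1) unfolding decomposition_function_def by blast
  then show ?thesis by (simp add: abs_le_iff)
qed

lemma schwartz_affine: "schwartz \<phi> \<Longrightarrow> a \<noteq> 0 \<Longrightarrow> schwartz (\<lambda>x. \<phi> (a *\<^sub>R x - b))"
  using schwartz_op_schwartz[OF schwartz_op_affine] .

text \<open>The partition of unity itself supplies the cut-off: where \<open>\<psi>\<close> is
  nonzero, only translates by \<open>l\<close> with coordinates in \<open>{- 2..2}\<close> can be
  nonzero, so their finite sum already equals one. It vanishes when a coordinate exceeds 3 in size,
  well inside the cube of side 8.\<close>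

lemma decomposition_cutoff:
  fixes \<psi> :: "real^'n::finite \<Rightarrow> complex"
  assumes \<psi>: "decomposition_function \<psi>"
  shows "\<exists>\<zeta>. schwartz \<zeta> \<and> (\<forall>x. \<zeta> x \<noteq> 0 \<longrightarrow> x \<in> interior (cube 8)) \<and> (\<forall>x. \<psi> x \<noteq> 0 \<longrightarrow> \<zeta> x = 1)"
proof -
  define F where "F = {l :: int^'n. \<forall>i. l $ i \<in> {- 2..2}}"
  have "F \<subseteq> (\<lambda>f. vec_lambda f) ` (UNIV \<rightarrow>\<^sub>E {- 2..2})"
  proof
    fix l assume "l \<in> F"
    then have "l = vec_lambda (vec_nth l)" "vec_nth l \<in> UNIV \<rightarrow>\<^sub>E {- 2..2}" by (auto simp: F_def)
    then show "l \<in> (\<lambda>f. vec_lambda f) ` (UNIV \<rightarrow>\<^sub>E {- 2..2})" by blast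
  qed
  then have F: "finite F" by (rule finite_subset) (intro finite_imageI finite_PiE, auto)
  define \<zeta> where "\<zeta> x = (\<Sum>l\<in>F. \<psi> (1 *\<^sub>R x - of_int_vec l))" for x
  have \<psi>s: "schwartz \<psi>" using \<psi> by (simp add: decomposition_function_def)
  have "schwartz \<zeta>"
    unfolding \<zeta>_def[abs_def]
  proof (rule schwartz_sum_fun)
    fix l :: "int^'n"
    show "schwartz (\<lambda>x. \<psi> (1 *\<^sub>R x - of_int_vec l))"
      using schwartz_affine[OF \<psi>s one_neq_zero, of "of_int_vec l"] .
  qed
  moreover have "x \<in> interior (cube 8)" if "\<zeta> x \<noteq> 0" for x
  proof -
    have "\<exists>l. l \<in> F \<and> \<psi> (1 *\<^sub>R x - of_int_vec l) \<noteq> 0"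
    proof (rule ccontr)
      assume "\<not> ?thesis"
      then have "\<forall>l\<in>F. \<psi> (1 *\<^sub>R x - of_int_vec l) = 0" by blast
      then have "\<zeta> x = 0" unfolding \<zeta>_def by (intro sum.neutral)
      then show False using that by simp
    qed
    then obtain l where l: "l \<in> F" "\<psi> (1 *\<^sub>R x - of_int_vec l) \<noteq> 0"
      by blast
    have "\<bar>x $ i\<bar> < 4" for i
    proof -
      have "\<bar>x $ i - of_int (l $ i)\<bar> \<le> 1" using decomposition_function_support[OF \<psi> l(2), of i] by simp
      moreover have "\<bar>real_of_int (l $ i)\<bar> \<le> 2"
      proof -
        have "- 2 \<le> l $ i" "l $ i \<le> 2" using l(1) by (simp_all add: F_def)
        then have "real_of_int (- 2) \<le> real_of_int (l $ i)" "real_of_int (l $ i) \<le> real_of_int 2"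
          by (simp_all only: of_int_le_iff)
        then show ?thesis by (simp add: abs_le_iff)
      qed
      ultimately show ?thesis by linarith
    qed
    then show ?thesis by (simp add: interior_cube)
  qed
  moreover have "\<zeta> x = 1" if "\<psi> x \<noteq> 0" for x
  proof -
    have z: "\<psi> (x - of_int_vec l) = 0" if "l \<notin> F" for l
    proof (rule ccontr)
      assume nz: "\<psi> (x - of_int_vec l) \<noteq> 0"
      have abs2: "\<bar>l $ i\<bar> \<le> 2" for i
        using decomposition_function_support[OF \<psi> nz, of i] decomposition_function_support[OF \<psi> \<open>\<psi> x \<noteq> 0\<close>, of i]
        by simp
      have "- 2 \<le> l $ i \<and> l $ i \<le> 2" for i using abs2[of i] by arith
      with that show False by (simp add: F_def)
    qed
    have 1: "((\<lambda>l. \<psi> (x - of_int_vec l)) has_sum 1) UNIV" using \<psi> by (simp add: decomposition_function_def)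
    have 2: "((\<lambda>l. \<psi> (x - of_int_vec l)) has_sum (\<Sum>l\<in>F. \<psi> (x - of_int_vec l))) UNIV"
    proof (rule has_sum_cong_neutral[THEN iffD1, OF _ _ _ has_sum_finite[OF F]])
      show "\<psi> (x - of_int_vec l) = 0" if "l \<in> UNIV - F" for l using z that by blast
    qed auto
    from has_sum_unique[OF 2 1] show ?thesis unfolding \<zeta>_def scaleR_one .
  qed
  ultimately show ?thesis by blast
qed

text \<open>The Fourier transform of \<open>u\<close> moved to the unit scale, with the cube of
  index \<open>k\<close> at the origin. The substitution is made in the test function without a
  Jacobian, since both sides of the estimate refer to the same rescaled distribution.\<close>

definition rescaled :: "int \<Rightarrow> int^'n \<Rightarrow> 'n::finite dist \<Rightarrow> 'n dist" where
  "rescaled j k u \<phi> = dist_fourier u (\<lambda>\<xi>. \<phi> ((2 powi (- j)) *\<^sub>R \<xi> - of_int_vec k))"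

lemma tempered_dist_fourier: "tempered u \<Longrightarrow> tempered (dist_fourier u)"
  unfolding dist_fourier_def by (rule tempered_compose[OF _ schwartz_op_fourier])

lemma tempered_rescaled: "tempered u \<Longrightarrow> tempered (rescaled j k u)"
  unfolding rescaled_def[abs_def]
  by (rule tempered_compose[OF tempered_dist_fourier schwartz_op_affine]) auto

text \<open>Expand the square in \<xi> = c (\<eta> + \<kappa>): the terms without \<eta> form a
  constant phase, and the cross term joins the linear part. The division by \<open>pi\<close>
  matches the coefficient 2 s c^2 with the normalisation 2 pi of the linear phase.\<close>

lemma phase_rescale:
  fixes \<xi> x :: "real^'n::finite"
  assumes "a * c = 1"
  shows "phase x s \<xi> = phase (c *\<^sub>R x) (s * c\<^sup>2) \<kappa> * phase (c *\<^sub>R x + (s * c\<^sup>2 / pi) *\<^sub>R \<kappa>) (s * c\<^sup>2) (a *\<^sub>R \<xi> - \<kappa>)"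
proof -
  define \<eta> where "\<eta> = a *\<^sub>R \<xi> - \<kappa>"
  have \<xi>: "\<xi> = c *\<^sub>R (\<eta> + \<kappa>)" using assms by (simp add: \<eta>_def mult.commute)
  have "2 * pi * (x \<bullet> \<xi>) + s * (norm \<xi>)\<^sup>2 = (2 * pi * ((c *\<^sub>R x) \<bullet> \<kappa>) + s * c\<^sup>2 * (norm \<kappa>)\<^sup>2) +
      (2 * pi * ((c *\<^sub>R x + (s * c\<^sup>2 / pi) *\<^sub>R \<kappa>) \<bullet> \<eta>) + s * c\<^sup>2 * (norm \<eta>)\<^sup>2)"
    unfolding \<xi> power2_norm_eq_inner
    by (simp add: inner_add_left inner_add_right inner_commute algebra_simps power2_eq_square)
  then show ?thesis unfolding phase_def \<eta>_def[symmetric] by (simp only: cis_mult)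
qed

text \<open>The constant phase leaves the pairing by linearity and has modulus one. What remains is
  a chirp at unit scale whose frequency is an affine image of \<open>x\<close>.\<close>

lemma norm_rescaled:
  fixes \<psi> :: "real^'n::finite \<Rightarrow> complex"
  assumes u: "tempered u" and \<psi>: "schwartz \<psi>"
  shows "norm (dist_fourier u (\<lambda>\<xi>. \<psi> ((2 powi (- j)) *\<^sub>R \<xi> - of_int_vec k) * phase x s \<xi>)) =
    norm (rescaled j k u (\<lambda>\<eta>. phase ((2 powi j) *\<^sub>R x + (s * (2 powi j)\<^sup>2 / pi) *\<^sub>R of_int_vec k) (s * (2 powi j)\<^sup>2) \<eta> * \<psi> \<eta>))"
proof -
  let ?a = "2 powi (- j) :: real" and ?c = "2 powi j :: real"
  let ?y = "?c *\<^sub>R x + (s * ?c\<^sup>2 / pi) *\<^sub>R of_int_vec k" and ?s = "s * ?c\<^sup>2"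
  define \<theta> where "\<theta> = phase (?c *\<^sub>R x) ?s (of_int_vec k)"
  have ac: "?a * ?c = 1" by (simp add: power_int_minus)
  have "(\<lambda>\<xi>. \<psi> (?a *\<^sub>R \<xi> - of_int_vec k) * phase x s \<xi>) =
     (\<lambda>\<xi>. \<theta> * (phase ?y ?s (?a *\<^sub>R \<xi> - of_int_vec k) * \<psi> (?a *\<^sub>R \<xi> - of_int_vec k)))"
    unfolding phase_rescale[OF ac, of x s _ "of_int_vec k"] \<theta>_def by (simp add: mult_ac)
  moreover have "schwartz (\<lambda>\<xi>. phase ?y ?s (?a *\<^sub>R \<xi> - of_int_vec k) * \<psi> (?a *\<^sub>R \<xi> - of_int_vec k))"
    using schwartz_affine[OF schwartz_phase_mult[OF \<psi>], of ?a] by simp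
  ultimately have "dist_fourier u (\<lambda>\<xi>. \<psi> (?a *\<^sub>R \<xi> - of_int_vec k) * phase x s \<xi>) =
     \<theta> * dist_fourier u (\<lambda>\<xi>. phase ?y ?s (?a *\<^sub>R \<xi> - of_int_vec k) * \<psi> (?a *\<^sub>R \<xi> - of_int_vec k))"
    using tempered_cmult[OF tempered_dist_fourier[OF u]] by simp
  then show ?thesis by (simp add: norm_mult rescaled_def \<theta>_def)
qed

lemma norm_freq_proj:
  fixes \<psi> :: "real^'n::finite \<Rightarrow> complex"
  assumes u: "tempered u" and \<psi>: "schwartz \<psi>"
  shows "norm (freq_proj \<psi> j k u x) = norm (rescaled j k u (\<lambda>\<eta>. phase ((2 powi j) *\<^sub>R x) 0 \<eta> * \<psi> \<eta>))"
  using norm_rescaled[OF u \<psi>, of j k x 0] by (simp add: freq_proj_def phase_def)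

text \<open>All operations act by transposition, so the propagator meets
  \<open>inv_fourier (fourier \<Phi>)\<close>. Inversion for the compactly supported
  \<open>\<Phi>\<close> removes this pair of transforms, and the symbol merges with the character of
  \<open>x\<close>.\<close>

lemma norm_freq_proj_schrodinger:
  fixes \<psi> :: "real^'n::finite \<Rightarrow> complex" and t :: real and j :: int
  assumes u: "tempered u" and \<psi>: "decomposition_function \<psi>"
  defines "s \<equiv> 4 * pi\<^sup>2 * t * (2 powi j)\<^sup>2"
  shows "norm (freq_proj \<psi> j k (schrodinger t u) x) =
    norm (rescaled j k u (\<lambda>\<eta>. phase ((2 powi j) *\<^sub>R x + (s / pi) *\<^sub>R of_int_vec k) s \<eta> * \<psi> \<eta>))"
proof -
  let ?a = "2 powi (- j) :: real" and ?c = "2 powi j :: real"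
  have \<psi>s: "schwartz \<psi>" using \<psi> by (simp add: decomposition_function_def)
  define \<Phi> where "\<Phi> \<xi> = phase x 0 \<xi> * \<psi> (?a *\<^sub>R \<xi> - of_int_vec k)" for \<xi>
  have \<Phi>s: "schwartz \<Phi>"
    unfolding \<Phi>_def[abs_def] by (rule schwartz_phase_mult, rule schwartz_affine[OF \<psi>s]) simp
  have \<Phi>0: "\<bar>\<xi> $ i\<bar> \<le> ?c * (1 + norm (of_int_vec k :: real^'n))" if "\<Phi> \<xi> \<noteq> 0" for \<xi> i
  proof -
    have "\<bar>?a * \<xi> $ i - of_int (k $ i)\<bar> \<le> 1"
      using decomposition_function_support[OF \<psi>, of "?a *\<^sub>R \<xi> - of_int_vec k" i] that by (simp add: \<Phi>_def)
    moreover have "\<bar>real_of_int (k $ i)\<bar> \<le> norm (of_int_vec k :: real^'n)"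
      using component_le_norm_cart[of "of_int_vec k :: real^'n" i] by simp
    ultimately have "\<bar>?a * \<xi> $ i\<bar> \<le> 1 + norm (of_int_vec k :: real^'n)" by linarith
    then have "?c * \<bar>?a * \<xi> $ i\<bar> \<le> ?c * (1 + norm (of_int_vec k :: real^'n))" by (intro mult_left_mono) auto
    moreover have "?c * \<bar>?a * \<xi> $ i\<bar> = \<bar>\<xi> $ i\<bar>" by (simp add: abs_mult power_int_minus)
    ultimately show ?thesis by simp
  qed
  have inv: "inv_fourier (fourier \<Phi>) \<xi> = \<Phi> \<xi>" for \<xi> by (rule inv_fourier_fourier[OF \<Phi>s \<Phi>0])
  have "(\<lambda>\<xi>. \<psi> (?a *\<^sub>R \<xi> - of_int_vec k) * cis (2 * pi * (x \<bullet> \<xi>))) = \<Phi>"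
    by (rule ext) (simp add: \<Phi>_def phase_def)
  then have "freq_proj \<psi> j k (schrodinger t u) x = schrodinger t u (fourier \<Phi>)"
    by (simp only: freq_proj_def dist_fourier_def)
  also have "\<dots> = dist_fourier u (\<lambda>\<xi>. phase 0 (4 * pi\<^sup>2 * t) \<xi> * \<Phi> \<xi>)"
    by (simp add: schrodinger_eq inv dist_fourier_def)
  also have "(\<lambda>\<xi>. phase 0 (4 * pi\<^sup>2 * t) \<xi> * \<Phi> \<xi>) = (\<lambda>\<xi>. \<psi> (?a *\<^sub>R \<xi> - of_int_vec k) * phase x (4 * pi\<^sup>2 * t) \<xi>)"
    unfolding \<Phi>_def mult.assoc[symmetric] phase_mult_phase by (simp add: mult.commute)
  finally show ?thesis using norm_rescaled[OF u \<psi>s, of j k x "4 * pi\<^sup>2 * t"] by (simp add: s_def)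
qed

lemma nn_integral_lborel_affine:
  fixes f :: "real^'n::finite \<Rightarrow> ennreal"
  assumes [measurable]: "f \<in> borel_measurable borel" and c: "c > 0"
  shows "(\<integral>\<^sup>+x. f (c *\<^sub>R x + b) \<partial>lborel) = ennreal (1 / c ^ CARD('n)) * (\<integral>\<^sup>+y. f y \<partial>lborel)"
proof -
  have "(\<integral>\<^sup>+y. f y \<partial>lborel) = (\<integral>\<^sup>+y. f (y + b) \<partial>lborel)"
    by (rule nn_integral_lborel_translation[symmetric]) measurable
  also have "\<dots> = ennreal (c ^ CARD('n)) * (\<integral>\<^sup>+x. f (c *\<^sub>R x + b) \<partial>lborel)"
    using nn_integral_lborel_scaleR[of "\<lambda>y. f (y + b)" c] c by simp
  finally have "ennreal (1 / c ^ CARD('n)) * (\<integral>\<^sup>+y. f y \<partial>lborel) =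
    (ennreal (1 / c ^ CARD('n)) * ennreal (c ^ CARD('n))) * (\<integral>\<^sup>+x. f (c *\<^sub>R x + b) \<partial>lborel)"
    by (simp add: mult.assoc)
  also have "ennreal (1 / c ^ CARD('n)) * ennreal (c ^ CARD('n)) = 1"
    using c by (simp add: ennreal_mult'[symmetric])
  finally show ?thesis by simp
qed

subsection \<open>Assembling the norms\<close>

lemma epowr_mono: "x \<le> y \<Longrightarrow> 0 \<le> a \<Longrightarrow> epowr x a \<le> epowr y a"
  by (auto simp: epowr_def top_unique less_top[symmetric] intro!: ennreal_leI powr_mono2 enn2real_mono)

lemma epowr_cmult:
  assumes "c > 0" "a > 0"
  shows "epowr (ennreal c * x) a = ennreal (c powr a) * epowr x a"
proof (cases "x = \<infinity>")
  case True
  then show ?thesis using assms by (simp add: epowr_def ennreal_mult_top)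
next
  case False
  then have "ennreal c * x \<noteq> \<infinity>" by (simp add: ennreal_mult_eq_top_iff)
  then show ?thesis using False assms
    by (simp add: epowr_def enn2real_mult powr_mult ennreal_mult'[symmetric])
qed

lemma epowr_powr_inverse:
  assumes "c > 0" "a > 0"
  shows "epowr (ennreal (c powr a) * x) (1 / a) = ennreal c * epowr x (1 / a)"
  using assms epowr_cmult[of "c powr a" "1 / a" x] by (simp add: powr_powr)

lemma infsum_cmult_le_ennreal:
  fixes f g :: "'a \<Rightarrow> ennreal"
  assumes "\<And>k. f k \<le> c * g k"
  shows "(\<Sum>\<^sub>\<infinity>k. f k) \<le> c * (\<Sum>\<^sub>\<infinity>k. g k)"
proof -
  have f: "(\<Sum>\<^sub>\<infinity>k. f k) = (SUP F\<in>{F. finite F \<and> F \<subseteq> UNIV}. sum f F)" by (rule nonneg_infsum_complete) simp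
  have g: "(\<Sum>\<^sub>\<infinity>k. g k) = (SUP F\<in>{F. finite F \<and> F \<subseteq> UNIV}. sum g F)" by (rule nonneg_infsum_complete) simp
  show ?thesis unfolding f
  proof (rule SUP_least)
    fix F :: "'a set" assume F: "F \<in> {F. finite F \<and> F \<subseteq> UNIV}"
    have "sum f F \<le> (\<Sum>k\<in>F. c * g k)" by (intro sum_mono assms)
    also have "\<dots> = c * sum g F" by (simp add: sum_distrib_left)
    also have "\<dots> \<le> c * (\<Sum>\<^sub>\<infinity>k. g k)" unfolding g using F by (intro mult_left_mono SUP_upper) auto
    finally show "sum f F \<le> c * (\<Sum>\<^sub>\<infinity>k. g k)" .
  qed
qed

text \<open>Both sides use the same \<open>v\<close> and the same dilation, so the Jacobian cancels,
  and the shift by a multiple of \<open>k\<close> drops out of the integral; the constant is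
  therefore common to all cubes.\<close>

lemma Lp_norm_freq_proj_schrodinger:
  fixes \<psi> :: "real^'n::finite \<Rightarrow> complex"
  assumes \<psi>: "decomposition_function \<psi>" and p: "p \<ge> 1"
  shows "\<exists>C>0. \<forall>t j k u. tempered u \<longrightarrow>
    Lp_norm p (freq_proj \<psi> j k (schrodinger t u)) \<le>
      ennreal (C * (1 + \<bar>4 * pi\<^sup>2 * t * (2 powi j)\<^sup>2\<bar>) powr (real CARD('n) * \<bar>1 / 2 - 1 / p\<bar>)) * Lp_norm p (freq_proj \<psi> j k u)"
proof -
  let ?d = "CARD('n)"
  have \<psi>s: "schwartz \<psi>" using \<psi> by (simp add: decomposition_function_def)
  obtain \<zeta> where \<zeta>: "schwartz \<zeta>" "\<And>x. \<zeta> x \<noteq> 0 \<Longrightarrow> x \<in> interior (cube 8)" "\<And>x. \<psi> x \<noteq> 0 \<Longrightarrow> \<zeta> x = 1"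
    using decomposition_cutoff[OF \<psi>] by blast
  have "\<exists>C>0. \<forall>s v. tempered v \<longrightarrow> (\<lambda>y. v (\<lambda>x. phase y s x * \<psi> x)) \<in> borel_measurable borel \<and>
    (\<integral>\<^sup>+y. ennreal (norm (v (\<lambda>x. phase y s x * \<psi> x)) powr p) \<partial>lborel) \<le>
      ennreal (C * (1 + \<bar>s\<bar>) powr (real ?d / 2 * \<bar>p - 2\<bar>)) * (\<integral>\<^sup>+y. ennreal (norm (v (\<lambda>x. phase y 0 x * \<psi> x)) powr p) \<partial>lborel)"
    by (rule modulation_estimate[OF _ \<zeta>(1,2) \<psi>s \<zeta>(3) p]) simp
  then obtain C where C: "C > 0" "\<And>s v. tempered v \<Longrightarrow> (\<lambda>y. v (\<lambda>x. phase y s x * \<psi> x)) \<in> borel_measurable borel"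
    "\<And>s v. tempered v \<Longrightarrow> (\<integral>\<^sup>+y. ennreal (norm (v (\<lambda>x. phase y s x * \<psi> x)) powr p) \<partial>lborel) \<le>
      ennreal (C * (1 + \<bar>s\<bar>) powr (real ?d / 2 * \<bar>p - 2\<bar>)) * (\<integral>\<^sup>+y. ennreal (norm (v (\<lambda>x. phase y 0 x * \<psi> x)) powr p) \<partial>lborel)"
    by blast
  have "Lp_norm p (freq_proj \<psi> j k (schrodinger t u)) \<le>
      ennreal (C powr (1 / p) * (1 + \<bar>4 * pi\<^sup>2 * t * (2 powi j)\<^sup>2\<bar>) powr (real ?d * \<bar>1 / 2 - 1 / p\<bar>)) * Lp_norm p (freq_proj \<psi> j k u)"
    if u: "tempered u" for t j k and u :: "'n dist"
  proof -
    let ?c = "2 powi j :: real"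
    define s where "s = 4 * pi\<^sup>2 * t * ?c\<^sup>2"
    define v where "v = rescaled j k u"
    have v: "tempered v" unfolding v_def by (rule tempered_rescaled[OF u])
    define f where "f s y = ennreal (norm (v (\<lambda>x. phase y s x * \<psi> x)) powr p)" for s y
    have fm: "f s \<in> borel_measurable borel" for s
      unfolding f_def using C(2)[OF v, of s] by measurable
    define D where "D = C * (1 + \<bar>s\<bar>) powr (real ?d / 2 * \<bar>p - 2\<bar>)"
    have D: "D > 0" using C(1) by (simp add: D_def)
    have c: "?c > 0" by simp
    have "(\<integral>\<^sup>+x. ennreal (norm (freq_proj \<psi> j k (schrodinger t u) x) powr p) \<partial>lborel) =
        (\<integral>\<^sup>+x. f s (?c *\<^sub>R x + (s / pi) *\<^sub>R of_int_vec k) \<partial>lborel)"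
      unfolding norm_freq_proj_schrodinger[OF u \<psi>] f_def v_def s_def by simp
    also have "\<dots> = ennreal (1 / ?c ^ ?d) * (\<integral>\<^sup>+y. f s y \<partial>lborel)"
      by (rule nn_integral_lborel_affine[OF fm c])
    also have "\<dots> \<le> ennreal (1 / ?c ^ ?d) * (ennreal D * (\<integral>\<^sup>+y. f 0 y \<partial>lborel))"
      unfolding f_def D_def by (intro mult_left_mono C(3) v) simp
    also have "\<dots> = ennreal D * (ennreal (1 / ?c ^ ?d) * (\<integral>\<^sup>+y. f 0 y \<partial>lborel))"
      by (simp only: mult.left_commute)
    also have "ennreal (1 / ?c ^ ?d) * (\<integral>\<^sup>+y. f 0 y \<partial>lborel) = (\<integral>\<^sup>+x. f 0 (?c *\<^sub>R x + 0) \<partial>lborel)"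
      by (rule nn_integral_lborel_affine[OF fm c, symmetric])
    also have "\<dots> = (\<integral>\<^sup>+x. ennreal (norm (freq_proj \<psi> j k u x) powr p) \<partial>lborel)"
      unfolding norm_freq_proj[OF u \<psi>s] f_def v_def by simp
    finally have "Lp_norm p (freq_proj \<psi> j k (schrodinger t u)) \<le>
        epowr (ennreal D * (\<integral>\<^sup>+x. ennreal (norm (freq_proj \<psi> j k u x) powr p) \<partial>lborel)) (1 / p)"
      unfolding Lp_norm_def using p by (intro epowr_mono) auto
    also have "\<dots> = ennreal (D powr (1 / p)) * Lp_norm p (freq_proj \<psi> j k u)"
      unfolding Lp_norm_def using D p by (intro epowr_cmult) auto
    \<comment> \<open>Taking the p-th root turns \<open>|p - 2| / 2\<close> into
      \<open>|1 / 2 - 1 / p|\<close>, since \<open>p - 2\<close> is \<open>2 * p\<close> times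
      \<open>1 / 2 - 1 / p\<close>.\<close>
    also have "D powr (1 / p) = C powr (1 / p) * (1 + \<bar>s\<bar>) powr (real ?d * \<bar>1 / 2 - 1 / p\<bar>)"
    proof -
      have "p - 2 = (2 * p) * (1 / 2 - 1 / p)" using p by (simp add: field_simps)
      then have "\<bar>p - 2\<bar> = (2 * p) * \<bar>1 / 2 - 1 / p\<bar>" using p by (simp only: abs_mult)
      then have "real ?d / 2 * \<bar>p - 2\<bar> * (1 / p) = real ?d * \<bar>1 / 2 - 1 / p\<bar>" using p by simp
      then show ?thesis using C(1) by (simp add: D_def powr_mult powr_powr)
    qed
    finally show ?thesis by (simp only: s_def)
  qed
  then show ?thesis using C(1) by (intro exI[of _ "C powr (1 / p)"]) auto
qed

text \<open>The factor is the same for all cubes of one scale, so it passes out of the l^q sum by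
  homogeneity.\<close>

lemma modulation_norm_le:
  assumes q: "q \<ge> 1" and E: "E > 0"
    and le: "\<And>k. Lp_norm p (freq_proj \<psi> j k u') \<le> ennreal E * Lp_norm p (freq_proj \<psi> j k u)"
  shows "modulation_norm \<psi> p q j u' \<le> ennreal E * modulation_norm \<psi> p q j u"
proof -
  have "epowr (Lp_norm p (freq_proj \<psi> j k u')) q \<le> ennreal (E powr q) * epowr (Lp_norm p (freq_proj \<psi> j k u)) q" for k
    using epowr_mono[OF le, of q k] q E by (simp add: epowr_cmult)
  then have "modulation_norm \<psi> p q j u' \<le> epowr (ennreal (E powr q) * (\<Sum>\<^sub>\<infinity>k. epowr (Lp_norm p (freq_proj \<psi> j k u)) q)) (1 / q)"
    unfolding modulation_norm_def using q by (intro epowr_mono infsum_cmult_le_ennreal) auto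
  also have "\<dots> = ennreal E * modulation_norm \<psi> p q j u"
    unfolding modulation_norm_def using q E by (intro epowr_powr_inverse) auto
  finally show ?thesis .
qed

text \<open>The operator factor \<open>E\<close> may vary with the scale; only its product with
  \<sigma> is compared with \<open>w\<close>. If \<open>w j\<close> is zero, so is
  \<open>\<sigma> j\<close>, and the term vanishes even when the local norm is infinite.\<close>

lemma frakM_norm_le:
  assumes r: "r \<ge> 1" and H: "H > 0" and E: "\<And>j. E j > 0" and w: "\<And>j. 0 \<le> w j" and \<sigma>: "\<And>j. 0 \<le> \<sigma> j"
    and le: "\<And>j. modulation_norm \<psi> p q j u' \<le> ennreal (E j) * modulation_norm \<psi> p q j u"
    and wt: "\<And>j. \<sigma> j * E j \<le> H * w j"
  shows "frakM_norm \<psi> p q r \<sigma> u' \<le> ennreal H * frakM_norm \<psi> p q r w u"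
proof -
  have "ennreal (\<sigma> j powr r) * epowr (modulation_norm \<psi> p q j u') r \<le>
      ennreal (H powr r) * (ennreal (w j powr r) * epowr (modulation_norm \<psi> p q j u) r)" for j
  proof -
    let ?X = "epowr (modulation_norm \<psi> p q j u) r"
    have "epowr (modulation_norm \<psi> p q j u') r \<le> ennreal (E j powr r) * ?X"
      using epowr_mono[OF le, of r j] r E[of j] by (simp add: epowr_cmult)
    then have "ennreal (\<sigma> j powr r) * epowr (modulation_norm \<psi> p q j u') r \<le> ennreal (\<sigma> j powr r) * (ennreal (E j powr r) * ?X)"
      by (rule mult_left_mono) simp
    also have "\<dots> = ennreal ((\<sigma> j * E j) powr r) * ?X"
      using \<sigma>[of j] E[of j] by (simp add: mult.assoc[symmetric] ennreal_mult'[symmetric] powr_mult)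
    also have "\<dots> \<le> ennreal ((H * w j) powr r) * ?X"
      using wt[of j] \<sigma>[of j] E[of j] r by (intro mult_right_mono ennreal_leI powr_mono2) auto
    also have "\<dots> = ennreal (H powr r) * (ennreal (w j powr r) * ?X)"
      using H w[of j] by (simp add: mult.assoc[symmetric] ennreal_mult'[symmetric] powr_mult)
    finally show ?thesis .
  qed
  then have "frakM_norm \<psi> p q r \<sigma> u' \<le>
      epowr (ennreal (H powr r) * (\<Sum>\<^sub>\<infinity>j. ennreal (w j powr r) * epowr (modulation_norm \<psi> p q j u) r)) (1 / r)"
    unfolding frakM_norm_def using r by (intro epowr_mono infsum_cmult_le_ennreal) auto
  also have "\<dots> = ennreal H * frakM_norm \<psi> p q r w u"
    unfolding frakM_norm_def using r H by (intro epowr_powr_inverse) auto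
  finally show ?thesis .
qed

text \<open>For \<open>j \<ge> 0\<close> the factor 4^j is at least one and is pulled out of the
  whole bracket; its power is exactly what the weight cancels. For negative \<open>j\<close> it is
  at most one and is dropped.\<close>

lemma schrodinger_weight_le:
  fixes d p t :: real and j :: int
  assumes p: "p \<ge> 1" and d: "d \<ge> 0" and w: "w j \<ge> 0"
  shows "schrodinger_weight d p w j * (1 + \<bar>4 * pi\<^sup>2 * t * (2 powi j)\<^sup>2\<bar>) powr (d * \<bar>1 / 2 - 1 / p\<bar>) \<le>
     (8 * pi\<^sup>2) powr (d * \<bar>1 / 2 - 1 / p\<bar>) * japanese t powr (d * \<bar>1 / 2 - 1 / p\<bar>) * w j"
proof -
  define \<theta> where "\<theta> = d * \<bar>1 / 2 - 1 / p\<bar>"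
  have \<theta>: "\<theta> \<ge> 0" using d by (simp add: \<theta>_def)
  let ?c = "(2 powi j :: real)\<^sup>2"
  have jt: "japanese t \<ge> 1" "japanese t \<ge> \<bar>t\<bar>"
    by (simp_all add: japanese_def real_le_rsqrt)
  have "pi\<^sup>2 \<ge> 1" using pi_ge_two by (intro one_le_power) linarith
  \<comment> \<open>Both 1 and 4 pi^2 |t| are at most 4 pi^2 times \<open>japanese t\<close>, hence
    the constant 8 pi^2.\<close>
  then have G: "1 + 4 * pi\<^sup>2 * \<bar>t\<bar> \<le> 8 * pi\<^sup>2 * japanese t"
  proof -
    have "1 \<le> 4 * pi\<^sup>2 * japanese t" using \<open>pi\<^sup>2 \<ge> 1\<close> jt(1) mult_mono[of 1 "4 * pi\<^sup>2" 1 "japanese t"] by simp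
    moreover have "4 * pi\<^sup>2 * \<bar>t\<bar> \<le> 4 * pi\<^sup>2 * japanese t" using jt(2) by (intro mult_left_mono) auto
    moreover have "8 * pi\<^sup>2 * japanese t = 4 * pi\<^sup>2 * japanese t + 4 * pi\<^sup>2 * japanese t" by simp
    ultimately show ?thesis by (simp only: add_mono)
  qed
  have abs: "\<bar>4 * pi\<^sup>2 * t * ?c\<bar> = 4 * pi\<^sup>2 * \<bar>t\<bar> * ?c" by (simp add: abs_mult)
  show ?thesis
  proof (cases "j \<ge> 0")
    case True
    have c1: "?c \<ge> 1" using True by (intro one_le_power one_le_power_int) auto
    have c: "?c = 2 powr (2 * of_int j)"
    proof -
      have "(2 powi j :: real) = 2 powr of_int j" by (simp add: powr_real_of_int')
      then show ?thesis by (simp only: power2_eq_square powr_add[symmetric] mult_2)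
    qed
    have "1 + \<bar>4 * pi\<^sup>2 * t * ?c\<bar> \<le> (1 + 4 * pi\<^sup>2 * \<bar>t\<bar>) * ?c"
      unfolding abs using c1 by (simp add: distrib_right)
    also have "\<dots> \<le> (8 * pi\<^sup>2 * japanese t) * ?c" using G c1 by (intro mult_right_mono) auto
    finally have "(1 + \<bar>4 * pi\<^sup>2 * t * ?c\<bar>) powr \<theta> \<le> ((8 * pi\<^sup>2 * japanese t) * ?c) powr \<theta>"
      using \<theta> by (intro powr_mono2) auto
    also have "\<dots> = (8 * pi\<^sup>2) powr \<theta> * japanese t powr \<theta> * 2 powr (2 * of_int j * \<theta>)"
      using jt(1) by (simp add: powr_mult c powr_powr)
    also have "2 * of_int j * \<theta> = of_int j * d * \<bar>1 - 2 / p\<bar>"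
    proof -
      have "1 - 2 / p = 2 * (1 / 2 - 1 / p)" by (simp add: right_diff_distrib)
      then have "\<bar>1 - 2 / p\<bar> = 2 * \<bar>1 / 2 - 1 / p\<bar>" by (simp only: abs_mult abs_numeral)
      then show ?thesis by (simp only: \<theta>_def mult_ac)
    qed
    finally have le: "(1 + \<bar>4 * pi\<^sup>2 * t * ?c\<bar>) powr \<theta> \<le> (8 * pi\<^sup>2) powr \<theta> * japanese t powr \<theta> * 2 powr (of_int j * d * \<bar>1 - 2 / p\<bar>)" .
    have "schrodinger_weight d p w j * (1 + \<bar>4 * pi\<^sup>2 * t * ?c\<bar>) powr \<theta> \<le>
      (2 powr (- of_int j * d * \<bar>1 - 2 / p\<bar>) * w j) * ((8 * pi\<^sup>2) powr \<theta> * japanese t powr \<theta> * 2 powr (of_int j * d * \<bar>1 - 2 / p\<bar>))"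
    proof -
      have "schrodinger_weight d p w j = 2 powr (- of_int j * d * \<bar>1 - 2 / p\<bar>) * w j"
        using True by (simp add: schrodinger_weight_def)
      then show ?thesis using mult_left_mono[OF le, of "schrodinger_weight d p w j"] w by simp
    qed
    also have "\<dots> = (2 powr (- of_int j * d * \<bar>1 - 2 / p\<bar>) * 2 powr (of_int j * d * \<bar>1 - 2 / p\<bar>)) * ((8 * pi\<^sup>2) powr \<theta> * japanese t powr \<theta> * w j)"
      by (simp only: mult_ac)
    also have "2 powr (- of_int j * d * \<bar>1 - 2 / p\<bar>) * 2 powr (of_int j * d * \<bar>1 - 2 / p\<bar>) = (1::real)"
      by (simp add: powr_add[symmetric])
    finally show ?thesis by (simp only: mult_1_left \<theta>_def)
  next
    case False
    then have c1: "?c \<le> 1" using power_int_increasing[of j 0 "2::real"] by (intro power_le_one) auto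
    have "4 * pi\<^sup>2 * \<bar>t\<bar> * ?c \<le> 4 * pi\<^sup>2 * \<bar>t\<bar>" using c1 by (intro mult_left_le) auto
    then have "1 + \<bar>4 * pi\<^sup>2 * t * ?c\<bar> \<le> 8 * pi\<^sup>2 * japanese t" unfolding abs using G by linarith
    then have "(1 + \<bar>4 * pi\<^sup>2 * t * ?c\<bar>) powr \<theta> \<le> (8 * pi\<^sup>2 * japanese t) powr \<theta>"
      using \<theta> by (intro powr_mono2) auto
    also have "\<dots> = (8 * pi\<^sup>2) powr \<theta> * japanese t powr \<theta>" using jt(1) by (simp add: powr_mult)
    finally have le: "w j * (1 + \<bar>4 * pi\<^sup>2 * t * ?c\<bar>) powr \<theta> \<le> w j * ((8 * pi\<^sup>2) powr \<theta> * japanese t powr \<theta>)"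
      using w by (rule mult_left_mono)
    have eq: "schrodinger_weight d p w j = w j" using False by (simp add: schrodinger_weight_def)
    show ?thesis unfolding eq \<theta>_def[symmetric] mult.commute[of _ "w j"] by (rule le)
  qed
qed

theorem mainTheorem3:
  fixes \<psi> :: "real^'n \<Rightarrow> complex"
    and p q r d :: real
    and w \<sigma> :: "int \<Rightarrow> real"
  assumes d: "d = real CARD('n)"
    and psi: "decomposition_function \<psi>"
    and exponents: "1 \<le> p" "1 \<le> q" "1 \<le> r"
    and w_nonneg: "\<And>j. 0 \<le> w j"
    and w_bound: "\<exists>\<epsilon>>0. \<exists>A. \<forall>j.
      (j \<ge> 0 \<longrightarrow> w j \<le> A * 2 powr (- \<epsilon> * of_int j)) \<and>
      (j < 0 \<longrightarrow> w j \<le> A * 2 powr (- (d * inverse_conj p - d / q - \<epsilon>) * of_int j))"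
    and sigma: "\<sigma> = schrodinger_weight d p w"
  shows "(\<forall>t. schrodinger t \<in> frakM \<psi> p q r w \<rightarrow> frakM \<psi> p q r \<sigma>) \<and>
    (\<exists>C>0. \<forall>t. \<forall>u \<in> frakM \<psi> p q r w.
      frakM_norm \<psi> p q r \<sigma> (schrodinger t u)
        \<le> ennreal (C * japanese t powr (d * \<bar>1 / 2 - 1 / p\<bar>)) * frakM_norm \<psi> p q r w u)"
proof -
  let ?\<theta> = "d * \<bar>1 / 2 - 1 / p\<bar>"
  let ?G = "\<lambda>t j. (1 + \<bar>4 * pi\<^sup>2 * t * (2 powi j)\<^sup>2\<bar>) powr ?\<theta>"
  obtain C where C: "C > 0" "\<And>t j k u. tempered u \<Longrightarrow> Lp_norm p (freq_proj \<psi> j k (schrodinger t u)) \<le>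
      ennreal (C * ?G t j) * Lp_norm p (freq_proj \<psi> j k u)"
    using Lp_norm_freq_proj_schrodinger[OF psi exponents(1)] unfolding d by blast
  define C' where "C' = C * (8 * pi\<^sup>2) powr ?\<theta>"
  have C': "C' > 0" using C(1) by (simp add: C'_def)
  have jt: "japanese t > 0" for t by (simp add: japanese_def add_pos_nonneg)
  have G: "1 + \<bar>x\<bar> > (0::real)" for x by simp
  \<comment> \<open>The inequality is proved for every tempered \<open>u\<close>, with infinite
    norms allowed; membership in the target space then follows from finiteness of the right
    side.\<close>
  have main: "frakM_norm \<psi> p q r \<sigma> (schrodinger t u) \<le> ennreal (C' * japanese t powr ?\<theta>) * frakM_norm \<psi> p q r w u"
    if u: "tempered u" for t u
  proof (rule frakM_norm_le[where E = "\<lambda>j. C * ?G t j"])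
    show "0 \<le> \<sigma> j" for j using w_nonneg by (simp add: sigma schrodinger_weight_def)
    show E: "C * ?G t j > 0" for j using C(1) G by (simp add: less_imp_neq[OF G, symmetric])
    show "modulation_norm \<psi> p q j (schrodinger t u) \<le> ennreal (C * ?G t j) * modulation_norm \<psi> p q j u" for j
      by (rule modulation_norm_le[OF exponents(2) E C(2)[OF u]])
    show "\<sigma> j * (C * ?G t j) \<le> (C' * japanese t powr ?\<theta>) * w j" for j
      using mult_left_mono[OF schrodinger_weight_le[OF exponents(1), of d w j t], of C] w_nonneg C(1)
      by (simp add: sigma C'_def d mult_ac)
  qed (use C' jt w_nonneg exponents in \<open>auto simp: less_imp_neq[symmetric]\<close>)
  have "schrodinger t u \<in> frakM \<psi> p q r \<sigma>" if "u \<in> frakM \<psi> p q r w" for t u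
  proof -
    have u: "tempered u" "frakM_norm \<psi> p q r w u < \<infinity>" using that by (auto simp: frakM_def)
    have "frakM_norm \<psi> p q r \<sigma> (schrodinger t u) < \<infinity>"
      by (rule le_less_trans[OF main[OF u(1)]]) (use u(2) in \<open>auto simp: ennreal_mult_less_top\<close>)
    then show ?thesis using tempered_schrodinger[OF u(1)] by (simp add: frakM_def)
  qed
  moreover have "frakM_norm \<psi> p q r \<sigma> (schrodinger t u) \<le> ennreal (C' * japanese t powr ?\<theta>) * frakM_norm \<psi> p q r w u"
    if "u \<in> frakM \<psi> p q r w" for t u
    using that main by (simp add: frakM_def)
  ultimately show ?thesis using C' by blast
qed

end
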